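(* For each integer $N\ge 1$ let $m_N=100N$, and let $X=(X_1,\dots,X_{m_N})$ be the Gaussian random vector obtained by concatenating, in this order, the three coordinate blocks $$X_i^{(0)}=\frac{3}{10}Z+\frac{\sqrt{91}}{10}\varepsilon_i,\qquad 1\le i\le 96N,$$ $$X_j^{(1)}=\frac{12}{5}-\frac{3}{10}Z+\frac{\sqrt{91}}{10}\eta_j,\qquad 1\le j\le N,$$ $$X_k^{(2)}=\frac{22}{5}-\frac{18}{25}Z+\frac{\sqrt{301}}{25}\xi_k,\qquad 1\le k\le 3N,$$ where $Z,(\varepsilon_i)_{i\ge1},(\eta_j)_{j\ge1},(\xi_k)_{k\ge1}$ are mutually independent standard normal random variables. The first $96N$ hypotheses (the first block) are the true nulls, and the remaining $4N$ are nonnulls. Let $\mathrm{FDR}_N$ denote the false discovery rate, in this model, of the Benjamini--Hochberg procedure at level $\alpha=0.01$ applied to the two-sided $p$-values $P_i=2(1-\Phi(|X_i|))$, $1\le i\le m_N$. Then for all sufficiently large $N$, $$\mathrm{FDR}_N>0.0104>\alpha=0.01 .$$ Consequently, the following assertion is false: "for every $m\ge1$, every mean vector $\mu\in\mathbb{R}^m$, every $m\times m$ correlation matrix $\Sigma$, and every $\alpha\in(0,1)$, if $X\sim\mathcal{N}_m(\mu,\Sigma)$, then the Benjamini--Hochberg procedure at level $\alpha$ applied to the two-sided $p$-values $P_i=2(1-\Phi(|X_i|))$ for the hypotheses $H_i:\mu_i=0$ satisfies $\mathrm{FDR}\le\alpha$."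
   Context: $\Phi$ is the standard normal cumulative distribution function. Let $X\sim\mathcal{N}_m(\mu,\Sigma)$ with $\Sigma$ a correlation matrix (a covariance matrix with unit diagonal), and consider the hypotheses $H_i:\mu_i=0$, $1\le i\le m$, with two-sided $p$-values $P_i=2(1-\Phi(|X_i|))$. The Benjamini--Hochberg (BH) procedure at level $\alpha\in(0,1)$ uses the critical values $t_r=\alpha r/m$. Let $$R=\max\{r\in\{1,\dots,m\}:\#\{i:P_i\le t_r\}\ge r\},$$ with $R=0$ if the set is empty. The procedure rejects those hypotheses $H_i$ with $P_i\le t_R$ (no rejections if $R=0$). Let $I_0=\{i:\mu_i=0\}$ be the set of true nulls and let $V=\#\{i\in I_0:P_i\le t_R\}$ be the number of false rejections ($V=0$ if $R=0$). The false discovery proportion is $\mathrm{FDP}=V/\max(R,1)$ and the false discovery rate is $\mathrm{FDR}=\mathbb{E}[\mathrm{FDP}]$. *)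

theory Defs
  imports "HOL-Probability.Probability"
begin

text \<open>
  Vectors in \<open>\<real>\<^sup>m\<close> and \<open>m \<times> m\<close> matrices, with \<open>m\<close> a variable, are functions on \<open>nat\<close>
  of which only the values at indices below \<open>m\<close> matter; the coordinates are numbered
  \<open>0, \<dots>, m - 1\<close> instead of \<open>1, \<dots>, m\<close>.
\<close>

definition Phi :: "real \<Rightarrow> real" where
  "Phi = cdf std_normal_distribution"

definition p_value :: "real \<Rightarrow> real" where
  "p_value x = 2 * (1 - Phi \<bar>x\<bar>)"


subsection \<open>The Benjamini--Hochberg procedure and its false discovery rate\<close>

definition bh_critical :: "real \<Rightarrow> nat \<Rightarrow> nat \<Rightarrow> real" where
  "bh_critical \<alpha> m r = \<alpha> * real r / real m"

definition bh_R :: "real \<Rightarrow> nat \<Rightarrow> (nat \<Rightarrow> real) \<Rightarrow> nat" where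
  "bh_R \<alpha> m p =
    (let S = {r \<in> {1..m}. card {i. i < m \<and> p i \<le> bh_critical \<alpha> m r} \<ge> r}
     in if S = {} then 0 else Max S)"

definition bh_rejected :: "real \<Rightarrow> nat \<Rightarrow> (nat \<Rightarrow> real) \<Rightarrow> nat set" where
  "bh_rejected \<alpha> m p =
    (if bh_R \<alpha> m p = 0 then {}
     else {i. i < m \<and> p i \<le> bh_critical \<alpha> m (bh_R \<alpha> m p)})"

definition bh_V :: "real \<Rightarrow> nat \<Rightarrow> nat set \<Rightarrow> (nat \<Rightarrow> real) \<Rightarrow> nat" where
  "bh_V \<alpha> m I0 p = card (I0 \<inter> bh_rejected \<alpha> m p)"

definition bh_FDP :: "real \<Rightarrow> nat \<Rightarrow> nat set \<Rightarrow> (nat \<Rightarrow> real) \<Rightarrow> real" where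
  "bh_FDP \<alpha> m I0 p = real (bh_V \<alpha> m I0 p) / real (max (bh_R \<alpha> m p) 1)"

text \<open>\<open>I0\<close> is the set of true nulls and \<open>X\<close> the vector of test statistics.\<close>

definition bh_FDR ::
  "'w measure \<Rightarrow> real \<Rightarrow> nat \<Rightarrow> nat set \<Rightarrow> (nat \<Rightarrow> 'w \<Rightarrow> real) \<Rightarrow> real" where
  "bh_FDR M \<alpha> m I0 X =
    prob_space.expectation M (\<lambda>\<omega>. bh_FDP \<alpha> m I0 (\<lambda>i. p_value (X i \<omega>)))"

definition true_nulls :: "nat \<Rightarrow> (nat \<Rightarrow> real) \<Rightarrow> nat set" where
  "true_nulls m \<mu> = {i. i < m \<and> \<mu> i = 0}"


subsection \<open>Multivariate normal vectors\<close>

definition correlation_matrix :: "nat \<Rightarrow> (nat \<Rightarrow> nat \<Rightarrow> real) \<Rightarrow> bool" where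
  "correlation_matrix m \<Sigma> \<longleftrightarrow>
    (\<forall>i<m. \<forall>j<m. \<Sigma> i j = \<Sigma> j i) \<and>
    (\<forall>a :: nat \<Rightarrow> real. 0 \<le> (\<Sum>i<m. \<Sum>j<m. a i * \<Sigma> i j * a j)) \<and>
    (\<forall>i<m. \<Sigma> i i = 1)"

text \<open>The univariate normal law with variance \<open>v\<close>; for \<open>v = 0\<close> it is a point mass.\<close>

definition normal_variable :: "'w measure \<Rightarrow> ('w \<Rightarrow> real) \<Rightarrow> real \<Rightarrow> real \<Rightarrow> bool" where
  "normal_variable M Y c v \<longleftrightarrow>
    Y \<in> borel_measurable M \<and>
    (if v = 0 then (AE \<omega> in M. Y \<omega> = c)
     else v > 0 \<and> distributed M lborel Y (normal_density c (sqrt v)))"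

text \<open>
  \<open>X\<close> has law \<open>\<N>\<^sub>m(\<mu>, \<Sigma>)\<close>, with \<open>\<Sigma>\<close> possibly singular: every linear combination of the
  coordinates is univariate normal with the corresponding mean and variance.
\<close>

definition multivariate_normal ::
  "'w measure \<Rightarrow> nat \<Rightarrow> (nat \<Rightarrow> 'w \<Rightarrow> real) \<Rightarrow> (nat \<Rightarrow> real) \<Rightarrow> (nat \<Rightarrow> nat \<Rightarrow> real) \<Rightarrow> bool"
where
  "multivariate_normal M m X \<mu> \<Sigma> \<longleftrightarrow>
    (\<forall>i<m. X i \<in> borel_measurable M) \<and>
    (\<forall>a :: nat \<Rightarrow> real.
      normal_variable M (\<lambda>\<omega>. \<Sum>i<m. a i * X i \<omega>)
        (\<Sum>i<m. a i * \<mu> i) (\<Sum>i<m. \<Sum>j<m. a i * \<Sigma> i j * a j))"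


subsection \<open>The three-block model\<close>

text \<open>
  \<open>Common\<close> indexes the shared variable \<open>Z\<close>; \<open>Eps i\<close>, \<open>Eta j\<close>, \<open>Xi k\<close> index the
  idiosyncratic noises \<open>\<epsilon>\<close>, \<open>\<eta>\<close>, \<open>\<xi>\<close> of the three blocks.
\<close>

datatype source = Common | Eps nat | Eta nat | Xi nat

definition iid_std_normal :: "'w measure \<Rightarrow> ('i \<Rightarrow> 'w \<Rightarrow> real) \<Rightarrow> bool" where
  "iid_std_normal M W \<longleftrightarrow>
    prob_space.indep_vars M (\<lambda>_. borel) W UNIV \<and>
    (\<forall>k. distributed M lborel (W k) std_normal_density)"

definition block_X :: "nat \<Rightarrow> (source \<Rightarrow> 'w \<Rightarrow> real) \<Rightarrow> nat \<Rightarrow> 'w \<Rightarrow> real" where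
  "block_X N W i \<omega> =
    (if i < 96 * N then
       3 / 10 * W Common \<omega> + sqrt 91 / 10 * W (Eps i) \<omega>
     else if i < 97 * N then
       12 / 5 - 3 / 10 * W Common \<omega> + sqrt 91 / 10 * W (Eta (i - 96 * N)) \<omega>
     else
       22 / 5 - 18 / 25 * W Common \<omega> + sqrt 301 / 25 * W (Xi (i - 97 * N)) \<omega>)"

end

theory Submission
  imports Defs "HOL-Real_Asymp.Real_Asymp"
begin

text \<open>
  Write \<open>Q = 1 - \<Phi>\<close>. Given the common factor \<open>Z = z\<close> the statistics are independent, so for large
  \<open>N\<close> the fraction of them that exceed \<open>u\<close> in absolute value is close to an explicit function
  \<open>reject_rate z u\<close>. On the scale of \<open>\<bar>x\<bar>\<close> the Benjamini--Hochberg threshold is then close to the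
  smallest \<open>u\<close> with \<open>\<alpha> * reject_rate z u \<ge> 2 * Q u\<close>, and at this point \<open>u(z)\<close> the false discovery
  proportion is close to \<open>\<alpha> * 96/100 * null_rate z u / (2 * Q u)\<close>, where \<open>null_rate z\<close> is the
  conditional two-sided tail of one null statistic. For a threshold that does not depend on \<open>z\<close>, the
  average of this expression over \<open>Z\<close> is exactly \<open>96/100 * \<alpha> = 0.0096\<close>. The nonnulls load
  negatively on \<open>Z\<close>: when \<open>Z\<close> is large they move towards \<open>0\<close> while the nulls move away from it, the
  threshold becomes extreme, and what little is rejected consists to a large part of nulls. Averaging with the true
  \<open>u(z)\<close> gives approximately \<open>0.0116\<close>.

  The gap to \<open>0.0104\<close> is more than ten percent, so that crude bounds on \<open>u(z)\<close> suffice, since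
  \<open>null_rate z u / Q u\<close> depends only weakly on \<open>u\<close>. The \<open>z\<close>-axis is cut into twenty-two cells (the
  parts far out and a short piece where \<open>u(z)\<close> jumps are given up). On each cell \<open>u(z)\<close> is enclosed
  in one interval. Its right end is justified by one tail inequality (\<open>reject_rate_lower\<close>), its left end
  by a bound for \<open>reject_rate z u / Q u\<close> that is uniform in all smaller \<open>u\<close> (\<open>tail_le_tail_ratio_bound\<close>).
  Inside the interval the ratio \<open>Q ((u - c) / s) / Q u\<close> is quasiconcave in \<open>u\<close>
  (\<open>tail_ratio_quasiconcave\<close>), hence at least its value at one of the ends; the likelihood ratio is
  monotone in \<open>c\<close>, so that the same end works on the whole cell
  (\<open>tail_monotone_likelihood_ratio\<close>). Finally the integral over the cell is at least its
  midpoint approximation, up to an explicit factor (\<open>midpoint_lower_bound\<close>). The finitely many numerical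
  inequalities are decided by fixed-point interval arithmetic; the contributions add up to
  \<open>0.01043\<close>.

  The passage from the limit to finite \<open>N\<close> is pathwise. When the empirical distribution
  functions of the three families of noise variables are uniformly close to \<open>\<Phi>\<close>, the empirical
  rejection rates are close to \<open>reject_rate z\<close> for all \<open>z\<close> and \<open>u\<close> at once, and the lower bound for the
  false discovery proportion holds pointwise (\<open>bh_FDP_lower_bound\<close>, \<open>block_model_FDP_lower\<close>). By
  Hoeffding's inequality on a finite grid this event has probability tending to \<open>1\<close>, at a rate that
  is the same for every probability space (\<open>uniform_empirical_deviation\<close>).

  The universal assertion is refuted by realising the model on an infinite product of standard normal
  laws: the block vector is a linear image of independent normal variables with unit variances, so
  it is multivariate normal with a correlation matrix as covariance.
\<close>

section \<open>Gaussian tails\<close>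

definition Q :: "real \<Rightarrow> real" where "Q x = 1 - Phi x"

lemma Phi_has_derivative: "(Phi has_real_derivative std_normal_density x) (at x)"
proof -
  interpret N: prob_space std_normal_distribution
    by (rule prob_space_normal_density) simp
  define I where "I y = integral {x - 1..y} std_normal_density" for y
  have cont: "continuous_on {x - 1..x + 1} std_normal_density"
    unfolding normal_density_def by (intro continuous_intros) auto
  have der: "(I has_real_derivative std_normal_density x) (at x)"
  proof -
    have "(I has_real_derivative std_normal_density x) (at x within {x - 1..x + 1})"
      unfolding I_def by (rule integral_has_real_derivative[OF cont]) auto
    thus ?thesis by (simp add: at_within_Icc_at)
  qed
  have eq: "Phi y = Phi (x - 1) + I y" if "y \<in> {x - 1<..<x + 1}" for y
  proof -
    have un: "{..y} = {..x - 1} \<union> {x - 1<..y}" using that by auto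
    have "Phi y = measure std_normal_distribution {..x - 1} + measure std_normal_distribution {x - 1<..y}"
      unfolding Phi_def cdf_def un by (rule N.finite_measure_Union) auto
    also have "measure std_normal_distribution {x - 1<..y} = (LINT t|lborel. indicator {x - 1<..y} t * std_normal_density t)"
    proof -
      have "measure std_normal_distribution {x - 1<..y}
          = (LINT t|std_normal_distribution. indicator {x - 1<..y} t)" by simp
      also have "\<dots> = (LINT t|lborel. indicator {x - 1<..y} t * std_normal_density t)"
        by (subst integral_density) (auto simp: mult.commute)
      finally show ?thesis .
    qed
    also have "\<dots> = set_lebesgue_integral lborel {x - 1<..y} std_normal_density"
      by (simp add: set_lebesgue_integral_def)
    also have "\<dots> = set_lebesgue_integral lborel {x - 1..y} std_normal_density"
      by (rule set_integral_cong_set) (auto simp: set_borel_measurable_def intro!: AE_I'[of "{x - 1}"])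
    also have "\<dots> = I y"
      unfolding I_def using that
      by (intro set_borel_integral_eq_integral(2)) (auto simp: set_integrable_def intro!: integrable_mult_indicator[where 'b=real, simplified])
    finally show ?thesis by (simp add: Phi_def cdf_def)
  qed
  have "((\<lambda>y. Phi (x - 1) + I y) has_real_derivative std_normal_density x) (at x)"
    using der by (auto intro!: derivative_eq_intros)
  thus ?thesis
    by (rule has_field_derivative_transform_within_open[where S = "{x - 1<..<x + 1}"]) (auto simp: eq)
qed

lemma Q_has_derivative [derivative_intros]:
  assumes "(f has_real_derivative f') (at x within S)"
  shows "((\<lambda>x. Q (f x)) has_real_derivative - (std_normal_density (f x) * f')) (at x within S)"
proof -
  have "(Q has_real_derivative - std_normal_density (f x)) (at (f x))"
    unfolding Q_def[abs_def] by (auto intro!: derivative_eq_intros Phi_has_derivative)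
  from DERIV_chain2[OF this assms] show ?thesis by simp
qed

lemma std_normal_density_has_derivative [derivative_intros]:
  assumes "(f has_real_derivative f') (at x within S)"
  shows "((\<lambda>x. std_normal_density (f x)) has_real_derivative
          - (f x * std_normal_density (f x) * f')) (at x within S)"
  unfolding std_normal_density_def
  by (rule derivative_eq_intros assms refl | simp)+

lemma continuous_on_Q [continuous_intros]:
  assumes "continuous_on S f"
  shows "continuous_on S (\<lambda>x. Q (f x))"
proof (rule continuous_on_compose2[OF _ assms])
  show "continuous_on UNIV Q"
    by (intro continuous_at_imp_continuous_on ballI DERIV_isCont[OF Q_has_derivative[OF DERIV_ident]])
qed simp

lemma continuous_on_std_normal_density [continuous_intros]:
  assumes "continuous_on S f"
  shows "continuous_on S (\<lambda>x. std_normal_density (f x))"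
  unfolding std_normal_density_def by (intro continuous_intros assms) auto

lemma Q_tendsto_0: "(Q \<longlongrightarrow> 0) at_top"
proof -
  interpret N: real_distribution std_normal_distribution by (rule real_dist_normal_dist)
  have "(Phi \<longlongrightarrow> 1) at_top" unfolding Phi_def by (rule N.cdf_lim_at_top_prob)
  from tendsto_diff[OF tendsto_const[of 1] this] show ?thesis by (simp add: Q_def[abs_def])
qed

text \<open>The comparisons of Gaussian tails below are instances of this principle: both sides
  vanish at infinity, and the sign of the derivative of the difference is elementary.\<close>

lemma nonneg_if_decreasing_to_0:
  fixes f :: "real \<Rightarrow> real"
  assumes "\<And>x. x \<ge> a \<Longrightarrow> (f has_real_derivative f' x) (at x)"
    and "\<And>x. x \<ge> a \<Longrightarrow> f' x \<le> 0"
    and "(f \<longlongrightarrow> 0) at_top"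
  shows "f a \<ge> 0"
proof (rule tendsto_upperbound[OF assms(3)])
  show "eventually (\<lambda>x. f x \<le> f a) at_top"
    using eventually_ge_at_top[of a]
  proof eventually_elim
    case (elim x)
    show ?case
      by (rule DERIV_nonpos_imp_nonincreasing[OF elim]) (use assms in blast)
  qed
qed simp

lemma Q_pos: "Q x > 0"
proof -
  have le: "Q y \<ge> 0" for y
    by (rule nonneg_if_decreasing_to_0[where f = Q and f' = "\<lambda>x. - std_normal_density x"])
       (auto intro!: derivative_eq_intros Q_tendsto_0)
  have "Q (x + 1) < Q x"
    by (rule DERIV_neg_imp_decreasing) 
       (auto intro!: exI derivative_eq_intros simp: normal_density_pos)
  with le[of "x + 1"] show ?thesis by simp
qed

lemma Q_strict_antimono: "x < y \<Longrightarrow> Q y < Q x"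
  by (rule DERIV_neg_imp_decreasing) (auto intro!: exI derivative_eq_intros simp: normal_density_pos)

lemma Q_antimono: "x \<le> y \<Longrightarrow> Q y \<le> Q x"
  using Q_strict_antimono[of x y] by (cases "x = y") auto

lemma Q_uminus: "Q (- x) = 1 - Q x"
proof -
  have c: "((\<lambda>x. Q x + Q (- x)) has_real_derivative 0) (at x)" for x
    by (auto intro!: derivative_eq_intros simp: std_normal_density_def)
  have "Q x + Q (- x) = Q y + Q (- y)" for y
    using DERIV_isconst_all[of "\<lambda>x. Q x + Q (- x)"] c by blast
  hence eq: "Q x + Q (- x) = Q y + Q (- y)" for y .
  interpret N: real_distribution std_normal_distribution by (rule real_dist_normal_dist)
  have "(Phi \<longlongrightarrow> 0) at_bot" unfolding Phi_def by (rule N.cdf_lim_at_bot)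
  hence "((\<lambda>y. Phi (- y)) \<longlongrightarrow> 0) at_top"
    by (simp add: filterlim_at_bot_mirror)
  from tendsto_add[OF Q_tendsto_0 tendsto_diff[OF tendsto_const[of 1] this]]
  have "((\<lambda>y. Q y + Q (- y)) \<longlongrightarrow> 1) at_top" by (simp add: Q_def[abs_def])
  hence "((\<lambda>y. Q x + Q (- x)) \<longlongrightarrow> 1) (at_top :: real filter)" by (subst (asm) eq[symmetric])
  hence "Q x + Q (- x) = 1" by (simp add: tendsto_const_iff)
  thus ?thesis by simp
qed

lemma Q_0: "Q 0 = 1 / 2" using Q_uminus[of 0] by simp

lemma Q_lt_1: "Q x < 1" using Q_uminus[of x] Q_pos[of "- x"] by simp

lemma tendsto_density_times_0:
  assumes "(g \<longlongrightarrow> 0) at_top"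
  shows "((\<lambda>x. std_normal_density x * g x) \<longlongrightarrow> 0) at_top"
proof (rule Lim_null_comparison)
  show "eventually (\<lambda>x. norm (std_normal_density x * g x) \<le> \<bar>g x\<bar>) at_top"
  proof (intro always_eventually allI)
    fix x
    have "sqrt (2 * pi) \<ge> 1" using pi_ge_two by (intro real_le_rsqrt) auto
    hence "std_normal_density x \<le> 1"
      unfolding std_normal_density_def by (intro mult_le_one) (auto simp: field_simps)
    thus "norm (std_normal_density x * g x) \<le> \<bar>g x\<bar>"
      by (simp add: abs_mult mult_left_le_one_le)
  qed
  show "((\<lambda>x. \<bar>g x\<bar>) \<longlongrightarrow> 0) at_top" using assms by (rule tendsto_rabs_zero)
qed

text \<open>The rational factors here and in the next lemma are convergents of Laplace's continued fraction
  for Mills' ratio. The derivative of the difference of the two sides is the density times a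
  constant multiple of a squared reciprocal, so its sign is evident.\<close>

lemma Mills_upper:
  assumes "x > 0"
  shows "Q x \<le> std_normal_density x * ((x\<^sup>2 + 2) / (x * (x\<^sup>2 + 3)))"
proof -
  define g where "g x = (x\<^sup>2 + 2) / (x * (x\<^sup>2 + 3))" for x :: real
  have "std_normal_density x * g x - Q x \<ge> 0"
  proof (rule nonneg_if_decreasing_to_0[where a = x and f = "\<lambda>x. std_normal_density x * g x - Q x"
        and f' = "\<lambda>t. std_normal_density t * (- 6 / (t * (t\<^sup>2 + 3))\<^sup>2)"])
    fix t assume "t \<ge> x"
    with assms have t: "t > 0" "t\<^sup>2 + 3 > 0" by (auto intro: add_nonneg_pos)
    have "((\<lambda>t. t\<^sup>2 + 2) has_real_derivative 2 * t) (at t)"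
      "((\<lambda>t. t * (t\<^sup>2 + 3)) has_real_derivative 3 * t\<^sup>2 + 3) (at t)"
      by (auto intro!: derivative_eq_intros simp: power2_eq_square algebra_simps)
    from DERIV_divide[OF this] have "(g has_real_derivative
        (2 * t * (t * (t\<^sup>2 + 3)) - (t\<^sup>2 + 2) * (3 * t\<^sup>2 + 3))
          / ((t * (t\<^sup>2 + 3)) * (t * (t\<^sup>2 + 3)))) (at t)"
      using t by (simp add: g_def[abs_def])
    also have "(2 * t * (t * (t\<^sup>2 + 3)) - (t\<^sup>2 + 2) * (3 * t\<^sup>2 + 3))
          / ((t * (t\<^sup>2 + 3)) * (t * (t\<^sup>2 + 3))) = t * g t - 1 - 6 / (t * (t\<^sup>2 + 3))\<^sup>2"
      unfolding g_def using t by (simp add: divide_simps) algebra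
    finally have "(g has_real_derivative t * g t - 1 - 6 / (t * (t\<^sup>2 + 3))\<^sup>2) (at t)" .
    thus "((\<lambda>x. std_normal_density x * g x - Q x) has_real_derivative
       std_normal_density t * (- 6 / (t * (t\<^sup>2 + 3))\<^sup>2)) (at t)"
      by (auto intro!: derivative_eq_intros simp: algebra_simps)
    show "std_normal_density t * (- 6 / (t * (t\<^sup>2 + 3))\<^sup>2) \<le> 0"
      by (intro mult_nonneg_nonpos) auto
  next
    have "(g \<longlongrightarrow> 0) at_top" unfolding g_def by real_asymp
    from tendsto_diff[OF tendsto_density_times_0[OF this] Q_tendsto_0]
    show "((\<lambda>x. std_normal_density x * g x - Q x) \<longlongrightarrow> 0) at_top" by simp
  qed
  thus ?thesis by (simp add: g_def)
qed

lemma Mills_lower: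
  assumes "x > 0"
  shows "Q x \<ge> std_normal_density x * (x * (x\<^sup>2 + 5) / ((x\<^sup>2 + 6) * x\<^sup>2 + 3))"
proof -
  define g where "g x = x * (x\<^sup>2 + 5) / ((x\<^sup>2 + 6) * x\<^sup>2 + 3)" for x :: real
  have "Q x - std_normal_density x * g x \<ge> 0"
  proof (rule nonneg_if_decreasing_to_0[where a = x and f = "\<lambda>x. Q x - std_normal_density x * g x"
        and f' = "\<lambda>t. std_normal_density t * (- 24 / ((t\<^sup>2 + 6) * t\<^sup>2 + 3)\<^sup>2)"])
    fix t :: real
    have t: "(t\<^sup>2 + 6) * t\<^sup>2 + 3 > 0" by (intro add_nonneg_pos) auto
    have "((\<lambda>t. t * (t\<^sup>2 + 5)) has_real_derivative 3 * t\<^sup>2 + 5) (at t)"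
      "((\<lambda>t. (t\<^sup>2 + 6) * t\<^sup>2 + 3) has_real_derivative 4 * t ^ 3 + 12 * t) (at t)"
      by (auto intro!: derivative_eq_intros simp: power2_eq_square power3_eq_cube algebra_simps)
    from DERIV_divide[OF this] have "(g has_real_derivative
        ((3 * t\<^sup>2 + 5) * ((t\<^sup>2 + 6) * t\<^sup>2 + 3) - t * (t\<^sup>2 + 5) * (4 * t ^ 3 + 12 * t))
          / (((t\<^sup>2 + 6) * t\<^sup>2 + 3) * ((t\<^sup>2 + 6) * t\<^sup>2 + 3))) (at t)"
      using t by (simp add: g_def[abs_def])
    also have "((3 * t\<^sup>2 + 5) * ((t\<^sup>2 + 6) * t\<^sup>2 + 3) - t * (t\<^sup>2 + 5) * (4 * t ^ 3 + 12 * t))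
          / (((t\<^sup>2 + 6) * t\<^sup>2 + 3) * ((t\<^sup>2 + 6) * t\<^sup>2 + 3))
        = t * g t - 1 + 24 / ((t\<^sup>2 + 6) * t\<^sup>2 + 3)\<^sup>2"
      unfolding g_def using t by (simp add: divide_simps) algebra
    finally have "(g has_real_derivative t * g t - 1 + 24 / ((t\<^sup>2 + 6) * t\<^sup>2 + 3)\<^sup>2) (at t)" .
    thus "((\<lambda>x. Q x - std_normal_density x * g x) has_real_derivative
       std_normal_density t * (- 24 / ((t\<^sup>2 + 6) * t\<^sup>2 + 3)\<^sup>2)) (at t)"
      by (auto intro!: derivative_eq_intros simp: algebra_simps)
    show "std_normal_density t * (- 24 / ((t\<^sup>2 + 6) * t\<^sup>2 + 3)\<^sup>2) \<le> 0"
      by (intro mult_nonneg_nonpos) auto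
  next
    have "(g \<longlongrightarrow> 0) at_top" unfolding g_def by real_asymp
    from tendsto_diff[OF Q_tendsto_0 tendsto_density_times_0[OF this]]
    show "((\<lambda>x. Q x - std_normal_density x * g x) \<longlongrightarrow> 0) at_top" by simp
  qed
  thus ?thesis by (simp add: g_def)
qed

lemma Q_neq_0: "Q x \<noteq> 0" using Q_pos[of x] by simp

section \<open>A convergent series for the central range\<close>

fun odd_fact :: "nat \<Rightarrow> real" where
  "odd_fact 0 = 1"
| "odd_fact (Suc n) = (2 * real n + 3) * odd_fact n"

lemma odd_fact_pos: "odd_fact n > 0" by (induction n) auto

text \<open>The terms of \<open>\<Phi> x - 1/2 = \<phi> x * (x + x^3/3 + x^5/(3 * 5) + \<dots>)\<close>. All terms are positive for \<open>x > 0\<close>,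
  which avoids the cancellation in the Taylor series of \<open>\<Phi>\<close>.\<close>

definition Phi_term :: "nat \<Rightarrow> real \<Rightarrow> real" where
  "Phi_term k x = x ^ (2 * k + 1) / odd_fact k"

text \<open>The derivative of the density times one term is a difference of consecutive quantities, so the sum
  telescopes. The weight \<open>\<tau>\<close> on the last term stands for the tail of the series: \<open>\<tau> = 1\<close> gives a
  lower and a slightly larger \<open>\<tau>\<close> an upper bound.\<close>

lemma Phi_partial_sum_has_derivative:
  "((\<lambda>x. std_normal_density x * ((\<Sum>k<n. Phi_term k x) + \<tau> * Phi_term n x)) has_real_derivative
     std_normal_density x * (1 + (2 * real n + 1) * x ^ (2 * n) / odd_fact n
        * (\<tau> * (1 - x\<^sup>2 / (2 * real n + 1)) - 1))) (at x)"
proof -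
  define e where "e k = (2 * real k + 1) * x ^ (2 * k) / odd_fact k" for k
  have e: "x * Phi_term k x = e (Suc k)" for k
  proof -
    define d where "d = 2 * real k + 3"
    have "d > 0" "2 * real (Suc k) + 1 = d" "odd_fact (Suc k) = d * odd_fact k" by (simp_all add: d_def)
    thus ?thesis unfolding e_def Phi_term_def by (simp del: odd_fact.simps of_nat_Suc)
  qed
  have e': "e (Suc n) = e n * (x\<^sup>2 / (2 * real n + 1))"
  proof -
    define d where "d = 2 * real n + 3"
    have "d > 0" "2 * real (Suc n) + 1 = d" "odd_fact (Suc n) = d * odd_fact n" "2 * real n + 1 > 0"
      by (simp_all add: d_def)
    thus ?thesis unfolding e_def by (simp add: power2_eq_square del: odd_fact.simps of_nat_Suc)
  qed
  have 1: "((\<lambda>x. std_normal_density x * Phi_term k x) has_real_derivative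
      std_normal_density x * (e k - e (Suc k))) (at x)" for k
  proof -
    have "(Phi_term k has_real_derivative e k) (at x)"
      unfolding Phi_term_def[abs_def] e_def
      using DERIV_cdivide[OF DERIV_pow[of "2 * k + 1" x], of "odd_fact k"] by (simp add: add.commute)
    moreover have "(std_normal_density has_real_derivative - x * std_normal_density x) (at x)"
      by (auto intro!: derivative_eq_intros)
    ultimately have "((\<lambda>x. std_normal_density x * Phi_term k x) has_real_derivative
        - x * std_normal_density x * Phi_term k x + e k * std_normal_density x) (at x)"
      by (rule DERIV_mult[rotated])
    also have "- x * std_normal_density x * Phi_term k x + e k * std_normal_density x
        = std_normal_density x * (e k - e (Suc k))"
      unfolding e[symmetric] by (simp add: algebra_simps)
    finally show ?thesis .
  qed
  have "((\<lambda>x. (\<Sum>k<n. std_normal_density x * Phi_term k x) + \<tau> * (std_normal_density x * Phi_term n x))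
      has_real_derivative (\<Sum>k<n. std_normal_density x * (e k - e (Suc k)))
        + \<tau> * (std_normal_density x * (e n - e (Suc n)))) (at x)"
    by (intro DERIV_add DERIV_sum DERIV_cmult 1)
  also have "(\<Sum>k<n. std_normal_density x * (e k - e (Suc k))) = std_normal_density x * (1 - e n)"
    unfolding sum_distrib_left[symmetric] sum_lessThan_telescope' by (simp add: e_def)
  also have "std_normal_density x * (1 - e n) + \<tau> * (std_normal_density x * (e n - e (Suc n)))
      = std_normal_density x * (1 + e n * (\<tau> * (1 - x\<^sup>2 / (2 * real n + 1)) - 1))"
    unfolding e' by (simp add: algebra_simps)
  finally show ?thesis by (simp add: e_def sum_distrib_left distrib_left mult_ac)
qed

lemma Phi_partial_sum_lower:
  assumes "x \<ge> 0"
  shows "std_normal_density x * ((\<Sum>k<n. Phi_term k x) + Phi_term n x) \<le> 1 / 2 - Q x"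
proof -
  let ?F = "\<lambda>x. 1 / 2 - Q x - std_normal_density x * ((\<Sum>k<n. Phi_term k x) + 1 * Phi_term n x)"
  have "?F 0 \<le> ?F x"
  proof (rule DERIV_nonneg_imp_nondecreasing[OF assms])
    fix t :: real assume t: "0 \<le> t" "t \<le> x"
    have "((\<lambda>x. 1 / 2 - Q x) has_real_derivative std_normal_density t) (at t)"
      by (auto intro!: derivative_eq_intros)
    note D = DERIV_diff[OF this Phi_partial_sum_has_derivative[of n 1 t]]
    define E r where "E = (2 * real n + 1) * t ^ (2 * n) / odd_fact n"
      and "r = t\<^sup>2 / (2 * real n + 1)"
    have "E \<ge> 0" "r \<ge> 0" using odd_fact_pos[of n] t by (simp_all add: E_def r_def)
    hence "0 \<le> std_normal_density t * (E * r)" by simp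
    also have "\<dots> = std_normal_density t - std_normal_density t * (1 + E * (1 * (1 - r) - 1))"
      by (simp add: algebra_simps)
    finally have "0 \<le> std_normal_density t - std_normal_density t * (1 + E * (1 * (1 - r) - 1))" .
    with D show "\<exists>y. (?F has_real_derivative y) (at t) \<and> 0 \<le> y"
      unfolding E_def r_def by blast
  qed
  thus ?thesis by (simp add: Q_0 Phi_term_def)
qed

lemma Phi_partial_sum_upper:
  assumes x: "x \<ge> 0" and \<tau>: "\<tau> * (1 - x\<^sup>2 / (2 * real n + 1)) \<ge> 1" "\<tau> \<ge> 0"
  shows "1 / 2 - Q x \<le> std_normal_density x * ((\<Sum>k<n. Phi_term k x) + \<tau> * Phi_term n x)"
proof -
  let ?F = "\<lambda>x. std_normal_density x * ((\<Sum>k<n. Phi_term k x) + \<tau> * Phi_term n x) - (1 / 2 - Q x)"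
  have "?F 0 \<le> ?F x"
  proof (rule DERIV_nonneg_imp_nondecreasing[OF x])
    fix t :: real assume t: "0 \<le> t" "t \<le> x"
    have "((\<lambda>x. 1 / 2 - Q x) has_real_derivative std_normal_density t) (at t)"
      by (auto intro!: derivative_eq_intros)
    note D = DERIV_diff[OF Phi_partial_sum_has_derivative[of n \<tau> t] this]
    have "t\<^sup>2 \<le> x\<^sup>2" using t by (simp add: power_mono)
    hence "t\<^sup>2 / (2 * real n + 1) \<le> x\<^sup>2 / (2 * real n + 1)" by (intro divide_right_mono) auto
    hence "\<tau> * (1 - x\<^sup>2 / (2 * real n + 1)) \<le> \<tau> * (1 - t\<^sup>2 / (2 * real n + 1))"
      using \<tau>(2) by (intro mult_left_mono) auto
    hence "0 \<le> \<tau> * (1 - t\<^sup>2 / (2 * real n + 1)) - 1" using \<tau>(1) by simp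
    hence "0 \<le> std_normal_density t * ((2 * real n + 1) * t ^ (2 * n) / odd_fact n
        * (\<tau> * (1 - t\<^sup>2 / (2 * real n + 1)) - 1))"
      using odd_fact_pos[of n] t by (intro mult_nonneg_nonneg divide_nonneg_pos) auto
    with D show "\<exists>y. (?F has_real_derivative y) (at t) \<and> 0 \<le> y"
      by (intro exI conjI) (assumption, simp add: distrib_left)
  qed
  thus ?thesis by (simp add: Q_0 Phi_term_def)
qed

section \<open>Ratios of Gaussian tails\<close>

lemma density_ratio:
  "std_normal_density ((x - c) / s) = std_normal_density x * exp (x\<^sup>2 / 2 - ((x - c) / s)\<^sup>2 / 2)"
  unfolding std_normal_density_def mult.assoc mult_exp_exp by simp

text \<open>Moving the mean of a normal variable away from \<open>0\<close> makes its absolute value stochastically larger.\<close>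

lemma folded_tail_mono:
  assumes "0 < s" "0 \<le> u" "0 \<le> c" "c \<le> c'"
  shows "Q ((u - c) / s) + Q ((u + c) / s) \<le> Q ((u - c') / s) + Q ((u + c') / s)"
proof (rule DERIV_nonneg_imp_nondecreasing[OF assms(4)])
  fix x assume x: "c \<le> x" "x \<le> c'"
  have "((u - x) / s)\<^sup>2 \<le> ((u + x) / s)\<^sup>2"
    using assms x by (simp add: power_divide divide_right_mono power2_eq_square algebra_simps)
  hence "std_normal_density ((u + x) / s) \<le> std_normal_density ((u - x) / s)"
    unfolding std_normal_density_def by (intro mult_left_mono) auto
  moreover have "((\<lambda>c. Q ((u - c) / s) + Q ((u + c) / s)) has_real_derivative
      (std_normal_density ((u - x) / s) - std_normal_density ((u + x) / s)) / s) (at x)"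
    using assms(1) by (auto intro!: derivative_eq_intros simp: field_simps)
  ultimately show "\<exists>y. ((\<lambda>c. Q ((u - c) / s) + Q ((u + c) / s)) has_real_derivative y) (at x) \<and> 0 \<le> y"
    using assms(1) by (intro exI conjI) (assumption, simp)
qed

text \<open>The tail ratio at \<open>u\<close> is an average of the density ratio over \<open>[u, q]\<close> and of the tail ratio at \<open>q\<close>;
  a common bound for these is a bound at every \<open>u \<le> q\<close>.\<close>

lemma tail_ratio_upper:
  assumes "0 < s" "u \<le> q" "Q ((q - c) / s) \<le> K * Q q"
    and "\<And>x. u \<le> x \<Longrightarrow> x \<le> q \<Longrightarrow> std_normal_density ((x - c) / s) / s \<le> K * std_normal_density x"
  shows "Q ((u - c) / s) \<le> K * Q u"
proof -
  define g where "g x = K * Q x - Q ((x - c) / s)" for x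
  have "g q \<le> g u"
  proof (rule DERIV_nonpos_imp_nonincreasing[OF assms(2)])
    fix x assume x: "u \<le> x" "x \<le> q"
    have "(g has_real_derivative std_normal_density ((x - c) / s) / s - K * std_normal_density x) (at x)"
      unfolding g_def using assms(1) by (auto intro!: derivative_eq_intros)
    with assms(4)[OF x] show "\<exists>y. (g has_real_derivative y) (at x) \<and> y \<le> 0" by force
  qed
  thus ?thesis using assms(3) by (simp add: g_def)
qed

text \<open>The logarithm of the density ratio is a concave parabola with vertex \<open>c / (1 - s\<^sup>2)\<close>. To the left of
  the vertex it increases; its maximum is the bound in the next lemma.\<close>

lemma log_density_ratio_le_value:
  assumes "0 < s" "s < 1" "x \<le> q" "q * (1 - s\<^sup>2) \<le> c"
  shows "x\<^sup>2 / 2 - ((x - c) / s)\<^sup>2 / 2 \<le> q\<^sup>2 / 2 - ((q - c) / s)\<^sup>2 / (2 :: real)"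
proof -
  have s1: "s\<^sup>2 < 1" using assms(1,2) by (simp add: power_less_one_iff)
  have "(q + x) * (1 - s\<^sup>2) \<le> 2 * q * (1 - s\<^sup>2)"
    using assms s1 by (intro mult_right_mono) auto
  hence "0 \<le> (q - x) * (2 * c - (q + x) * (1 - s\<^sup>2))"
    using assms by (intro mult_nonneg_nonneg) auto
  also have "\<dots> = (2 * s\<^sup>2) * ((q\<^sup>2 / 2 - ((q - c) / s)\<^sup>2 / 2) - (x\<^sup>2 / 2 - ((x - c) / s)\<^sup>2 / 2))"
    using assms(1) by (simp add: power_divide field_simps power2_eq_square)
  finally show ?thesis using assms(1) by (simp add: zero_le_mult_iff)
qed

lemma log_density_ratio_le_max:
  fixes x c s :: real
  assumes "0 < s" "s < 1"
  shows "x\<^sup>2 / 2 - ((x - c) / s)\<^sup>2 / 2 \<le> c\<^sup>2 / (2 * (1 - s\<^sup>2))"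
proof -
  have s1: "s\<^sup>2 < 1" using assms(1,2) by (simp add: power_less_one_iff)
  have "0 \<le> (x * (1 - s\<^sup>2) - c)\<^sup>2" by simp
  also have "\<dots> = (2 * s\<^sup>2 * (1 - s\<^sup>2)) * (c\<^sup>2 / (2 * (1 - s\<^sup>2)) - (x\<^sup>2 / 2 - ((x - c) / s)\<^sup>2 / 2))"
    using assms(1) s1 by (simp add: power_divide field_simps power2_eq_square)
  finally have "0 \<le> c\<^sup>2 / (2 * (1 - s\<^sup>2)) - (x\<^sup>2 / 2 - ((x - c) / s)\<^sup>2 / 2)"
    using assms(1) s1 by (simp add: zero_le_mult_iff mult_le_0_iff)
  thus ?thesis by simp
qed

text \<open>The density ratio is unimodal, so for \<open>l > 0\<close> the function \<open>Q ((x - c) / s) - l * Q x\<close> first increases, then decreases and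
  finally increases to its limit \<open>0\<close>. On the last stretch it is negative. If it is nonnegative at both
  ends of an interval, the interval lies in the first two stretches, where it is at
  least its minimum over the ends.\<close>

lemma tail_ratio_quasiconcave:
  assumes s: "0 < s" "s < 1" and u: "uA \<le> u" "u \<le> uB"
    and A: "l * Q uA \<le> Q ((uA - c) / s)" and B: "l * Q uB \<le> Q ((uB - c) / s)"
  shows "l * Q u \<le> Q ((u - c) / s)"
proof -
  define e where "e x = x\<^sup>2 / 2 - ((x - c) / s)\<^sup>2 / 2" for x
  define LR where "LR x = exp (e x) / s" for x
  define g where "g x = Q ((x - c) / s) - l * Q x" for x
  have dg: "(g has_real_derivative std_normal_density x * (l - LR x)) (at x)" for x
  proof -
    have "(g has_real_derivative l * std_normal_density x - std_normal_density ((x - c) / s) / s) (at x)"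
      unfolding g_def using s(1) by (auto intro!: derivative_eq_intros)
    also have "l * std_normal_density x - std_normal_density ((x - c) / s) / s
        = std_normal_density x * (l - LR x)"
      unfolding LR_def e_def density_ratio by (simp add: algebra_simps)
    finally show ?thesis .
  qed
  have nn: "std_normal_density x \<ge> 0" "std_normal_density x > 0" for x
    by (simp_all add: normal_density_pos)
  have lim: "(g \<longlongrightarrow> 0) at_top"
  proof -
    have "filterlim (\<lambda>x. (x - c) / s) at_top at_top" using s(1) by real_asymp
    from filterlim_compose[OF Q_tendsto_0 this]
      and tendsto_mult[OF tendsto_const[of l] Q_tendsto_0]
    have "(g \<longlongrightarrow> 0 - l * 0) at_top" unfolding g_def by (intro tendsto_diff)
    thus ?thesis by simp
  qed
  \<comment> \<open>once the likelihood ratio has started to decrease it never recovers\<close>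
  have decr: "LR y \<le> LR y0" if "x0 < y0" "LR y0 < LR x0" "y0 \<le> y" for x0 y0 y
  proof -
    define a where "a = (1 - s\<^sup>2) / (2 * s\<^sup>2)"
    have a: "a > 0" unfolding a_def using s by (simp add: power_less_one_iff)
    have diff: "e q - e x = (q - x) * (c / s\<^sup>2 - a * (q + x))" for x q
      unfolding e_def a_def using s(1) by (simp add: power_divide field_simps power2_eq_square)
    have "(y0 - x0) * (c / s\<^sup>2 - a * (y0 + x0)) < 0"
      using that(2) s(1) diff[of y0 x0] by (simp add: LR_def divide_less_cancel)
    hence "c / s\<^sup>2 < a * (y0 + x0)" using that(1) by (simp add: mult_less_0_iff)
    also have "\<dots> \<le> a * (y + y0)" using a that by simp
    finally have "(y - y0) * (c / s\<^sup>2 - a * (y + y0)) \<le> 0"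
      using that(3) by (intro mult_nonneg_nonpos) auto
    thus ?thesis using diff[of y y0] s(1) by (simp add: LR_def divide_right_mono)
  qed
  have "g u \<ge> 0"
  proof (cases "\<forall>x. uA \<le> x \<longrightarrow> x \<le> u \<longrightarrow> LR x \<le> l")
    case True
    have "g uA \<le> g u"
      by (rule DERIV_nonneg_imp_nondecreasing[OF u(1)])
         (use dg nn True in \<open>metis mult_nonneg_nonneg diff_ge_0_iff_ge\<close>)
    thus ?thesis using A by (simp add: g_def)
  next
    case False
    then obtain x0 where x0: "uA \<le> x0" "x0 \<le> u" "LR x0 > l" by force
    show ?thesis
    proof (cases "\<forall>x. u \<le> x \<longrightarrow> x \<le> uB \<longrightarrow> LR x \<ge> l")
      case True
      have "g uB \<le> g u"
        by (rule DERIV_nonpos_imp_nonincreasing[OF u(2)])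
           (use dg nn True in \<open>metis mult_nonneg_nonpos diff_le_0_iff_le\<close>)
      thus ?thesis using B by (simp add: g_def)
    next
      case False
      then obtain y0 where y0: "u \<le> y0" "y0 \<le> uB" "LR y0 < l" by force
      have lt: "LR y < l" if "y0 \<le> y" for y
        using decr[of x0 y0 y] x0 y0 that by (cases "x0 = y0") auto
      have "- g (uB + 1) \<ge> 0"
      proof (rule nonneg_if_decreasing_to_0[where f = "\<lambda>x. - g x" and a = "uB + 1"
            and f' = "\<lambda>x. - (std_normal_density x * (l - LR x))"])
        fix x assume "uB + 1 \<le> x"
        show "((\<lambda>x. - g x) has_real_derivative - (std_normal_density x * (l - LR x))) (at x)"
          by (intro derivative_intros dg)
        show "- (std_normal_density x * (l - LR x)) \<le> 0"
          using lt[of x] y0 \<open>uB + 1 \<le> x\<close> by simp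
      qed (use tendsto_minus[OF lim] in simp)
      moreover have "g uB < g (uB + 1)"
      proof (rule DERIV_pos_imp_increasing[where f = g])
        fix x assume "uB \<le> x"
        thus "\<exists>y. (g has_real_derivative y) (at x) \<and> 0 < y"
          using dg[of x] nn(2)[of x] lt[of x] y0 by (intro exI conjI) (assumption, simp)
      qed simp
      ultimately show ?thesis using B by (simp add: g_def)
    qed
  qed
  thus ?thesis by (simp add: g_def)
qed

lemma mult_Q_le_density: "x * Q x \<le> std_normal_density x"
proof (cases "x \<le> 0")
  case True
  hence "x * Q x \<le> 0" using Q_pos[of x] by (simp add: mult_nonpos_nonneg)
  also have "0 \<le> std_normal_density x" by simp
  finally show ?thesis .
next
  case False
  have r: "(x\<^sup>2 + 2) / (x * (x\<^sup>2 + 3)) \<le> 1 / x"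
  proof -
    have "x\<^sup>2 + 3 > 0" by (simp add: add_nonneg_pos)
    moreover have "(x\<^sup>2 + 2) / (x\<^sup>2 + 3) \<le> 1" by (simp add: divide_le_eq_1 add_nonneg_pos)
    ultimately show ?thesis using False by (simp add: divide_simps)
  qed
  have "Q x \<le> std_normal_density x * ((x\<^sup>2 + 2) / (x * (x\<^sup>2 + 3)))"
    using Mills_upper[of x] False by simp
  also have "\<dots> \<le> std_normal_density x * (1 / x)"
    by (rule mult_left_mono[OF r]) simp
  finally show ?thesis using False by (simp add: field_simps)
qed

text \<open>Equivalently, the hazard rate of the normal law is increasing. This is what makes the tail
  log-concave.\<close>

lemma Mills_ratio_antimono:
  assumes "x \<le> y"
  shows "Q y * std_normal_density x \<le> Q x * std_normal_density y"
proof -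
  have "Q y / std_normal_density y \<le> Q x / std_normal_density x"
  proof (rule DERIV_nonpos_imp_nonincreasing[OF assms])
    fix t
    have p: "std_normal_density t > 0" by (simp add: normal_density_pos)
    have "((\<lambda>t. Q t / std_normal_density t) has_real_derivative
        (t * Q t - std_normal_density t) / std_normal_density t) (at t)"
      using p by (auto intro!: derivative_eq_intros simp: field_simps)
    moreover have "(t * Q t - std_normal_density t) / std_normal_density t \<le> 0"
      using mult_Q_le_density[of t] p by (simp add: divide_nonpos_pos)
    ultimately show "\<exists>y. ((\<lambda>t. Q t / std_normal_density t) has_real_derivative y) (at t) \<and> y \<le> 0"
      by blast
  qed
  thus ?thesis by (simp add: divide_simps normal_density_pos)
qed

lemma tail_log_concave:
  assumes "x \<le> y" "0 \<le> d"
  shows "Q (y + d) * Q x \<le> Q (x + d) * Q y"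
proof -
  have "Q (y + d) / Q y \<le> Q (x + d) / Q x"
  proof (rule DERIV_nonpos_imp_nonincreasing[OF assms(1)])
    fix t
    have "((\<lambda>t. Q (t + d) / Q t) has_real_derivative
        (Q (t + d) * std_normal_density t - Q t * std_normal_density (t + d)) / (Q t)\<^sup>2) (at t)"
    proof -
      have "((\<lambda>t. Q (t + d)) has_real_derivative - std_normal_density (t + d)) (at t)"
        "(Q has_real_derivative - std_normal_density t) (at t)"
        by (auto intro!: derivative_eq_intros)
      from DERIV_divide[OF this] show ?thesis
        using Q_pos[of t] by (simp add: power2_eq_square mult.commute)
    qed
    moreover have "(Q (t + d) * std_normal_density t - Q t * std_normal_density (t + d)) / (Q t)\<^sup>2 \<le> 0"
      using Mills_ratio_antimono[of t "t + d"] assms(2) by (simp add: divide_nonpos_nonneg)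
    ultimately show "\<exists>y. ((\<lambda>t. Q (t + d) / Q t) has_real_derivative y) (at t) \<and> y \<le> 0"
      by blast
  qed
  thus ?thesis using Q_pos[of x] Q_pos[of y] by (simp add: divide_simps mult.commute)
qed

text \<open>Between two thresholds, the tail ratio gains more from a larger shift at the larger threshold. So if
  the larger threshold has the larger value of \<open>Q ((u - c) / s) / Q u\<close> for one \<open>c\<close>, it has it for all
  larger \<open>c\<close>.\<close>

lemma tail_monotone_likelihood_ratio:
  assumes "0 < s" "uA \<le> uB" "c \<le> c'"
  shows "Q ((uB - c) / s) * Q ((uA - c') / s) \<le> Q ((uB - c') / s) * Q ((uA - c) / s)"
proof -
  have "Q ((uA - c) / s + (uB - uA) / s) * Q ((uA - c') / s)
      \<le> Q ((uA - c') / s + (uB - uA) / s) * Q ((uA - c) / s)"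
    using assms by (intro tail_log_concave) (auto simp: divide_right_mono)
  thus ?thesis by (simp add: add_divide_distrib[symmetric])
qed

text \<open>If \<open>Z\<close> and the noise are independent standard normal, \<open>X = s * noise - c * Z\<close> is again standard
  normal, and the function \<open>g\<close> is the mass that the joint density of \<open>Z\<close> and \<open>X\<close>
  gives to \<open>Z = z\<close>, \<open>X \<ge> u\<close>. Given \<open>X = x\<close> the variable \<open>Z\<close> has a normal density \<open>n\<close>, for which
  \<open>n (m + h) + n (m - h) = 2 * n m * exp (- h\<^sup>2 / (2 * s\<^sup>2)) * cosh \<dots>\<close>. This identity gives the
  inequality for each \<open>x\<close>, and integration over \<open>x \<ge> u\<close>, here in the form of a derivative in
  \<open>u\<close>, transfers it to \<open>g\<close>.\<close>

lemma symmetric_sum_ge: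
  fixes s m u c h :: real
  assumes s: "0 < s" and cs: "c\<^sup>2 + s\<^sup>2 = 1"
  defines "g \<equiv> \<lambda>z. std_normal_density z * Q ((u + c * z) / s)"
  shows "g (m + h) + g (m - h) \<ge> 2 * g m * (1 - h\<^sup>2 / (2 * s\<^sup>2))"
proof -
  define r where "r = 1 - h\<^sup>2 / (2 * s\<^sup>2)"
  define n where "n x z = exp (- (z + c * x)\<^sup>2 / (2 * s\<^sup>2))" for x z
  have dens: "std_normal_density z * std_normal_density ((x + c * z) / s)
      = std_normal_density x * (n x z / sqrt (2 * pi))" for x z
  proof -
    have "s\<^sup>2 = 1 - c\<^sup>2" using cs by simp
    have "s\<^sup>2 * z\<^sup>2 + (x + c * z)\<^sup>2 = s\<^sup>2 * x\<^sup>2 + (z + c * x)\<^sup>2"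
      unfolding \<open>s\<^sup>2 = 1 - c\<^sup>2\<close> by (simp add: power2_eq_square algebra_simps)
    hence "(s\<^sup>2 * z\<^sup>2 + (x + c * z)\<^sup>2) / (2 * s\<^sup>2) = (s\<^sup>2 * x\<^sup>2 + (z + c * x)\<^sup>2) / (2 * s\<^sup>2)"
      by simp
    hence "- z\<^sup>2 / 2 + - ((x + c * z) / s)\<^sup>2 / 2 = - x\<^sup>2 / 2 + - (z + c * x)\<^sup>2 / (2 * s\<^sup>2)"
      unfolding power_divide[of "x + c * z" s 2] using s by (simp add: add_divide_distrib)
    hence "exp (- z\<^sup>2 / 2) * exp (- ((x + c * z) / s)\<^sup>2 / 2)
        = exp (- x\<^sup>2 / 2) * exp (- (z + c * x)\<^sup>2 / (2 * s\<^sup>2))"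
      unfolding mult_exp_exp by simp
    thus ?thesis unfolding std_normal_density_def n_def by simp
  qed
  have n: "n x (m + h) + n x (m - h) \<ge> 2 * n x m * r" for x
  proof -
    define a where "a = (m + c * x) * h / s\<^sup>2"
    have e: "n x (m + h) = n x m * exp (- (h\<^sup>2 / (2 * s\<^sup>2))) * exp (- a)"
         "n x (m - h) = n x m * exp (- (h\<^sup>2 / (2 * s\<^sup>2))) * exp a"
      unfolding n_def a_def mult_exp_exp using s
      by (simp_all add: diff_divide_distrib[symmetric] add_divide_distrib[symmetric] divide_simps)
         (simp_all add: power2_eq_square algebra_simps)
    have "exp a + exp (- a) \<ge> 2" using exp_ge_add_one_self[of a] exp_ge_add_one_self[of "- a"] by linarith
    moreover have "exp (- (h\<^sup>2 / (2 * s\<^sup>2))) \<ge> r"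
      unfolding r_def using exp_ge_add_one_self[of "- (h\<^sup>2 / (2 * s\<^sup>2))"] by simp
    ultimately have "exp (- (h\<^sup>2 / (2 * s\<^sup>2))) * (exp a + exp (- a)) \<ge> r * 2"
      by (meson dual_order.trans exp_ge_zero mult_left_mono mult_right_mono zero_le_numeral)
    hence "n x m * (exp (- (h\<^sup>2 / (2 * s\<^sup>2))) * (exp a + exp (- a))) \<ge> n x m * (r * 2)"
      by (intro mult_left_mono) (auto simp: n_def)
    thus ?thesis unfolding e by (simp add: algebra_simps)
  qed
  define G where "G x z = std_normal_density z * Q ((x + c * z) / s)" for x z
  define D where "D x = G x (m + h) + G x (m - h) - 2 * r * G x m" for x
  have dG: "((\<lambda>x. G x z) has_real_derivative - std_normal_density x * (n x z / sqrt (2 * pi)) / s) (at x)" for x z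
  proof -
    have "((\<lambda>x. G x z) has_real_derivative
        - (std_normal_density z * std_normal_density ((x + c * z) / s)) / s) (at x)"
      unfolding G_def using s by (auto intro!: derivative_eq_intros)
    thus ?thesis unfolding dens by simp
  qed
  have limG: "((\<lambda>x. G x z) \<longlongrightarrow> 0) at_top" for z
  proof -
    have "filterlim (\<lambda>x. (x + c * z) / s) at_top at_top" using s(1) by real_asymp
    from tendsto_mult[OF tendsto_const filterlim_compose[OF Q_tendsto_0 this]]
    show ?thesis unfolding G_def by simp
  qed
  have "D u \<ge> 0"
  proof (rule nonneg_if_decreasing_to_0[where f = D and a = u and f' = "\<lambda>x. - std_normal_density x
        / (s * sqrt (2 * pi)) * (n x (m + h) + n x (m - h) - 2 * n x m * r)"])
    fix x
    show "(D has_real_derivative - std_normal_density x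
        / (s * sqrt (2 * pi)) * (n x (m + h) + n x (m - h) - 2 * n x m * r)) (at x)"
      unfolding D_def by (auto intro!: derivative_eq_intros dG) (use s in \<open>simp add: field_simps\<close>)
    show "- std_normal_density x
        / (s * sqrt (2 * pi)) * (n x (m + h) + n x (m - h) - 2 * n x m * r) \<le> 0"
      using n[of x] s by (intro mult_nonpos_nonneg) auto
  next
    have "(D \<longlongrightarrow> 0 + 0 - 2 * r * 0) at_top" unfolding D_def by (intro tendsto_intros limG)
    thus "(D \<longlongrightarrow> 0) at_top" by simp
  qed
  thus ?thesis unfolding D_def G_def g_def r_def by (simp add: algebra_simps)
qed

text \<open>Integrating the preceding inequality over \<open>0 \<le> h \<le> (b - a) / 2\<close> turns it into a midpoint rule that
  errs on one side only. The relative error is of second order in the length, so cells of length \<open>0.6\<close>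
  still lose less than two percent.\<close>

lemma midpoint_lower_bound:
  fixes s a b u c :: real
  assumes s: "0 < s" and cs: "c\<^sup>2 + s\<^sup>2 = 1" and ab: "a \<le> b"
  defines "g \<equiv> \<lambda>z. std_normal_density z * Q ((u + c * z) / s)"
  shows "integral {a..b} g \<ge> (b - a) * (1 - (b - a)\<^sup>2 / (24 * s\<^sup>2)) * g ((a + b) / 2)"
proof -
  define m where "m = (a + b) / 2"
  define w where "w = (b - a) / 2"
  have w: "w \<ge> 0" "a = m - w" "b = m + w" using ab by (auto simp: w_def m_def field_simps)
  have dg: "g differentiable (at x)" for x
  proof -
    have "(g has_real_derivative - (x * std_normal_density x) * Q ((u + c * x) / s)
        - std_normal_density x * (std_normal_density ((u + c * x) / s) * (c / s))) (at x)"
      unfolding g_def using s by (auto intro!: derivative_eq_intros simp: algebra_simps)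
    thus ?thesis using real_differentiable_def by blast
  qed
  have cont: "continuous_on S g" for S
    by (intro continuous_at_imp_continuous_on ballI differentiable_imp_continuous_within dg)
  define I where "I x = integral {m - (w + 1)..x} g" for x
  have dI: "(I has_real_derivative g x) (at x)" if "x \<in> {m - w..m + w}" for x
  proof -
    have "(I has_real_derivative g x) (at x within {m - (w + 1)..m + (w + 1)})"
      unfolding I_def using that by (intro integral_has_real_derivative cont) auto
    thus ?thesis using that by (simp add: at_within_Icc_at)
  qed
  define H where "H h = I (m + h) - I (m - h) - 2 * g m * (h - h ^ 3 / (6 * s\<^sup>2))" for h
  have "H 0 \<le> H w"
  proof (rule DERIV_nonneg_imp_nondecreasing[OF w(1)])
    fix h assume h: "0 \<le> h" "h \<le> w"
    have 1: "((\<lambda>h. I (m + h)) has_real_derivative g (m + h) * (0 + 1)) (at h)"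
      by (rule DERIV_chain'[OF _ dI]) (use h in \<open>auto intro!: derivative_eq_intros\<close>)
    have 2: "((\<lambda>h. I (m - h)) has_real_derivative g (m - h) * (0 - 1)) (at h)"
      by (rule DERIV_chain'[OF _ dI]) (use h in \<open>auto intro!: derivative_eq_intros\<close>)
    have "(H has_real_derivative g (m + h) + g (m - h) - 2 * g m * (1 - h\<^sup>2 / (2 * s\<^sup>2))) (at h)"
    proof -
      have "((\<lambda>h. h ^ 3 / (6 * s\<^sup>2)) has_real_derivative (3 * h\<^sup>2) / (6 * s\<^sup>2)) (at h)"
        by (intro DERIV_cdivide) (auto intro!: derivative_eq_intros)
      hence "((\<lambda>h. 2 * g m * (h - h ^ 3 / (6 * s\<^sup>2))) has_real_derivative
          2 * g m * (1 - (3 * h\<^sup>2) / (6 * s\<^sup>2))) (at h)"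
        by (intro DERIV_cmult DERIV_diff DERIV_ident)
      from DERIV_diff[OF DERIV_diff[OF 1 2] this] show ?thesis
        unfolding H_def by simp
    qed
    moreover have "0 \<le> g (m + h) + g (m - h) - 2 * g m * (1 - h\<^sup>2 / (2 * s\<^sup>2))"
      using symmetric_sum_ge[OF s cs, of m u h] unfolding g_def by simp
    ultimately show "\<exists>y. (H has_real_derivative y) (at h) \<and> 0 \<le> y" by blast
  qed
  hence "I (m + w) - I (m - w) \<ge> 2 * g m * (w - w ^ 3 / (6 * s\<^sup>2))" by (simp add: H_def)
  also have "I (m + w) - I (m - w) = integral {a..b} g"
    unfolding I_def w(2,3)
    using Henstock_Kurzweil_Integration.integral_combine[where a = "m - (w + 1)" and c = "m - w" and b = "m + w" and f = g] w(1)
      integrable_continuous_interval[OF cont] by (simp add: algebra_simps)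
  also have "2 * g m * (w - w ^ 3 / (6 * s\<^sup>2)) = (b - a) * (1 - (b - a)\<^sup>2 / (24 * s\<^sup>2)) * g ((a + b) / 2)"
    unfolding m_def w_def using s by (simp add: field_simps power2_eq_square power3_eq_cube)
  finally show ?thesis .
qed

lemma le_shifted_scaled:
  fixes s u c :: real
  assumes "0 < s" "s < 1" "0 \<le> u" "0 \<le> c"
  shows "u \<le> (u + c) / s"
proof -
  have "u * s \<le> u * 1" using assms by (intro mult_left_mono) auto
  thus ?thesis using assms by (simp add: le_divide_eq)
qed

lemma shifted_tail_le:
  assumes "0 < s" "s < 1" "0 \<le> u" "0 \<le> c"
  shows "Q ((u + c) / s) \<le> Q u"
  by (intro Q_antimono le_shifted_scaled assms)

text \<open>The companion of \<open>tail_ratio_quasiconcave\<close> for shifts to the left, where the ratio is simply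
  decreasing on \<open>[0, \<infinity>)\<close>: shrinking by \<open>s < 1\<close> and shifting both move the argument further into the
  tail, where log-concavity makes the relative decay faster.\<close>

lemma shifted_tail_ratio_antimono:
  assumes "0 < s" "s < 1" "0 \<le> u" "0 \<le> c" "u \<le> u'"
  shows "Q ((u' + c) / s) * Q u \<le> Q ((u + c) / s) * Q u'"
proof -
  have le: "u \<le> (u + c) / s" by (intro le_shifted_scaled assms)
  have "(u' - u) * s \<le> (u' - u) * 1" using assms by (intro mult_left_mono) auto
  hence "u' - u \<le> (u' - u) / s" using assms by (simp add: le_divide_eq)
  hence "(u + c) / s + (u' - u) \<le> (u' + c) / s" by (simp add: add_divide_distrib diff_divide_distrib)
  hence "Q ((u' + c) / s) * Q u \<le> Q ((u + c) / s + (u' - u)) * Q u"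
    using Q_pos[of u] by (intro mult_right_mono Q_antimono) auto
  also have "\<dots> \<le> Q (u + (u' - u)) * Q ((u + c) / s)"
    using assms le by (intro tail_log_concave) auto
  finally show ?thesis by (simp add: mult.commute)
qed

section \<open>Rejection rates conditionally on the common factor\<close>

text \<open>The standard deviations of the noise in the blocks; the first one is shared by the nulls and by the
  first block of nonnulls.\<close>

definition sd1 :: real where "sd1 = sqrt 91 / 10"
definition sd2 :: real where "sd2 = sqrt 301 / 25"

lemma sd_squares: "sd1\<^sup>2 = 91 / 100" "sd2\<^sup>2 = 301 / 625"
  by (simp_all add: sd1_def sd2_def power_divide)

lemma sd_bounds: "0 < sd1" "sd1 < 1" "0 < sd2" "sd2 < 1"
proof -
  show "0 < sd1" "0 < sd2" by (simp_all add: sd1_def sd2_def)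
  show "sd1 < 1" "sd2 < 1"
    using sd_squares \<open>0 < sd1\<close> \<open>0 < sd2\<close> by (auto intro!: power_less_imp_less_base[of _ 2 1])
qed

definition null_rate :: "real \<Rightarrow> real \<Rightarrow> real" where
  "null_rate z u = Q ((u - 3/10 * z) / sd1) + Q ((u + 3/10 * z) / sd1)"

definition alt1_rate :: "real \<Rightarrow> real \<Rightarrow> real" where
  "alt1_rate z u = Q ((u - (12/5 - 3/10 * z)) / sd1) + Q ((u + (12/5 - 3/10 * z)) / sd1)"

definition alt2_rate :: "real \<Rightarrow> real \<Rightarrow> real" where
  "alt2_rate z u = Q ((u - (22/5 - 18/25 * z)) / sd2) + Q ((u + (22/5 - 18/25 * z)) / sd2)"

definition reject_rate :: "real \<Rightarrow> real \<Rightarrow> real" where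
  "reject_rate z u = 96/100 * null_rate z u + 1/100 * alt1_rate z u + 3/100 * alt2_rate z u"

section \<open>Fixed-point interval arithmetic\<close>

type_synonym ivl = "(int \<times> int) option"

text \<open>An interval is a pair of integers in units of \<open>2 ^ (-32)\<close>. The value \<open>None\<close> carries no information and
  is the result of operations outside their domain; thus the arithmetic operations need no
  side conditions.\<close>

definition encloses :: "ivl \<Rightarrow> real \<Rightarrow> bool" where
  "encloses I x \<longleftrightarrow> (\<forall>a b. I = Some (a, b) \<longrightarrow> of_int a \<le> x * 2 ^ 32 \<and> x * 2 ^ 32 \<le> of_int b)"

fun ivl_add :: "ivl \<Rightarrow> ivl \<Rightarrow> ivl" where
  "ivl_add (Some (a, b)) (Some (c, d)) = Some (a + c, b + d)"
| "ivl_add _ _ = None"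

fun ivl_sub :: "ivl \<Rightarrow> ivl \<Rightarrow> ivl" where
  "ivl_sub (Some (a, b)) (Some (c, d)) = Some (a - d, b - c)"
| "ivl_sub _ _ = None"

fun ivl_mult :: "ivl \<Rightarrow> ivl \<Rightarrow> ivl" where
  "ivl_mult (Some (a, b)) (Some (c, d)) =
    (if 0 \<le> a \<and> 0 \<le> c then Some (drop_bit 32 (a * c), drop_bit 32 (b * d) + 1) else None)"
| "ivl_mult _ _ = None"

fun ivl_divide :: "ivl \<Rightarrow> ivl \<Rightarrow> ivl" where
  "ivl_divide (Some (a, b)) (Some (c, d)) =
    (if 0 \<le> a \<and> 0 < c then Some (push_bit 32 a div d, push_bit 32 b div c + 1) else None)"
| "ivl_divide _ _ = None"

fun ivl_divide_int :: "ivl \<Rightarrow> int \<Rightarrow> ivl" where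
  "ivl_divide_int (Some (a, b)) n = (if 0 < n then Some (a div n, b div n + 1) else None)"
| "ivl_divide_int _ _ = None"

fun ivl_max :: "ivl \<Rightarrow> ivl \<Rightarrow> ivl" where
  "ivl_max (Some (a, b)) (Some (c, d)) = Some (max a c, max b d)"
| "ivl_max _ _ = None"

fun ivl_join :: "ivl \<Rightarrow> ivl \<Rightarrow> ivl" where
  "ivl_join (Some (a, b)) (Some (c, d)) = Some (a, d)"
| "ivl_join _ _ = None"

fun ivl_le :: "ivl \<Rightarrow> ivl \<Rightarrow> bool" where
  "ivl_le (Some (a, b)) (Some (c, d)) \<longleftrightarrow> b \<le> c"
| "ivl_le _ _ \<longleftrightarrow> False"

definition ivl_rat :: "int \<Rightarrow> int \<Rightarrow> ivl" where
  "ivl_rat n d = (if 0 < d then Some (push_bit 32 n div d, push_bit 32 n div d + 1) else None)"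

definition ivl_int :: "int \<Rightarrow> ivl" where
  "ivl_int n = Some (push_bit 32 n, push_bit 32 n)"

fun ivl_squares :: "nat \<Rightarrow> ivl \<Rightarrow> ivl" where
  "ivl_squares 0 I = I"
| "ivl_squares (Suc k) I = ivl_squares k (ivl_mult I I)"

definition ivl_exp_base :: "ivl \<Rightarrow> ivl \<Rightarrow> ivl" where
  "ivl_exp_base t q = ivl_join (ivl_sub (ivl_sub (ivl_add (ivl_int 1) q) t) (ivl_divide_int (ivl_mult q t) 3))
                         (ivl_sub (ivl_add (ivl_int 1) q) t)"

definition ivl_exp_small :: "ivl \<Rightarrow> ivl" where
  "ivl_exp_small t = ivl_exp_base t (ivl_divide_int (ivl_mult t t) 2)"

text \<open>The exponential is computed as \<open>exp (t / 1024) ^ 1024\<close> by ten squarings, from Taylor polynomials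
  of degrees three and two for the lower and the upper end.
  Positive exponents are reduced to negative ones.\<close>

definition ivl_exp :: "int \<Rightarrow> int \<Rightarrow> ivl" where
  "ivl_exp n d =
    (if n \<le> 0 then ivl_squares 10 (ivl_exp_small (ivl_rat (- n) (1024 * d)))
     else ivl_divide (ivl_int 1) (ivl_squares 10 (ivl_exp_small (ivl_rat n (1024 * d)))))"

definition ivl_sqrt_2pi :: ivl where "ivl_sqrt_2pi = Some (10765886462, 10765886463)"
text \<open>Square roots are needed for two numbers only: \<open>91000000 = (10000 * sd1)\<^sup>2\<close> and
  \<open>48160000 = (10000 * sd2)\<^sup>2\<close>. An argument of a tail is written as \<open>n / sqrt D\<close> with an integer \<open>n\<close> and
  one of these \<open>D\<close>, so that its square is rational.\<close>

definition ivl_sqrt :: "int \<Rightarrow> ivl" where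
  "ivl_sqrt D =
    (if D = 91000000 then Some (40971376724581, 40971376724582)
     else if D = 48160000 then Some (29805959044960, 29805959044961)
     else None)"

definition ivl_Mills :: "ivl \<Rightarrow> ivl \<Rightarrow> ivl" where
  "ivl_Mills x y = ivl_join
     (ivl_divide (ivl_mult x (ivl_add y (ivl_int 5))) (ivl_add (ivl_mult (ivl_add y (ivl_int 6)) y) (ivl_int 3)))
     (ivl_divide (ivl_add y (ivl_int 2)) (ivl_mult x (ivl_add y (ivl_int 3))))"

fun ivl_horner :: "ivl \<Rightarrow> ivl \<Rightarrow> nat \<Rightarrow> ivl" where
  "ivl_horner y t 0 = t"
| "ivl_horner y t (Suc n) = ivl_horner y (ivl_add (ivl_int 1) (ivl_divide_int (ivl_mult y t) (2 * int n + 3))) n"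

text \<open>The series is cut after twelve terms; it is used for \<open>x\<^sup>2 \<le> 6\<close>, where the weight of the last term lies
  between \<open>1\<close> and \<open>1 / (1 - 6/25) = 25/19\<close>.\<close>

definition ivl_series :: "ivl \<Rightarrow> ivl \<Rightarrow> ivl" where
  "ivl_series x y = ivl_mult x (ivl_horner y (ivl_join (ivl_int 1) (ivl_rat 25 19)) 12)"

lemma encloses_Some: "encloses (Some (a, b)) x \<longleftrightarrow> of_int a \<le> x * 2 ^ 32 \<and> x * 2 ^ 32 \<le> of_int b"
  by (simp add: encloses_def)

lemma encloses_None [simp]: "encloses None x" by (simp add: encloses_def)

lemma encloses_ivl_add: "encloses I x \<Longrightarrow> encloses J y \<Longrightarrow> encloses (ivl_add I J) (x + y)"
  by (cases "(I, J)" rule: ivl_add.cases) (auto simp: encloses_Some algebra_simps)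

lemma encloses_ivl_sub: "encloses I x \<Longrightarrow> encloses J y \<Longrightarrow> encloses (ivl_sub I J) (x - y)"
  by (cases "(I, J)" rule: ivl_sub.cases) (auto simp: encloses_Some algebra_simps)

lemma encloses_ivl_max: "encloses I x \<Longrightarrow> encloses J y \<Longrightarrow> encloses (ivl_max I J) (max x y)"
  by (cases "(I, J)" rule: ivl_max.cases) (auto simp: encloses_Some max_def)

lemma ivl_le_imp_le: "encloses I x \<Longrightarrow> encloses J y \<Longrightarrow> ivl_le I J \<Longrightarrow> x \<le> y"
  by (cases "(I, J)" rule: ivl_le.cases) (auto simp: encloses_Some)

lemma encloses_ivl_join:
  assumes "encloses I x" "encloses J y" "x \<le> z" "z \<le> y"
  shows "encloses (ivl_join I J) z"
  using assms by (cases "(I, J)" rule: ivl_join.cases) (auto simp: encloses_Some)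

lemma of_int_div_bounds:
  fixes n d :: int
  assumes "d > 0"
  shows "of_int (n div d) \<le> (of_int n / of_int d :: real)"
    "(of_int n / of_int d :: real) \<le> of_int (n div d + 1)"
proof -
  have "n div d = \<lfloor>of_int n / of_int d :: real\<rfloor>" by (simp add: floor_divide_of_int_eq)
  thus "of_int (n div d) \<le> (of_int n / of_int d :: real)"
    "(of_int n / of_int d :: real) \<le> of_int (n div d + 1)" by linarith+
qed

lemma encloses_ivl_rat: "encloses (ivl_rat n d) (of_int n / of_int d)"
  using of_int_div_bounds[of d "n * 2 ^ 32"]
  by (auto simp: ivl_rat_def encloses_Some push_bit_eq_mult)

lemma encloses_ivl_int: "encloses (ivl_int n) (of_int n)"
  by (simp add: ivl_int_def encloses_Some push_bit_eq_mult)

lemma encloses_ivl_divide_int: "encloses I x \<Longrightarrow> encloses (ivl_divide_int I n) (x / of_int n)"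
proof (cases "(I, n)" rule: ivl_divide_int.cases)
  case (1 a b n')
  assume "encloses I x"
  with 1 have ab: "of_int a \<le> x * 2 ^ 32" "x * 2 ^ 32 \<le> of_int b" by (auto simp: encloses_Some)
  show ?thesis
  proof (cases "0 < n")
    case True
    have "of_int a / of_int n \<le> x * 2 ^ 32 / of_int n" "x * 2 ^ 32 / of_int n \<le> of_int b / of_int n"
      using ab True by (auto simp: divide_right_mono)
    with of_int_div_bounds[OF True, of a] of_int_div_bounds[OF True, of b] True 1
    show ?thesis by (simp add: encloses_Some)
  qed (use 1 in simp)
qed simp

lemma encloses_ivl_mult:
  assumes "encloses I x" "encloses J y"
  shows "encloses (ivl_mult I J) (x * y)"
proof (cases "(I, J)" rule: ivl_mult.cases)
  case (1 a b c d)
  show ?thesis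
  proof (cases "0 \<le> a \<and> 0 \<le> c")
    case True
    have I: "of_int a \<le> x * 2 ^ 32" "x * 2 ^ 32 \<le> of_int b"
      and J: "of_int c \<le> y * 2 ^ 32" "y * 2 ^ 32 \<le> of_int d"
      using 1 assms by (auto simp: encloses_Some)
    have pos: "(0 :: real) \<le> of_int a" "(0 :: real) \<le> of_int c" using True by auto
    have "of_int a * of_int c \<le> (x * 2 ^ 32) * (y * 2 ^ 32)"
         "(x * 2 ^ 32) * (y * 2 ^ 32) \<le> of_int b * of_int d"
      using I J pos by (intro mult_mono; linarith)+
    hence "of_int (a * c) / of_int (2 ^ 32) \<le> x * y * 2 ^ 32"
          "x * y * 2 ^ 32 \<le> of_int (b * d) / of_int (2 ^ 32)"
      by (simp_all add: field_simps)
    moreover have "(0 :: int) < 2 ^ 32" by simp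
    note of_int_div_bounds(1)[OF this, of "a * c"] of_int_div_bounds(2)[OF this, of "b * d"]
    ultimately have "of_int (a * c div 2 ^ 32) \<le> x * y * 2 ^ 32"
      "x * y * 2 ^ 32 \<le> of_int (b * d div 2 ^ 32 + 1)" by linarith+
    thus ?thesis using True 1 by (simp add: encloses_Some drop_bit_eq_div)
  qed (use 1 in auto)
qed auto

lemma encloses_ivl_divide:
  assumes "encloses I x" "encloses J y"
  shows "encloses (ivl_divide I J) (x / y)"
proof (cases "(I, J)" rule: ivl_divide.cases)
  case (1 a b c d)
  show ?thesis
  proof (cases "0 \<le> a \<and> 0 < c")
    case True
    have I: "of_int a \<le> x * 2 ^ 32" "x * 2 ^ 32 \<le> of_int b"
      and J: "of_int c \<le> y * 2 ^ 32" "y * 2 ^ 32 \<le> of_int d"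
      using 1 assms by (auto simp: encloses_Some)
    have pos: "(0 :: real) \<le> of_int a" "(0 :: real) < of_int c" using True by auto
    hence y: "y * 2 ^ 32 > 0" "y > 0" using J by (auto simp: zero_less_mult_iff intro: less_le_trans)
    hence d: "(0 :: real) < of_int d" using J by linarith
    have "of_int a / of_int d \<le> (x * 2 ^ 32) / (y * 2 ^ 32)"
         "(x * 2 ^ 32) / (y * 2 ^ 32) \<le> of_int b / of_int c"
      using I J pos d y by (intro frac_le; linarith)+
    hence "of_int a / of_int d \<le> x / y" "x / y \<le> of_int b / of_int c" by simp_all
    hence "of_int (a * 2 ^ 32) / of_int d \<le> x / y * 2 ^ 32" "x / y * 2 ^ 32 \<le> of_int (b * 2 ^ 32) / of_int c"
      by (simp_all add: times_divide_eq_left[symmetric] del: times_divide_eq_left)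
    moreover have "d > 0" "c > 0" using d True by auto
    note of_int_div_bounds(1)[OF this(1), of "a * 2 ^ 32"] of_int_div_bounds(2)[OF this(2), of "b * 2 ^ 32"]
    ultimately have "of_int (a * 2 ^ 32 div d) \<le> x / y * 2 ^ 32"
      "x / y * 2 ^ 32 \<le> of_int (b * 2 ^ 32 div c + 1)" by linarith+
    thus ?thesis using True 1 by (simp add: encloses_Some push_bit_eq_mult)
  qed (use 1 in auto)
qed auto

lemma encloses_ivl_squares: "encloses I x \<Longrightarrow> encloses (ivl_squares k I) (x ^ (2 ^ k))"
proof (induction k arbitrary: I x)
  case (Suc k)
  from Suc.IH[OF encloses_ivl_mult[OF Suc.prems Suc.prems]] show ?case
    by (simp add: power_mult_distrib power_add[symmetric] mult_2)
qed simp

lemma exp_minus_Taylor_bounds: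
  fixes t :: real
  assumes "t \<ge> 0"
  shows "exp (- t) \<le> 1 + t * t / 2 - t" "1 + t * t / 2 - t - t * t / 2 * t / 3 \<le> exp (- t)"
proof -
  have up: "exp (- t) \<le> 1 + t * t / 2 - t" if "t \<ge> 0" for t :: real
  proof -
    have "(\<lambda>t. 1 + t * t / 2 - t - exp (- t)) 0 \<le> (\<lambda>t. 1 + t * t / 2 - t - exp (- t)) t"
    proof (rule DERIV_nonneg_imp_nondecreasing[OF that])
      fix x :: real
      have "((\<lambda>t. 1 + t * t / 2 - t - exp (- t)) has_real_derivative (x - 1 + exp (- x))) (at x)"
        by (auto intro!: derivative_eq_intros)
      moreover have "0 \<le> x - 1 + exp (- x)" using exp_ge_add_one_self[of "- x"] by simp
      ultimately show "\<exists>y. ((\<lambda>t. 1 + t * t / 2 - t - exp (- t)) has_real_derivative y) (at x) \<and> 0 \<le> y"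
        by blast
    qed
    thus ?thesis by simp
  qed
  have "(\<lambda>t. exp (- t) - (1 + t * t / 2 - t - t * t / 2 * t / 3)) 0
      \<le> (\<lambda>t. exp (- t) - (1 + t * t / 2 - t - t * t / 2 * t / 3)) t"
  proof (rule DERIV_nonneg_imp_nondecreasing[OF assms])
    fix x :: real assume x: "0 \<le> x" "x \<le> t"
    have "((\<lambda>t. exp (- t) - (1 + t * t / 2 - t - t * t / 2 * t / 3)) has_real_derivative
        (1 + x * x / 2 - x) - exp (- x)) (at x)"
      by (auto intro!: derivative_eq_intros simp: field_simps)
    moreover have "0 \<le> (1 + x * x / 2 - x) - exp (- x)" using up[OF x(1)] by simp
    ultimately show "\<exists>y. ((\<lambda>t. exp (- t) - (1 + t * t / 2 - t - t * t / 2 * t / 3))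
        has_real_derivative y) (at x) \<and> 0 \<le> y" by blast
  qed
  thus "1 + t * t / 2 - t - t * t / 2 * t / 3 \<le> exp (- t)" by simp
  show "exp (- t) \<le> 1 + t * t / 2 - t" by (rule up[OF assms])
qed

lemma encloses_ivl_exp_small:
  assumes "encloses I t" "t \<ge> 0"
  shows "encloses (ivl_exp_small I) (exp (- t))"
proof -
  note q = encloses_ivl_divide_int[OF encloses_ivl_mult[OF assms(1) assms(1)], of 2]
  have "encloses (ivl_int 1) 1" using encloses_ivl_int[of 1] by simp
  note up = encloses_ivl_sub[OF encloses_ivl_add[OF this q] assms(1)]
  note low = encloses_ivl_sub[OF up encloses_ivl_divide_int[OF encloses_ivl_mult[OF q assms(1)], of 3]]
  show ?thesis unfolding ivl_exp_small_def ivl_exp_base_def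
    using exp_minus_Taylor_bounds[OF assms(2)] by (intro encloses_ivl_join[OF low up]) simp_all
qed

lemma encloses_ivl_exp:
  assumes "d > 0"
  shows "encloses (ivl_exp n d) (exp (of_int n / of_int d))"
proof -
  have neg: "encloses (ivl_squares 10 (ivl_exp_small (ivl_rat k (1024 * d)))) (exp (- (of_int k / of_int d)))"
    if "k \<ge> 0" for k
  proof -
    have "encloses (ivl_exp_small (ivl_rat k (1024 * d))) (exp (- (of_int k / of_int (1024 * d))))"
      using assms that by (intro encloses_ivl_exp_small encloses_ivl_rat) auto
    note encloses_ivl_squares[OF this, of 10]
    moreover have "exp (- (of_int k / of_int (1024 * d))) ^ 2 ^ 10 = exp (- (of_int k / of_int d) :: real)"
      unfolding exp_of_nat_mult[symmetric] by simp
    ultimately show ?thesis by simp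
  qed
  show ?thesis
  proof (cases "n \<le> 0")
    case True
    thus ?thesis using neg[of "- n"] by (simp add: ivl_exp_def)
  next
    case False
    have "encloses (ivl_exp n d) (of_int 1 / exp (- (of_int n / of_int d)))"
      using False by (simp add: ivl_exp_def del: of_int_1) (intro encloses_ivl_divide encloses_ivl_int neg, simp)
    thus ?thesis by (simp add: exp_minus inverse_eq_divide)
  qed
qed

lemma encloses_ivl_sqrt_2pi: "encloses ivl_sqrt_2pi (sqrt (2 * pi))"
proof -
  have "10765886462 / 2 ^ 32 \<le> sqrt (2 * pi)" "sqrt (2 * pi) \<le> 10765886463 / 2 ^ 32"
    using pi_approx by (intro real_le_rsqrt real_le_lsqrt; simp add: power2_eq_square)+
  thus ?thesis by (simp add: ivl_sqrt_2pi_def encloses_Some field_simps)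
qed

lemma encloses_ivl_sqrt: "encloses (ivl_sqrt D) (sqrt (of_int D))"
proof -
  have "40971376724581 / 2 ^ 32 \<le> sqrt (91000000 :: real)" "sqrt 91000000 \<le> 40971376724582 / (2 ^ 32 :: real)"
    "29805959044960 / 2 ^ 32 \<le> sqrt (48160000 :: real)" "sqrt 48160000 \<le> 29805959044961 / (2 ^ 32 :: real)"
    by (intro real_le_rsqrt real_le_lsqrt; simp add: power2_eq_square)+
  thus ?thesis by (simp add: ivl_sqrt_def encloses_Some field_simps)
qed

section \<open>Interval enclosures of Gaussian tails\<close>

fun horner :: "real \<Rightarrow> real \<Rightarrow> nat \<Rightarrow> real" where
  "horner y \<tau> 0 = \<tau>"
| "horner y \<tau> (Suc n) = horner y (1 + y * \<tau> / (2 * real n + 3)) n"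

lemma horner_eq: "x * horner (x\<^sup>2) \<tau> n = (\<Sum>k<n. Phi_term k x) + \<tau> * Phi_term n x"
proof (induction n arbitrary: \<tau>)
  case (Suc n)
  have "Phi_term (Suc n) x = Phi_term n x * x\<^sup>2 / (2 * real n + 3)"
    using odd_fact_pos[of n] unfolding Phi_term_def by (simp add: field_simps power2_eq_square)
  with Suc.IH show ?case by (simp add: algebra_simps)
qed (simp add: Phi_term_def)

lemma horner_attains:
  assumes x: "0 \<le> x" "x\<^sup>2 \<le> 6"
  obtains \<tau> where "1 \<le> \<tau>" "\<tau> \<le> 25 / 19" "std_normal_density x * (x * horner (x\<^sup>2) \<tau> 12) = 1 / 2 - Q x"
proof -
  have "25 / 19 * (1 - 6 / 25) \<le> 25 / 19 * (1 - x\<^sup>2 / (2 * real 12 + 1))"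
    using x by simp
  hence up: "1 / 2 - Q x \<le> std_normal_density x * ((\<Sum>k<12. Phi_term k x) + 25 / 19 * Phi_term 12 x)"
    using x by (intro Phi_partial_sum_upper) auto
  have low: "std_normal_density x * ((\<Sum>k<12. Phi_term k x) + Phi_term 12 x) \<le> 1 / 2 - Q x"
    by (rule Phi_partial_sum_lower[OF x(1)])
  let ?f = "\<lambda>\<tau>. std_normal_density x * ((\<Sum>k<12. Phi_term k x) + \<tau> * Phi_term 12 x)"
  have "\<exists>\<tau>\<ge>1. \<tau> \<le> 25 / 19 \<and> ?f \<tau> = 1 / 2 - Q x"
    using low up by (intro IVT) (auto intro!: continuous_intros)
  thus ?thesis using that by (auto simp: horner_eq)
qed

lemma encloses_ivl_horner:
  assumes "encloses I y"
  shows "encloses J \<tau> \<Longrightarrow> encloses (ivl_horner I J n) (horner y \<tau> n)"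
proof (induction n arbitrary: J \<tau>)
  case (Suc n)
  have "encloses (ivl_add (ivl_int 1) (ivl_divide_int (ivl_mult I J) (2 * int n + 3)))
      (of_int 1 + y * \<tau> / of_int (2 * int n + 3))"
    by (intro encloses_ivl_add encloses_ivl_int encloses_ivl_divide_int encloses_ivl_mult assms Suc.prems)
  from Suc.IH[OF this] show ?case by simp
qed simp

text \<open>Tails are multiplied by \<open>sqrt (2 * pi) * exp (u\<^sup>2 / 2)\<close> for a threshold \<open>u\<close> of comparable size. For
  thresholds near \<open>9\<close> the tails themselves would be far below the resolution of the intervals, whereas
  the scaled ones and their ratios are of moderate size.\<close>

definition scaled_tail :: "real \<Rightarrow> real \<Rightarrow> real" where
  "scaled_tail u x = sqrt (2 * pi) * exp (u\<^sup>2 / 2) * Q x"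

lemma scaled_density: "sqrt (2 * pi) * exp (x\<^sup>2 / 2) * std_normal_density x = 1"
  unfolding std_normal_density_def by (simp add: exp_minus field_simps)

lemma encloses_ivl_Mills:
  assumes "x > 0" "encloses I x" "encloses J (x\<^sup>2)"
  shows "encloses (ivl_Mills I J) (scaled_tail x x)"
proof -
  have low: "encloses (ivl_divide (ivl_mult I (ivl_add J (ivl_int 5)))
      (ivl_add (ivl_mult (ivl_add J (ivl_int 6)) J) (ivl_int 3)))
      (x * (x\<^sup>2 + of_int 5) / ((x\<^sup>2 + of_int 6) * x\<^sup>2 + of_int 3))"
    by (intro encloses_ivl_add encloses_ivl_int encloses_ivl_divide encloses_ivl_mult assms)
  have up: "encloses (ivl_divide (ivl_add J (ivl_int 2)) (ivl_mult I (ivl_add J (ivl_int 3))))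
      ((x\<^sup>2 + of_int 2) / (x * (x\<^sup>2 + of_int 3)))"
    by (intro encloses_ivl_add encloses_ivl_int encloses_ivl_divide encloses_ivl_mult assms)
  have pos: "sqrt (2 * pi) * exp (x\<^sup>2 / 2) \<ge> 0" by simp
  have "x * (x\<^sup>2 + of_int 5) / ((x\<^sup>2 + of_int 6) * x\<^sup>2 + of_int 3) \<le> scaled_tail x x"
    using mult_left_mono[OF Mills_lower[OF assms(1)] pos] scaled_density[of x]
    unfolding scaled_tail_def by (simp add: mult.assoc[symmetric])
  moreover have "scaled_tail x x \<le> (x\<^sup>2 + of_int 2) / (x * (x\<^sup>2 + of_int 3))"
    using mult_left_mono[OF Mills_upper[OF assms(1)] pos] scaled_density[of x]
    unfolding scaled_tail_def by (simp add: mult.assoc[symmetric])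
  ultimately show ?thesis unfolding ivl_Mills_def by (rule encloses_ivl_join[OF low up])
qed

lemma encloses_ivl_series:
  assumes "0 \<le> x" "x\<^sup>2 \<le> 6" "encloses I x" "encloses J (x\<^sup>2)"
  shows "encloses (ivl_series I J) (sqrt (2 * pi) * exp (x\<^sup>2 / 2) * (1 / 2 - Q x))"
proof -
  obtain \<tau> where \<tau>: "1 \<le> \<tau>" "\<tau> \<le> 25 / 19"
      "std_normal_density x * (x * horner (x\<^sup>2) \<tau> 12) = 1 / 2 - Q x"
    using horner_attains[OF assms(1,2)] by metis
  have "encloses (ivl_join (ivl_int 1) (ivl_rat 25 19)) \<tau>"
    using \<tau> by (intro encloses_ivl_join[OF encloses_ivl_int encloses_ivl_rat]) auto
  hence "encloses (ivl_series I J) (x * horner (x\<^sup>2) \<tau> 12)"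
    unfolding ivl_series_def by (intro encloses_ivl_mult encloses_ivl_horner assms)
  also have "x * horner (x\<^sup>2) \<tau> 12 = sqrt (2 * pi) * exp (x\<^sup>2 / 2) * (1 / 2 - Q x)"
    unfolding \<tau>(3)[symmetric] using scaled_density[of x] by (simp add: mult.assoc[symmetric])
  finally show ?thesis .
qed

text \<open>Here \<open>u = U / 100\<close> and \<open>x = n / sqrt D\<close>. Mills' ratio is used for \<open>x\<^sup>2 \<ge> 6\<close> and the series below that.\<close>

definition ivl_tail_pos :: "int \<Rightarrow> int \<Rightarrow> int \<Rightarrow> ivl" where
  "ivl_tail_pos U n D =
    (if n * n \<ge> 6 * D
     then ivl_mult (ivl_exp (U * U * D - 10000 * (n * n)) (20000 * D))
               (ivl_Mills (ivl_divide (ivl_int n) (ivl_sqrt D)) (ivl_rat (n * n) D))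
     else ivl_sub (ivl_mult (ivl_exp (U * U) 20000) (ivl_divide_int ivl_sqrt_2pi 2))
               (ivl_mult (ivl_exp (U * U * D - 10000 * (n * n)) (20000 * D))
                     (ivl_series (ivl_divide (ivl_int n) (ivl_sqrt D)) (ivl_rat (n * n) D))))"

definition ivl_tail :: "int \<Rightarrow> int \<Rightarrow> int \<Rightarrow> ivl" where
  "ivl_tail U n D = (if n \<ge> 0 then ivl_tail_pos U n D
     else ivl_sub (ivl_mult (ivl_exp (U * U) 20000) ivl_sqrt_2pi) (ivl_tail_pos U (- n) D))"

definition ivl_tail_same :: "int \<Rightarrow> ivl" where
  "ivl_tail_same U = ivl_Mills (ivl_rat U 100) (ivl_rat (U * U) 10000)"

definition ivl_density_ratio :: "int \<Rightarrow> int \<Rightarrow> int \<Rightarrow> ivl" where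
  "ivl_density_ratio U C D = ivl_divide (ivl_mult (if 100 * U * (100000000 - D) \<le> C * 100000000
       then ivl_exp (U * U * D - 10000 * ((100 * U - C) * (100 * U - C))) (20000 * D)
       else ivl_exp (C * C) (2 * (100000000 - D))) (ivl_int 10000)) (ivl_sqrt D)"

definition ivl_ratio_bound :: "int \<Rightarrow> int \<Rightarrow> int \<Rightarrow> ivl" where
  "ivl_ratio_bound U C D = ivl_max (ivl_divide (ivl_tail U (100 * U - C) D) (ivl_tail_same U)) (ivl_density_ratio U C D)"

lemma encloses_ivl_tail_pos:
  assumes "0 < D" "0 \<le> n"
  shows "encloses (ivl_tail_pos U n D) (scaled_tail (of_int U / 100) (of_int n / sqrt (of_int D)))"
proof -
  define u x :: real where "u = of_int U / 100" and "x = of_int n / sqrt (of_int D)"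
  have D: "sqrt (of_int D) > 0" using assms(1) by simp
  have x2: "of_int (n * n) / of_int D = x\<^sup>2"
    unfolding x_def using assms(1) by (simp add: power_divide power2_eq_square)
  have X: "encloses (ivl_divide (ivl_int n) (ivl_sqrt D)) x" "encloses (ivl_rat (n * n) D) (x\<^sup>2)"
    using encloses_ivl_divide[OF encloses_ivl_int[of n] encloses_ivl_sqrt[of D]] encloses_ivl_rat[of "n * n" D]
    unfolding x2 by (simp_all add: x_def)
  have "of_int (U * U * D - 10000 * (n * n)) / of_int (20000 * D)
      = u\<^sup>2 / 2 - of_int (n * n) / of_int D / 2"
    unfolding u_def using assms(1) by (simp add: field_simps power2_eq_square)
  hence "of_int (U * U * D - 10000 * (n * n)) / of_int (20000 * D) = u\<^sup>2 / 2 - x\<^sup>2 / 2"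
    unfolding x2 .
  hence E: "encloses (ivl_exp (U * U * D - 10000 * (n * n)) (20000 * D)) (exp (u\<^sup>2 / 2 - x\<^sup>2 / 2))"
    using encloses_ivl_exp[of "20000 * D" "U * U * D - 10000 * (n * n)"] assms(1) by simp
  have eq: "exp (u\<^sup>2 / 2 - x\<^sup>2 / 2) * (sqrt (2 * pi) * exp (x\<^sup>2 / 2) * r) = sqrt (2 * pi) * exp (u\<^sup>2 / 2) * r" for r
    by (simp add: exp_diff)
  show ?thesis
  proof (cases "n * n \<ge> 6 * D")
    case True
    hence "n > 0" using assms by (cases "n = 0") auto
    hence "x > 0" using D by (simp add: x_def)
    from encloses_ivl_mult[OF E encloses_ivl_Mills[OF this X]]
    have "encloses (ivl_tail_pos U n D) (exp (u\<^sup>2 / 2 - x\<^sup>2 / 2) * scaled_tail x x)"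
      unfolding ivl_tail_pos_def using True by simp
    thus ?thesis unfolding scaled_tail_def eq by (simp add: u_def x_def)
  next
    case False
    have "x \<ge> 0" using assms D by (simp add: x_def)
    have "real_of_int (n * n) \<le> of_int (6 * D)" using False by (subst of_int_le_iff) simp
    hence "x\<^sup>2 \<le> 6" unfolding x2[symmetric] using assms(1) by (simp add: divide_le_eq)
    note S = encloses_ivl_mult[OF E encloses_ivl_series[OF \<open>x \<ge> 0\<close> this X]]
    have "of_int (U * U) / of_int 20000 = u\<^sup>2 / 2" by (simp add: u_def power2_eq_square)
    hence "encloses (ivl_exp (U * U) 20000) (exp (u\<^sup>2 / 2))"
      using encloses_ivl_exp[of 20000 "U * U"] by simp
    from encloses_ivl_sub[OF encloses_ivl_mult[OF this encloses_ivl_divide_int[OF encloses_ivl_sqrt_2pi, of 2]] S]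
    have "encloses (ivl_tail_pos U n D) (exp (u\<^sup>2 / 2) * (sqrt (2 * pi) / of_int 2) -
        exp (u\<^sup>2 / 2 - x\<^sup>2 / 2) * (sqrt (2 * pi) * exp (x\<^sup>2 / 2) * (1 / 2 - Q x)))"
      unfolding ivl_tail_pos_def using False by simp
    also have "\<dots> = scaled_tail u x" unfolding eq scaled_tail_def by (simp add: algebra_simps)
    finally show ?thesis by (simp add: u_def x_def)
  qed
qed

lemma encloses_ivl_tail:
  assumes "0 < D"
  shows "encloses (ivl_tail U n D) (scaled_tail (of_int U / 100) (of_int n / sqrt (of_int D)))"
proof (cases "n \<ge> 0")
  case True
  thus ?thesis using encloses_ivl_tail_pos[OF assms] by (simp add: ivl_tail_def)
next
  case False
  define u x :: real where "u = of_int U / 100" and "x = of_int n / sqrt (of_int D)"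
  have "of_int (U * U) / of_int 20000 = u\<^sup>2 / 2" by (simp add: u_def power2_eq_square)
  hence E: "encloses (ivl_exp (U * U) 20000) (exp (u\<^sup>2 / 2))"
    using encloses_ivl_exp[of 20000 "U * U"] by simp
  have "encloses (ivl_tail_pos U (- n) D) (scaled_tail u (- x))"
    using encloses_ivl_tail_pos[OF assms, of "- n" U] False by (simp add: u_def x_def)
  from encloses_ivl_sub[OF encloses_ivl_mult[OF E encloses_ivl_sqrt_2pi] this]
  have "encloses (ivl_tail U n D) (exp (u\<^sup>2 / 2) * sqrt (2 * pi) - scaled_tail u (- x))"
    using False by (simp add: ivl_tail_def)
  also have "\<dots> = scaled_tail u x" unfolding scaled_tail_def Q_uminus by (simp add: algebra_simps)
  finally show ?thesis by (simp add: u_def x_def)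
qed

lemma encloses_ivl_tail_same:
  assumes "0 < U"
  shows "encloses (ivl_tail_same U) (scaled_tail (of_int U / 100) (of_int U / 100))"
  unfolding ivl_tail_same_def
  using encloses_ivl_rat[of U 100] encloses_ivl_rat[of "U * U" 10000] assms
  by (intro encloses_ivl_Mills) (simp_all add: power2_eq_square)

section \<open>Tail inequalities decided by interval arithmetic\<close>

lemma divide_sqrt_eq_divide_sd:
  "of_int n / sqrt (of_int 91000000) = of_int n / 10000 / sd1"
  "of_int n / sqrt (of_int 48160000) = of_int n / 10000 / sd2"
proof -
  have "sqrt 91000000 = 10000 * sd1" "sqrt 48160000 = 10000 * sd2"
    by (rule real_sqrt_unique; simp add: power_mult_distrib sd_squares sd_bounds less_imp_le)+
  thus "of_int n / sqrt (of_int 91000000) = of_int n / 10000 / sd1"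
    "of_int n / sqrt (of_int 48160000) = of_int n / 10000 / sd2" by simp_all
qed

lemma scaled_tail_factor: "scaled_tail u x = scaled_tail u y * (Q x / Q y)"
  unfolding scaled_tail_def using Q_pos[of y] by simp

lemma scaled_tail_pos: "scaled_tail u x > 0"
  unfolding scaled_tail_def using Q_pos by simp

text \<open>The supremum over \<open>x \<le> q\<close> of the ratio of the densities of \<open>c + s * noise\<close> and of a standard normal
  variable: it is attained at \<open>q\<close> if \<open>q\<close> lies to the left of the vertex, and at the vertex otherwise.\<close>

definition density_ratio_bound :: "real \<Rightarrow> real \<Rightarrow> real \<Rightarrow> real" where
  "density_ratio_bound s c q =
    exp (if q * (1 - s\<^sup>2) \<le> c then q\<^sup>2 / 2 - ((q - c) / s)\<^sup>2 / 2 else c\<^sup>2 / (2 * (1 - s\<^sup>2))) / s"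

definition tail_ratio_bound :: "real \<Rightarrow> real \<Rightarrow> real \<Rightarrow> real" where
  "tail_ratio_bound s c q = max (Q ((q - c) / s) / Q q) (density_ratio_bound s c q)"

lemma tail_le_tail_ratio_bound:
  assumes "0 < s" "s < 1" "u \<le> q"
  shows "Q ((u - c) / s) \<le> tail_ratio_bound s c q * Q u"
proof (rule tail_ratio_upper[OF assms(1,3)])
  have "Q ((q - c) / s) / Q q \<le> tail_ratio_bound s c q" by (simp add: tail_ratio_bound_def)
  thus "Q ((q - c) / s) \<le> tail_ratio_bound s c q * Q q" using Q_pos[of q] by (simp add: divide_le_eq)
next
  fix x assume x: "u \<le> x" "x \<le> q"
  have "std_normal_density ((x - c) / s) / s
      = std_normal_density x * (exp (x\<^sup>2 / 2 - ((x - c) / s)\<^sup>2 / 2) / s)"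
    unfolding density_ratio by simp
  also have "\<dots> \<le> std_normal_density x * density_ratio_bound s c q"
    using log_density_ratio_le_value[OF assms(1,2) x(2), of c] log_density_ratio_le_max[OF assms(1,2), of x c]
      assms(1)
    unfolding density_ratio_bound_def by (intro mult_left_mono divide_right_mono) auto
  also have "\<dots> \<le> std_normal_density x * tail_ratio_bound s c q"
    by (intro mult_left_mono) (auto simp: tail_ratio_bound_def)
  finally show "std_normal_density ((x - c) / s) / s \<le> tail_ratio_bound s c q * std_normal_density x"
    by (simp add: mult.commute)
qed

lemma encloses_ivl_density_ratio:
  assumes D: "0 < D" "D < 100000000"
    and s: "s = sqrt (of_int D) / 10000"
  shows "encloses (ivl_density_ratio U C D) (density_ratio_bound s (of_int C / 10000) (of_int U / 100))"
proof -
  define q c :: real where "q = of_int U / 100" and "c = of_int C / 10000"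
  have s2: "s\<^sup>2 = of_int D / 100000000" using D by (simp add: s power_divide)
  have "real_of_int (100 * U * (100000000 - D)) / 1000000000000 \<le> of_int (C * 100000000) / 1000000000000
      \<longleftrightarrow> 100 * U * (100000000 - D) \<le> C * 100000000"
    by (subst of_int_le_iff[where 'a = real, symmetric]) (simp add: mult.commute)
  moreover have "real_of_int (100 * U * (100000000 - D)) / 1000000000000 = q * (1 - s\<^sup>2)"
    "real_of_int (C * 100000000) / 1000000000000 = c"
    by (simp_all add: q_def c_def s2 field_simps)
  ultimately have cond: "100 * U * (100000000 - D) \<le> C * 100000000 \<longleftrightarrow> q * (1 - s\<^sup>2) \<le> c" by simp
  have "((q - c) / s)\<^sup>2 = (q - c)\<^sup>2 / (of_int D / 100000000)"
    by (simp add: power_divide s2)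
  also have "(q - c)\<^sup>2 = of_int ((100 * U - C) * (100 * U - C)) / 100000000"
    by (simp add: q_def c_def field_simps power2_eq_square)
  finally have qc: "((q - c) / s)\<^sup>2 = of_int ((100 * U - C) * (100 * U - C)) / of_int D" by simp
  have "of_int (U * U * D - 10000 * ((100 * U - C) * (100 * U - C))) / of_int (20000 * D)
      = q\<^sup>2 / 2 - ((q - c) / s)\<^sup>2 / 2"
    unfolding qc using D by (simp add: q_def field_simps power2_eq_square)
  with encloses_ivl_exp[of "20000 * D" "U * U * D - 10000 * ((100 * U - C) * (100 * U - C))"] D
  have E1: "encloses (ivl_exp (U * U * D - 10000 * ((100 * U - C) * (100 * U - C))) (20000 * D))
      (exp (q\<^sup>2 / 2 - ((q - c) / s)\<^sup>2 / 2))" by simp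
  have "2 * (1 - s\<^sup>2) = of_int (2 * (100000000 - D)) / 100000000"
    by (simp add: s2 field_simps)
  hence "of_int (C * C) / of_int (2 * (100000000 - D)) = c\<^sup>2 / (2 * (1 - s\<^sup>2))"
    by (simp add: c_def power2_eq_square)
  with encloses_ivl_exp[of "2 * (100000000 - D)" "C * C"] D
  have E2: "encloses (ivl_exp (C * C) (2 * (100000000 - D))) (exp (c\<^sup>2 / (2 * (1 - s\<^sup>2))))" by simp
  have "encloses (ivl_density_ratio U C D)
     (exp (if q * (1 - s\<^sup>2) \<le> c then q\<^sup>2 / 2 - ((q - c) / s)\<^sup>2 / 2 else c\<^sup>2 / (2 * (1 - s\<^sup>2)))
       * of_int 10000 / sqrt (of_int D))"
    unfolding ivl_density_ratio_def cond using E1 E2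
    by (intro encloses_ivl_divide encloses_ivl_mult encloses_ivl_int encloses_ivl_sqrt) auto
  thus ?thesis unfolding density_ratio_bound_def q_def c_def s by simp
qed

lemma encloses_ivl_ratio_bound:
  assumes D: "0 < D" "D < 100000000" and s: "s = sqrt (of_int D) / 10000" and U: "0 < U"
  shows "encloses (ivl_ratio_bound U C D) (tail_ratio_bound s (of_int C / 10000) (of_int U / 100))"
proof -
  have "of_int (100 * U - C) / sqrt (of_int D) = (of_int U / 100 - of_int C / 10000) / s"
    using D by (simp add: s field_simps)
  with encloses_ivl_tail[OF D(1), of U "100 * U - C"]
  have "encloses (ivl_tail U (100 * U - C) D)
    (scaled_tail (of_int U / 100) ((of_int U / 100 - of_int C / 10000) / s))" by simp
  from encloses_ivl_divide[OF this encloses_ivl_tail_same[OF U]]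
  have "encloses (ivl_divide (ivl_tail U (100 * U - C) D) (ivl_tail_same U))
    (Q ((of_int U / 100 - of_int C / 10000) / s) / Q (of_int U / 100))"
    by (subst (asm) scaled_tail_factor[of _ _ "of_int U / 100"])
       (use scaled_tail_pos[of "of_int U / 100" "of_int U / 100"] in simp)
  thus ?thesis unfolding ivl_ratio_bound_def tail_ratio_bound_def
    by (intro encloses_ivl_max encloses_ivl_density_ratio[OF D s])
qed

text \<open>Integer parameters are in units of \<open>1/100\<close>. Only the dominant one-sided tails are kept; the factor
  \<open>20020\<close> in place of \<open>2 * 10000\<close> leaves room for the random deviations.\<close>

definition crossing_ok :: "int \<Rightarrow> int \<Rightarrow> int \<Rightarrow> bool" where
  "crossing_ok v z U = ivl_le (ivl_mult (ivl_int 20020) (ivl_tail_same U))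
      (ivl_add (ivl_mult (ivl_int 96) (ivl_tail U (100 * U - 30 * v) 91000000))
        (ivl_add (ivl_tail U (100 * U - 24000 + 30 * z) 91000000)
           (ivl_mult (ivl_int 3) (ivl_tail U (100 * U - 44000 + 72 * z) 48160000))))"

text \<open>The right-hand side is \<open>2 * 10000\<close>, less \<open>100\<close> for the tails of the opposite sign, each at most \<open>Q u\<close>,
  and less \<open>20\<close> for the random deviations.\<close>

definition no_crossing_ok :: "int \<Rightarrow> int \<Rightarrow> int \<Rightarrow> bool" where
  "no_crossing_ok v z U = ivl_le 
      (ivl_add (ivl_mult (ivl_int 96) (ivl_ratio_bound U (30 * v) 91000000))
        (ivl_add (ivl_ratio_bound U (24000 - 30 * z) 91000000)
           (ivl_mult (ivl_int 3) (ivl_ratio_bound U (44000 - 72 * z) 48160000)))) (ivl_int 19880)"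

text \<open>Both sides carry the same scaling factors, so the test compares the ratios \<open>Q ((u - c) / sd1) / Q u\<close> at the two
  thresholds.\<close>

definition endpoint_ok :: "int \<Rightarrow> int \<Rightarrow> int \<Rightarrow> bool" where
  "endpoint_ok v U U' = ivl_le (ivl_mult (ivl_tail U (100 * U - 30 * v) 91000000) (ivl_tail_same U'))
       (ivl_mult (ivl_tail U' (100 * U' - 30 * v) 91000000) (ivl_tail_same U))"

text \<open>The midpoint approximation, with its correction factor, to the integral of the
  function \<open>cell_bound\<close> below against the normal density. The constants come from
  \<open>24 * sd1\<^sup>2 = 21.84\<close> and from lengths in units of \<open>1/100\<close>.\<close>

definition ivl_cell_integral :: "int \<Rightarrow> int \<Rightarrow> int \<Rightarrow> int \<Rightarrow> ivl" where
  "ivl_cell_integral a b U U' =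
    ivl_mult (ivl_mult (ivl_rat ((b - a) * (218400 - (b - a) * (b - a))) 21840000)
               (ivl_divide (ivl_exp (- ((a + b) * (a + b))) 80000) ivl_sqrt_2pi))
         (ivl_add (ivl_divide (ivl_tail U (100 * U - 15 * (a + b)) 91000000) (ivl_tail_same U))
               (ivl_divide (ivl_tail U' (100 * U' + 15 * (a + b)) 91000000) (ivl_tail_same U')))"

lemma crossing_okD:
  assumes "crossing_ok v z U" "0 < U" and u: "u = of_int U / 100"
  shows "20020 * Q u \<le> 96 * Q ((u - 3/10 * (of_int v / 100)) / sd1)
     + Q ((u - (12/5 - 3/10 * (of_int z / 100))) / sd1)
     + 3 * Q ((u - (22/5 - 18/25 * (of_int z / 100))) / sd2)"
proof -
  have x: "of_int (100 * U - 30 * v) / sqrt (of_int 91000000) = (u - 3/10 * (of_int v / 100)) / sd1"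
    "of_int (100 * U - 24000 + 30 * z) / sqrt (of_int 91000000)
       = (u - (12/5 - 3/10 * (of_int z / 100))) / sd1"
    "of_int (100 * U - 44000 + 72 * z) / sqrt (of_int 48160000)
       = (u - (22/5 - 18/25 * (of_int z / 100))) / sd2"
    unfolding divide_sqrt_eq_divide_sd u by (rule arg_cong2[where f = "(/)", OF _ refl]; simp add: field_simps)+
  have "of_int 20020 * scaled_tail u u \<le> of_int 96 * scaled_tail u ((u - 3/10 * (of_int v / 100)) / sd1)
     + (scaled_tail u ((u - (12/5 - 3/10 * (of_int z / 100))) / sd1)
     + of_int 3 * scaled_tail u ((u - (22/5 - 18/25 * (of_int z / 100))) / sd2))"
    unfolding x[symmetric] unfolding u
    by (rule ivl_le_imp_le[OF _ _ assms(1)[unfolded crossing_ok_def]];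
        intro encloses_ivl_add encloses_ivl_mult encloses_ivl_int encloses_ivl_tail encloses_ivl_tail_same)
       (use assms in auto)
  also have "\<dots> = (sqrt (2 * pi) * exp (u\<^sup>2 / 2)) * (96 * Q ((u - 3/10 * (of_int v / 100)) / sd1)
     + Q ((u - (12/5 - 3/10 * (of_int z / 100))) / sd1)
     + 3 * Q ((u - (22/5 - 18/25 * (of_int z / 100))) / sd2))"
    unfolding scaled_tail_def by (simp add: algebra_simps)
  also have "of_int 20020 * scaled_tail u u = (sqrt (2 * pi) * exp (u\<^sup>2 / 2)) * (20020 * Q u)"
    unfolding scaled_tail_def by simp
  finally show ?thesis by simp
qed

lemma no_crossing_okD:
  assumes "no_crossing_ok v z U" "0 < U" and q: "q = of_int U / 100"
  shows "96 * tail_ratio_bound sd1 (3/10 * (of_int v / 100)) q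
      + tail_ratio_bound sd1 (12/5 - 3/10 * (of_int z / 100)) q
      + 3 * tail_ratio_bound sd2 (22/5 - 18/25 * (of_int z / 100)) q \<le> 19880"
proof -
  have s: "sd1 = sqrt (of_int 91000000) / 10000" "sd2 = sqrt (of_int 48160000) / 10000"
    using divide_sqrt_eq_divide_sd[of 1] sd_bounds by (simp_all add: field_simps)
  have c: "of_int (30 * v) / 10000 = 3/10 * (of_int v / 100 :: real)"
    "of_int (24000 - 30 * z) / 10000 = 12/5 - 3/10 * (of_int z / 100 :: real)"
    "of_int (44000 - 72 * z) / 10000 = 22/5 - 18/25 * (of_int z / 100 :: real)"
    by (simp_all add: field_simps)
  have "of_int 96 * tail_ratio_bound sd1 (3/10 * (of_int v / 100)) q
      + (tail_ratio_bound sd1 (12/5 - 3/10 * (of_int z / 100)) q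
      + of_int 3 * tail_ratio_bound sd2 (22/5 - 18/25 * (of_int z / 100)) q) \<le> of_int 19880"
    unfolding c[symmetric] unfolding q
    by (rule ivl_le_imp_le[OF _ _ assms(1)[unfolded no_crossing_ok_def]];
        intro encloses_ivl_add encloses_ivl_mult encloses_ivl_int encloses_ivl_ratio_bound s assms) auto
  thus ?thesis by simp
qed

lemma endpoint_okD:
  assumes "endpoint_ok v U U'" "0 < U" "0 < U'" and u: "u = of_int U / 100" "u' = of_int U' / 100"
  shows "Q ((u - 3/10 * (of_int v / 100)) / sd1) * Q u' \<le> Q ((u' - 3/10 * (of_int v / 100)) / sd1) * Q u"
proof -
  have x: "of_int (100 * U - 30 * v) / sqrt (of_int 91000000) = (u - 3/10 * (of_int v / 100)) / sd1"
    "of_int (100 * U' - 30 * v) / sqrt (of_int 91000000) = (u' - 3/10 * (of_int v / 100)) / sd1"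
    unfolding divide_sqrt_eq_divide_sd u by (rule arg_cong2[where f = "(/)", OF _ refl]; simp add: field_simps)+
  have "scaled_tail u ((u - 3/10 * (of_int v / 100)) / sd1) * scaled_tail u' u'
      \<le> scaled_tail u' ((u' - 3/10 * (of_int v / 100)) / sd1) * scaled_tail u u"
    unfolding x[symmetric] unfolding u
    by (rule ivl_le_imp_le[OF _ _ assms(1)[unfolded endpoint_ok_def]];
        intro encloses_ivl_mult encloses_ivl_tail encloses_ivl_tail_same) (use assms in auto)
  hence "(sqrt (2 * pi) * exp (u\<^sup>2 / 2)) * (sqrt (2 * pi) * exp (u'\<^sup>2 / 2)) *
        (Q ((u - 3/10 * (of_int v / 100)) / sd1) * Q u')
      \<le> (sqrt (2 * pi) * exp (u\<^sup>2 / 2)) * (sqrt (2 * pi) * exp (u'\<^sup>2 / 2)) *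
        (Q ((u' - 3/10 * (of_int v / 100)) / sd1) * Q u)"
    unfolding scaled_tail_def by (simp only: mult_ac)
  thus ?thesis by (subst (asm) mult_le_cancel_left_pos) auto
qed

lemma encloses_ivl_cell_integral:
  assumes "0 < U" "0 < U'" and u: "u = of_int U / 100" "u' = of_int U' / 100"
    and ab: "a = of_int A / 100" "b = of_int B / 100"
  shows "encloses (ivl_cell_integral A B U U')
     ((b - a) * (1 - (b - a)\<^sup>2 / (24 * sd1\<^sup>2)) * std_normal_density ((a + b) / 2)
       * (Q ((u - 3/10 * ((a + b) / 2)) / sd1) / Q u + Q ((u' + 3/10 * ((a + b) / 2)) / sd1) / Q u'))"
proof -
  have x: "of_int (100 * U - 15 * (A + B)) / sqrt (of_int 91000000) = (u - 3/10 * ((a + b) / 2)) / sd1"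
    "of_int (100 * U' + 15 * (A + B)) / sqrt (of_int 91000000) = (u' + 3/10 * ((a + b) / 2)) / sd1"
    unfolding divide_sqrt_eq_divide_sd u ab by (rule arg_cong2[where f = "(/)", OF _ refl]; simp add: field_simps)+
  have w: "of_int ((B - A) * (218400 - (B - A) * (B - A))) / of_int 21840000
      = (b - a) * (1 - (b - a)\<^sup>2 / (24 * sd1\<^sup>2))"
    unfolding ab sd_squares by (simp add: field_simps power2_eq_square)
  have e: "of_int (- ((A + B) * (A + B))) / of_int 80000 = - ((a + b) / 2)\<^sup>2 / 2"
    unfolding ab by (simp add: field_simps power2_eq_square)
  have t: "scaled_tail u y / scaled_tail u u = Q y / Q u" for u y
    using scaled_tail_pos[of u u] scaled_tail_factor[of u y u] by (simp add: field_simps)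
  have "encloses (ivl_cell_integral A B U U')
    (of_int ((B - A) * (218400 - (B - A) * (B - A))) / of_int 21840000 *
      (exp (of_int (- ((A + B) * (A + B))) / of_int 80000) / sqrt (2 * pi)) *
      (scaled_tail u ((u - 3/10 * ((a + b) / 2)) / sd1) / scaled_tail u u
      + scaled_tail u' ((u' + 3/10 * ((a + b) / 2)) / sd1) / scaled_tail u' u'))"
    unfolding x[symmetric] ivl_cell_integral_def unfolding u
    by (intro encloses_ivl_add encloses_ivl_mult encloses_ivl_rat encloses_ivl_divide encloses_ivl_exp
        encloses_ivl_sqrt_2pi encloses_ivl_tail encloses_ivl_tail_same assms) simp_all
  also have "exp (of_int (- ((A + B) * (A + B))) / of_int 80000) / sqrt (2 * pi) = std_normal_density ((a + b) / 2)"
    unfolding e std_normal_density_def by simp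
  finally show ?thesis unfolding w t .
qed

section \<open>Certified cells of the common factor\<close>

text \<open>A cell is a range \<open>z_lo < 100 * \<bar>z\<bar> < z_hi\<close> on one side of the origin (the negative side if
  \<open>mirrored\<close>), together with a range \<open>u_lo \<le> 100 * u \<le> u_hi\<close> for the threshold. The flag tells at which end of
  the latter the tail ratio of the nulls is smaller. The weight, in units of \<open>1/100000\<close>, is a lower
  bound for the contribution of the cell.\<close>

datatype cell = Cell (mirrored: bool) (z_lo: int) (z_hi: int) (use_left: bool) (u_lo: int) (u_hi: int)
  (weight: int)

fun cell_ok :: "cell \<Rightarrow> bool" where
  "cell_ok (Cell mir a b left U U' w) \<longleftrightarrow>
     0 \<le> a \<and> a < b \<and> b \<le> 400 \<and> 0 < U \<and> U \<le> U' \<and>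
     crossing_ok a (if mir then - a else b) U' \<and>
     no_crossing_ok b (if mir then - b else a) U \<and>
     (if left then endpoint_ok a U U' else endpoint_ok b U' U) \<and>
     ivl_le (ivl_rat w 100000) (ivl_cell_integral a b (if left then U else U') U')"

definition side :: "cell \<Rightarrow> real" where "side c = (if mirrored c then - 1 else 1)"
definition v_lo :: "cell \<Rightarrow> real" where "v_lo c = of_int (z_lo c) / 100"
definition v_hi :: "cell \<Rightarrow> real" where "v_hi c = of_int (z_hi c) / 100"
definition thr_lo :: "cell \<Rightarrow> real" where "thr_lo c = of_int (u_lo c) / 100"
definition thr_hi :: "cell \<Rightarrow> real" where "thr_hi c = of_int (u_hi c) / 100"
definition thr_ref :: "cell \<Rightarrow> real" where "thr_ref c = (if use_left c then thr_lo c else thr_hi c)"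

definition cell_set :: "cell \<Rightarrow> real set" where
  "cell_set c = {z. v_lo c < side c * z \<and> side c * z < v_hi c}"

text \<open>A lower bound for \<open>null_rate z u / Q u\<close> that is uniform in the threshold. The tail on the side of the
  common factor is quasiconcave in \<open>u\<close> and is taken at the end selected by the flag, the opposite tail is
  decreasing and is taken at the right end.\<close>

definition cell_bound :: "cell \<Rightarrow> real \<Rightarrow> real" where
  "cell_bound c z = Q ((thr_ref c - 3/10 * (side c * z)) / sd1) / Q (thr_ref c)
     + Q ((thr_hi c + 3/10 * (side c * z)) / sd1) / Q (thr_hi c)"

lemma null_rate_uminus: "null_rate (- z) u = null_rate z u"
  by (simp add: null_rate_def)

context
  fixes c :: cell
  assumes ok: "cell_ok c"
begin

lemma cell_ok_basic:
  "0 \<le> v_lo c" "v_lo c < v_hi c" "v_hi c \<le> 4" "0 < thr_lo c" "thr_lo c \<le> thr_hi c" "0 < thr_hi c"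
  "0 < u_lo c" "0 < u_hi c" "0 < thr_ref c"
  using ok by (cases c; simp add: v_lo_def v_hi_def thr_lo_def thr_hi_def thr_ref_def)+

lemma side_cases: "side c = 1 \<or> side c = - 1" by (simp add: side_def)

lemma null_rate_side: "null_rate (side c * z) u = null_rate z u"
  using side_cases null_rate_uminus by auto

text \<open>At the right end of the threshold range there are enough rejections. Over the cell, the null tail is
  smallest where \<open>\<bar>z\<bar>\<close> is smallest, the nonnull tails where \<open>z\<close> is largest.\<close>

lemma reject_rate_lower:
  assumes z: "z \<in> cell_set c"
  shows "2002/1000 * Q (thr_hi c) \<le> 1/100 * reject_rate z (thr_hi c)"
proof -
  define zM where "zM = (if mirrored c then - z_lo c else z_hi c)"
  have lo: "crossing_ok (z_lo c) zM (u_hi c)" using ok by (cases c) (auto simp: zM_def)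
  have zM: "z \<le> of_int zM / 100"
    using z by (auto simp: cell_set_def side_def zM_def v_lo_def v_hi_def split: if_splits)
  let ?u = "thr_hi c"
  have "20020 * Q ?u \<le> 96 * Q ((?u - 3/10 * (of_int (z_lo c) / 100)) / sd1)
     + Q ((?u - (12/5 - 3/10 * (of_int zM / 100))) / sd1)
     + 3 * Q ((?u - (22/5 - 18/25 * (of_int zM / 100))) / sd2)"
    by (rule crossing_okD[OF lo]) (use cell_ok_basic in \<open>auto simp: thr_hi_def\<close>)
  also have "Q ((?u - 3/10 * (of_int (z_lo c) / 100)) / sd1) \<le> Q ((?u - 3/10 * (side c * z)) / sd1)"
    using z sd_bounds by (intro Q_antimono divide_right_mono) (auto simp: cell_set_def v_lo_def mult.commute)
  also have "\<dots> \<le> null_rate (side c * z) ?u"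
    unfolding null_rate_def using Q_pos[of "(?u + 3/10 * (side c * z)) / sd1"] by simp
  also have "\<dots> = null_rate z ?u" by (rule null_rate_side)
  also have "Q ((?u - (12/5 - 3/10 * (of_int zM / 100))) / sd1) \<le> Q ((?u - (12/5 - 3/10 * z)) / sd1)"
    using zM sd_bounds by (intro Q_antimono divide_right_mono) auto
  also have "\<dots> \<le> alt1_rate z ?u"
    unfolding alt1_rate_def using Q_pos[of "(?u + (12/5 - 3/10 * z)) / sd1"] by simp
  also have "Q ((?u - (22/5 - 18/25 * (of_int zM / 100))) / sd2) \<le> Q ((?u - (22/5 - 18/25 * z)) / sd2)"
    using zM sd_bounds by (intro Q_antimono divide_right_mono) auto
  also have "\<dots> \<le> alt2_rate z ?u"
    unfolding alt2_rate_def using Q_pos[of "(?u + (22/5 - 18/25 * z)) / sd2"] by simp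
  finally show ?thesis unfolding reject_rate_def by simp
qed

text \<open>To the left of the threshold range there are too few rejections, uniformly in \<open>u\<close> because the tail
  ratios are bounded uniformly. The worst case is the largest \<open>\<bar>z\<bar>\<close> for the nulls and the
  smallest \<open>z\<close> for the nonnulls.\<close>

lemma reject_rate_upper:
  assumes z: "z \<in> cell_set c" and u: "0 \<le> u" "u \<le> thr_lo c"
  shows "1/100 * reject_rate z u \<le> 1998/1000 * Q u"
proof -
  define zm where "zm = (if mirrored c then - z_hi c else z_lo c)"
  have up: "no_crossing_ok (z_hi c) zm (u_lo c)" using ok by (cases c) (auto simp: zm_def)
  have zm: "of_int zm / 100 \<le> z" and z4: "z \<le> 4"
    using z cell_ok_basic by (auto simp: cell_set_def side_def zm_def v_lo_def v_hi_def split: if_splits)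
  have zm4: "of_int zm / 100 \<le> (4 :: real)" using zm z4 by simp
  let ?K0 = "tail_ratio_bound sd1 (3/10 * (of_int (z_hi c) / 100)) (thr_lo c)"
  let ?K1 = "tail_ratio_bound sd1 (12/5 - 3/10 * (of_int zm / 100)) (thr_lo c)"
  let ?K2 = "tail_ratio_bound sd2 (22/5 - 18/25 * (of_int zm / 100)) (thr_lo c)"
  have K: "96 * ?K0 + ?K1 + 3 * ?K2 \<le> 19880"
    by (rule no_crossing_okD[OF up]) (use cell_ok_basic in \<open>auto simp: thr_lo_def\<close>)
  have "null_rate z u = null_rate (side c * z) u" by (rule null_rate_side[symmetric])
  also have "\<dots> \<le> null_rate (v_hi c) u"
    unfolding null_rate_def
    using z cell_ok_basic u by (intro folded_tail_mono sd_bounds) (auto simp: cell_set_def mult.commute)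
  also have "\<dots> \<le> ?K0 * Q u + Q u"
    unfolding null_rate_def v_hi_def using cell_ok_basic u
    by (intro add_mono tail_le_tail_ratio_bound shifted_tail_le sd_bounds) (auto simp: v_hi_def)
  finally have 0: "null_rate z u \<le> (?K0 + 1) * Q u" by (simp add: distrib_right)
  have "alt1_rate z u \<le> Q ((u - (12/5 - 3/10 * (of_int zm / 100))) / sd1) + Q u"
    unfolding alt1_rate_def using zm z4 u sd_bounds
    by (intro add_mono shifted_tail_le Q_antimono divide_right_mono) auto
  also have "\<dots> \<le> ?K1 * Q u + Q u"
    by (intro add_right_mono tail_le_tail_ratio_bound sd_bounds u)
  finally have 1: "alt1_rate z u \<le> (?K1 + 1) * Q u" by (simp add: distrib_right)
  have "alt2_rate z u \<le> Q ((u - (22/5 - 18/25 * (of_int zm / 100))) / sd2) + Q u"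
    unfolding alt2_rate_def using zm z4 u sd_bounds
    by (intro add_mono shifted_tail_le Q_antimono divide_right_mono) auto
  also have "\<dots> \<le> ?K2 * Q u + Q u"
    by (intro add_right_mono tail_le_tail_ratio_bound sd_bounds u)
  finally have 2: "alt2_rate z u \<le> (?K2 + 1) * Q u" by (simp add: distrib_right)
  have "(96 * ?K0 + ?K1 + 3 * ?K2) * Q u \<le> 19880 * Q u"
    using K Q_pos[of u] by (intro mult_right_mono) auto
  with 0 1 2 show ?thesis unfolding reject_rate_def by (simp add: algebra_simps)
qed

lemma null_rate_ge_cell_bound:
  assumes z: "z \<in> cell_set c" and u: "thr_lo c \<le> u" "u \<le> thr_hi c"
  shows "Q u * cell_bound c z \<le> null_rate z u"
proof -
  define y where "y = side c * z"
  have y: "v_lo c < y" "y \<le> v_hi c" "0 \<le> y"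
    using z cell_ok_basic by (auto simp: y_def cell_set_def)
  let ?q = "\<lambda>t y. Q ((t - 3/10 * y) / sd1)"
  note Qp = Q_pos
  \<comment> \<open>The selected end has the smaller ratio. This was checked for one value of \<open>\<bar>z\<bar>\<close>, the smallest one
    for the left and the largest one for the right end, and extends to \<open>y\<close> by monotonicity.\<close>
  have ref: "?q (thr_ref c) y / Q (thr_ref c) * Q t \<le> ?q t y" if "t = thr_lo c \<or> t = thr_hi c" for t
  proof (cases "use_left c")
    case True
    have ty: "endpoint_ok (z_lo c) (u_lo c) (u_hi c)" using ok True by (cases c) auto
    have "?q (thr_lo c) (v_lo c) * Q (thr_hi c) \<le> ?q (thr_hi c) (v_lo c) * Q (thr_lo c)"
      unfolding v_lo_def by (rule endpoint_okD[OF ty]) (use cell_ok_basic in \<open>auto simp: thr_lo_def thr_hi_def\<close>)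
    hence "(?q (thr_lo c) (v_lo c) * Q (thr_hi c)) * ?q (thr_lo c) y
        \<le> (?q (thr_hi c) (v_lo c) * Q (thr_lo c)) * ?q (thr_lo c) y"
      using Qp by (intro mult_right_mono) (auto simp: less_imp_le)
    also have "\<dots> = (?q (thr_hi c) (v_lo c) * ?q (thr_lo c) y) * Q (thr_lo c)" by simp
    also have "\<dots> \<le> (?q (thr_hi c) y * ?q (thr_lo c) (v_lo c)) * Q (thr_lo c)"
      using y Qp cell_ok_basic
      by (intro mult_right_mono tail_monotone_likelihood_ratio sd_bounds) (auto simp: less_imp_le)
    finally have "?q (thr_lo c) (v_lo c) * (Q (thr_hi c) * ?q (thr_lo c) y)
        \<le> ?q (thr_lo c) (v_lo c) * (?q (thr_hi c) y * Q (thr_lo c))" by (simp add: mult_ac)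
    hence "Q (thr_hi c) * ?q (thr_lo c) y \<le> ?q (thr_hi c) y * Q (thr_lo c)"
      using Qp by (subst (asm) mult_le_cancel_left_pos) auto
    thus ?thesis using that True Qp[of "thr_lo c"] by (auto simp: thr_ref_def field_simps)
  next
    case False
    have ty: "endpoint_ok (z_hi c) (u_hi c) (u_lo c)" using ok False by (cases c) auto
    have "?q (thr_hi c) (v_hi c) * Q (thr_lo c) \<le> ?q (thr_lo c) (v_hi c) * Q (thr_hi c)"
      unfolding v_hi_def by (rule endpoint_okD[OF ty]) (use cell_ok_basic in \<open>auto simp: thr_lo_def thr_hi_def\<close>)
    hence "(?q (thr_hi c) (v_hi c) * Q (thr_lo c)) * ?q (thr_lo c) y
        \<le> (?q (thr_lo c) (v_hi c) * Q (thr_hi c)) * ?q (thr_lo c) y"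
      using Qp by (intro mult_right_mono) (auto simp: less_imp_le)
    moreover have "(?q (thr_hi c) y * ?q (thr_lo c) (v_hi c)) * Q (thr_lo c)
        \<le> (?q (thr_hi c) (v_hi c) * ?q (thr_lo c) y) * Q (thr_lo c)"
      using y Qp cell_ok_basic
      by (intro mult_right_mono tail_monotone_likelihood_ratio sd_bounds) (auto simp: less_imp_le)
    ultimately have "?q (thr_lo c) (v_hi c) * (?q (thr_hi c) y * Q (thr_lo c))
        \<le> ?q (thr_lo c) (v_hi c) * (?q (thr_lo c) y * Q (thr_hi c))" by (simp add: mult_ac)
    hence "?q (thr_hi c) y * Q (thr_lo c) \<le> ?q (thr_lo c) y * Q (thr_hi c)"
      using Qp by (subst (asm) mult_le_cancel_left_pos) auto
    thus ?thesis using that False Qp[of "thr_hi c"] by (auto simp: thr_ref_def field_simps)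
  qed
  have "?q (thr_ref c) y / Q (thr_ref c) * Q u \<le> ?q u y"
    by (rule tail_ratio_quasiconcave[OF sd_bounds(1,2) u]) (use ref in auto)
  moreover have "Q ((thr_hi c + 3/10 * y) / sd1) * Q u \<le> Q ((u + 3/10 * y) / sd1) * Q (thr_hi c)"
    using y u cell_ok_basic by (intro shifted_tail_ratio_antimono sd_bounds) auto
  hence "Q ((thr_hi c + 3/10 * y) / sd1) / Q (thr_hi c) * Q u \<le> Q ((u + 3/10 * y) / sd1)"
    using Qp[of "thr_hi c"] by (simp add: field_simps)
  ultimately have "Q u * cell_bound c z \<le> null_rate y u"
    unfolding cell_bound_def null_rate_def y_def[symmetric] by (simp add: algebra_simps)
  thus ?thesis unfolding y_def null_rate_side .
qed

lemma continuous_on_cell_bound: "continuous_on S (\<lambda>z. std_normal_density z * cell_bound c z)"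
  unfolding cell_bound_def
  by (intro continuous_intros ballI Q_neq_0) (use sd_bounds in simp_all)

text \<open>Both summands of \<open>cell_bound\<close> are tails with arguments linear in \<open>z\<close>, with slopes \<open>-3/10\<close> and
  \<open>3/10\<close>, so the midpoint rule applies because \<open>(3/10)\<^sup>2 + sd1\<^sup>2 = 1\<close>.\<close>

lemma cell_bound_integral:
  defines "l \<equiv> if mirrored c then - v_hi c else v_lo c" and "r \<equiv> if mirrored c then - v_lo c else v_hi c"
  shows "of_int (weight c) / 100000 \<le> integral {l..r} (\<lambda>z. std_normal_density z * cell_bound c z)"
proof -
  define m where "m = (v_lo c + v_hi c) / 2"
  define w where "w = (v_hi c - v_lo c) * (1 - (v_hi c - v_lo c)\<^sup>2 / (24 * sd1\<^sup>2))"
  have lr: "l \<le> r" "r - l = v_hi c - v_lo c" "(l + r) / 2 = side c * m"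
    using cell_ok_basic by (auto simp: l_def r_def m_def side_def)
  have cs: "(- (3/10) * side c)\<^sup>2 + sd1\<^sup>2 = 1" "(3/10 * side c)\<^sup>2 + sd1\<^sup>2 = 1"
    unfolding sd_squares power_mult_distrib using side_cases by (auto simp: power2_eq_square)
  have int: "(\<lambda>z. std_normal_density z * Q ((t + e * z) / sd1)) integrable_on {l..r}" for t e
    by (intro integrable_continuous_interval continuous_intros) (use sd_bounds in simp_all)
  let ?I = "\<lambda>t e. integral {l..r} (\<lambda>z. std_normal_density z * Q ((t + e * z) / sd1))"
  have mid: "std_normal_density (side c * m) = std_normal_density m" "side c * (side c * m) = m"
    using side_cases by (auto simp: std_normal_density_def)
  have 1: "w * (std_normal_density m * Q ((thr_ref c - 3/10 * m) / sd1)) \<le> ?I (thr_ref c) (- (3/10) * side c)"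
    using midpoint_lower_bound[OF sd_bounds(1) cs(1) lr(1), of "thr_ref c"] mid
    unfolding lr w_def by (simp add: mult.assoc)
  have 2: "w * (std_normal_density m * Q ((thr_hi c + 3/10 * m) / sd1)) \<le> ?I (thr_hi c) (3/10 * side c)"
    using midpoint_lower_bound[OF sd_bounds(1) cs(2) lr(1), of "thr_hi c"] mid
    unfolding lr w_def by (simp add: mult.assoc)
  let ?U = "if use_left c then u_lo c else u_hi c"
  have "ivl_le (ivl_rat (weight c) 100000) (ivl_cell_integral (z_lo c) (z_hi c) ?U (u_hi c))"
    using ok by (cases c) auto
  moreover have "encloses (ivl_cell_integral (z_lo c) (z_hi c) ?U (u_hi c))
      (w * std_normal_density m
        * (Q ((thr_ref c - 3/10 * m) / sd1) / Q (thr_ref c) + Q ((thr_hi c + 3/10 * m) / sd1) / Q (thr_hi c)))"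
    unfolding w_def m_def
    by (rule encloses_ivl_cell_integral)
       (use cell_ok_basic in \<open>auto simp: thr_ref_def thr_lo_def thr_hi_def v_lo_def v_hi_def\<close>)
  ultimately have "of_int (weight c) / of_int 100000 \<le> w * std_normal_density m
        * (Q ((thr_ref c - 3/10 * m) / sd1) / Q (thr_ref c) + Q ((thr_hi c + 3/10 * m) / sd1) / Q (thr_hi c))"
    by (rule ivl_le_imp_le[rotated 2, OF _ encloses_ivl_rat])
  also have "\<dots> = w * (std_normal_density m * Q ((thr_ref c - 3/10 * m) / sd1)) / Q (thr_ref c)
      + w * (std_normal_density m * Q ((thr_hi c + 3/10 * m) / sd1)) / Q (thr_hi c)"
    by (simp add: distrib_left)
  also have "\<dots> \<le> ?I (thr_ref c) (- (3/10) * side c) / Q (thr_ref c) + ?I (thr_hi c) (3/10 * side c) / Q (thr_hi c)"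
    using 1 2 Q_pos by (intro add_mono divide_right_mono) (auto simp: less_imp_le)
  also have "\<dots> = integral {l..r} (\<lambda>z. std_normal_density z * Q ((thr_ref c + - (3/10) * side c * z) / sd1) / Q (thr_ref c)
      + std_normal_density z * Q ((thr_hi c + 3/10 * side c * z) / sd1) / Q (thr_hi c))"
    by (simp only: Henstock_Kurzweil_Integration.integral_add[OF integrable_on_divide[OF int]
          integrable_on_divide[OF int]] Henstock_Kurzweil_Integration.integral_divide)
  also have "\<dots> = integral {l..r} (\<lambda>z. std_normal_density z * cell_bound c z)"
    by (simp add: cell_bound_def distrib_left mult.assoc)
  finally show ?thesis by simp
qed

end

section \<open>The Benjamini--Hochberg procedure under a deviation bound\<close>

lemma bh_R_le: "bh_R \<alpha> m p \<le> m"
proof -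
  let ?S = "{r \<in> {1..m}. card {i. i < m \<and> p i \<le> bh_critical \<alpha> m r} \<ge> r}"
  have "finite ?S" by simp
  thus ?thesis using Max_in[of ?S] by (auto simp: bh_R_def Let_def simp del: Max_in)
qed

lemma bh_R_ge:
  assumes "1 \<le> r" "r \<le> m" "r \<le> card {i. i < m \<and> p i \<le> bh_critical \<alpha> m r}"
  shows "r \<le> bh_R \<alpha> m p"
proof -
  let ?S = "{r \<in> {1..m}. card {i. i < m \<and> p i \<le> bh_critical \<alpha> m r} \<ge> r}"
  have "r \<in> ?S" "finite ?S" using assms by auto
  thus ?thesis using Max_ge[of ?S r] by (auto simp: bh_R_def Let_def)
qed

text \<open>At the maximal \<open>R\<close> the count is exactly \<open>R\<close>: if it were larger, \<open>R + 1\<close> would be admissible, too.\<close>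

lemma card_bh_rejected:
  assumes "bh_R \<alpha> m p \<noteq> 0" "0 \<le> \<alpha>"
  shows "card {i. i < m \<and> p i \<le> bh_critical \<alpha> m (bh_R \<alpha> m p)} = bh_R \<alpha> m p"
proof (rule antisym)
  let ?S = "{r \<in> {1..m}. card {i. i < m \<and> p i \<le> bh_critical \<alpha> m r} \<ge> r}"
  let ?R = "bh_R \<alpha> m p"
  let ?c = "\<lambda>r. card {i. i < m \<and> p i \<le> bh_critical \<alpha> m r}"
  have "?R \<in> ?S"
    using assms(1) Max_in[of ?S] by (auto simp: bh_R_def Let_def simp del: Max_in split: if_splits)
  thus "?R \<le> ?c ?R" by simp
  show "?c ?R \<le> ?R"
  proof (rule ccontr)
    assume gt: "\<not> ?c ?R \<le> ?R"
    have "?c ?R \<le> card {..<m}" by (intro card_mono) auto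
    hence m: "Suc ?R \<le> m" using gt by simp
    have "bh_critical \<alpha> m ?R \<le> bh_critical \<alpha> m (Suc ?R)"
      unfolding bh_critical_def using assms(2) by (intro divide_right_mono mult_left_mono) auto
    hence "?c ?R \<le> ?c (Suc ?R)" by (intro card_mono) auto
    hence "Suc ?R \<le> ?R" using gt m by (intro bh_R_ge) auto
    thus False by simp
  qed
qed

lemma p_value_eq: "p_value x = 2 * Q \<bar>x\<bar>"
  by (simp add: p_value_def Q_def)

lemma p_value_le_iff: "p_value x \<le> 2 * Q u \<longleftrightarrow> u \<le> \<bar>x\<bar>"
  unfolding p_value_eq using Q_antimono[of u "\<bar>x\<bar>"] Q_strict_antimono[of "\<bar>x\<bar>" u] by (cases "u \<le> \<bar>x\<bar>") auto

lemma bh_FDP_nonneg: "bh_FDP \<alpha> m I p \<ge> 0"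
  by (simp add: bh_FDP_def)

lemma bh_FDP_le_1:
  assumes "0 \<le> \<alpha>"
  shows "bh_FDP \<alpha> m I p \<le> 1"
proof (cases "bh_R \<alpha> m p = 0")
  case False
  have "bh_V \<alpha> m I p \<le> card {i. i < m \<and> p i \<le> bh_critical \<alpha> m (bh_R \<alpha> m p)}"
    unfolding bh_V_def using False by (intro card_mono) (auto simp: bh_rejected_def)
  thus ?thesis using card_bh_rejected[OF False assms] False by (simp add: bh_FDP_def divide_le_eq_1)
qed (simp add: bh_FDP_def bh_V_def bh_rejected_def)

text \<open>Let \<open>u\<close> be the threshold that BH uses, so \<open>2 * Q u = \<alpha> * R / m\<close>. Enough statistics exceed \<open>uB\<close>, so \<open>u \<le> uB\<close>.
  Since \<open>R\<close> is also the number of statistics that exceed \<open>u\<close>, the rate \<open>\<alpha> * G u\<close> agrees with \<open>2 * Q u\<close> up to the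
  deviation, which is impossible for \<open>u \<le> uA\<close>. Finally \<open>V / R\<close> is \<open>\<alpha> * (V / m)\<close> divided by \<open>2 * Q u\<close>.\<close>

lemma bh_FDP_lower_bound:
  fixes x :: "nat \<Rightarrow> real" and G G0 :: "real \<Rightarrow> real"
  assumes m: "0 < m" and I: "I \<subseteq> {..<m}" and \<alpha>: "0 < \<alpha>" "\<alpha> < 1" and \<delta>: "0 \<le> \<delta>"
    and dev: "\<And>u. 0 < u \<Longrightarrow> \<bar>card {i. i < m \<and> u \<le> \<bar>x i\<bar>} / m - G u\<bar> \<le> \<delta>"
    and dev0: "\<And>u. 0 < u \<Longrightarrow> \<bar>card {i \<in> I. u \<le> \<bar>x i\<bar>} / m - G0 u\<bar> \<le> \<delta>"
    and uB: "0 < uB" "2 * Q uB + \<alpha> * \<delta> \<le> \<alpha> * G uB"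
    and uA: "\<And>u. 0 < u \<Longrightarrow> u \<le> uA \<Longrightarrow> \<alpha> * G u + \<alpha> * \<delta> < 2 * Q u"
    and F: "\<And>u. uA \<le> u \<Longrightarrow> 0 < u \<Longrightarrow> u \<le> uB \<Longrightarrow> 2 * Q u * F \<le> \<alpha> * G0 u"
  shows "F - \<alpha> * \<delta> / (2 * Q uB) \<le> bh_FDP \<alpha> m I (\<lambda>i. p_value (x i))"
proof -
  let ?p = "\<lambda>i. p_value (x i)"
  define n where "n u = card {i. i < m \<and> u \<le> \<bar>x i\<bar>}" for u
  define R where "R = bh_R \<alpha> m ?p"
  have nm: "n u \<le> m" for u
  proof -
    have "n u \<le> card {..<m}" unfolding n_def by (intro card_mono) auto
    thus ?thesis by simp
  qed
  have "real (n uB) / m \<ge> G uB - \<delta>" using dev[OF uB(1)] unfolding n_def by linarith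
  hence "\<alpha> * (real (n uB) / m) \<ge> \<alpha> * (G uB - \<delta>)" using \<alpha> by (intro mult_left_mono) auto
  hence crit: "bh_critical \<alpha> m (n uB) \<ge> 2 * Q uB"
    using uB(2) by (simp add: bh_critical_def algebra_simps)
  have n1: "n uB \<ge> 1"
    using crit Q_pos[of uB] by (cases "n uB = 0") (auto simp: bh_critical_def)
  have "n uB \<le> card {i. i < m \<and> ?p i \<le> bh_critical \<alpha> m (n uB)}"
  proof -
    have "{i. i < m \<and> uB \<le> \<bar>x i\<bar>} \<subseteq> {i. i < m \<and> ?p i \<le> bh_critical \<alpha> m (n uB)}"
      using order_trans[OF p_value_le_iff[THEN iffD2] crit] by blast
    from card_mono[OF _ this] show ?thesis by (simp add: n_def)
  qed
  hence nR: "n uB \<le> R" unfolding R_def using n1 nm by (intro bh_R_ge) auto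
  hence R: "R \<ge> 1" "R \<noteq> 0" "R \<le> m" using n1 bh_R_le[of \<alpha> m ?p] by (auto simp: R_def)
  \<comment> \<open>\<open>t\<close> is the threshold for the p-values, and \<open>u\<close> below the corresponding one for \<open>\<bar>x\<bar>\<close>\<close>
  define t where "t = bh_critical \<alpha> m R"
  have "bh_critical \<alpha> m (n uB) \<le> t"
    unfolding t_def bh_critical_def using nR \<alpha> by (intro divide_right_mono mult_left_mono) auto
  hence t: "2 * Q uB \<le> t" using crit by simp
  have "\<alpha> * real R \<le> \<alpha> * real m" using R \<alpha> by (intro mult_left_mono) auto
  hence "t \<le> \<alpha>" unfolding t_def bh_critical_def using m by (simp add: divide_le_eq)
  hence t1: "t < 1" using \<alpha> by simp
  have "\<exists>u\<ge>0. u \<le> uB \<and> Q u = t / 2"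
  proof (rule IVT2)
    show "\<forall>x. 0 \<le> x \<and> x \<le> uB \<longrightarrow> isCont Q x"
      using DERIV_isCont[OF Q_has_derivative[OF DERIV_ident]] by blast
  qed (use t t1 uB Q_0 in auto)
  then obtain u where u: "0 \<le> u" "u \<le> uB" "t = 2 * Q u" by auto
  have u0: "0 < u" using u t1 Q_0 by (cases "u = 0") auto
  have rej: "?p i \<le> bh_critical \<alpha> m R \<longleftrightarrow> u \<le> \<bar>x i\<bar>" for i
    unfolding t_def[symmetric] u(3) by (rule p_value_le_iff)
  have nu: "n u = R"
    using card_bh_rejected[of \<alpha> m ?p] R \<alpha> unfolding R_def[symmetric] rej n_def by simp
  have uR: "2 * Q u = \<alpha> * (real R / m)" using u(3) by (simp add: t_def bh_critical_def)
  have "uA < u"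
  proof (rule ccontr)
    assume "\<not> uA < u"
    hence "\<alpha> * G u + \<alpha> * \<delta> < \<alpha> * (real R / m)" using uA[OF u0] uR by simp
    hence "\<alpha> * (G u + \<delta>) < \<alpha> * (real R / m)" by (simp add: distrib_left)
    hence "G u + \<delta> < real R / m" using \<alpha> by (subst (asm) mult_less_cancel_left_pos) auto
    thus False using dev[OF u0] nu unfolding n_def by simp
  qed
  define V where "V = card {i \<in> I. u \<le> \<bar>x i\<bar>}"
  have "I \<inter> bh_rejected \<alpha> m ?p = {i \<in> I. u \<le> \<bar>x i\<bar>}"
    using I R by (auto simp: bh_rejected_def R_def[symmetric] rej)
  hence "bh_FDP \<alpha> m I ?p = real V / R"
    using R by (simp add: bh_FDP_def bh_V_def V_def R_def[symmetric])
  also have "\<dots> = \<alpha> * (real V / m) / (2 * Q u)"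
    unfolding uR using m \<alpha> R by simp
  finally have FDP: "bh_FDP \<alpha> m I ?p = \<alpha> * (real V / m) / (2 * Q u)" .
  have "real V / m \<ge> G0 u - \<delta>" using dev0[OF u0] unfolding V_def by linarith
  hence "\<alpha> * (G0 u - \<delta>) \<le> \<alpha> * (real V / m)" using \<alpha> by (intro mult_left_mono) auto
  hence "\<alpha> * (G0 u - \<delta>) / (2 * Q u) \<le> bh_FDP \<alpha> m I ?p"
    unfolding FDP using Q_pos[of u] by (intro divide_right_mono) auto
  moreover have "F \<le> \<alpha> * G0 u / (2 * Q u)"
    using F[of u] \<open>uA < u\<close> u u0 Q_pos[of u] by (simp add: le_divide_eq mult.commute)
  moreover have "\<alpha> * \<delta> / (2 * Q u) \<le> \<alpha> * \<delta> / (2 * Q uB)"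
    using Q_antimono[OF u(2)] Q_pos \<alpha> \<delta> by (intro divide_left_mono) auto
  ultimately show ?thesis by (simp add: right_diff_distrib diff_divide_distrib)
qed

lemma Phi_attains:
  assumes "0 < p" "p < 1"
  obtains x where "Phi x = p"
proof -
  have "eventually (\<lambda>x. Q x < 1 - p) at_top" "eventually (\<lambda>x. Q x < p) at_top"
    using order_tendstoD(2)[OF Q_tendsto_0] assms by simp_all
  hence "eventually (\<lambda>x. Q x < 1 - p \<and> Q x < p \<and> 0 \<le> x) at_top"
    using eventually_ge_at_top[of 0] by eventually_elim auto
  then obtain b where b: "Q b < 1 - p" "Q b < p" "0 \<le> b" by (auto simp: eventually_at_top_linorder)
  have "\<exists>x\<ge>- b. x \<le> b \<and> Q x = 1 - p"
    using b by (intro IVT2) (auto simp: Q_uminus intro!: DERIV_isCont[OF Q_has_derivative[OF DERIV_ident]])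
  thus ?thesis using that by (auto simp: Q_def)
qed

context prob_space
begin

lemma std_normal_prob_le:
  assumes "distributed M lborel X std_normal_density"
  shows "expectation (\<lambda>\<omega>. indicator {..x} (X \<omega>)) = Phi x"
proof -
  have "expectation (\<lambda>\<omega>. indicator {..x} (X \<omega>)) = (\<integral>t. std_normal_density t * indicator {..x} t \<partial>lborel)"
    by (rule distributed_integral[OF assms, symmetric]) auto
  also have "\<dots> = (LINT t|std_normal_distribution. indicator {..x} t)"
    by (subst integral_density) auto
  also have "\<dots> = Phi x" by (simp add: Phi_def cdf_def)
  finally show ?thesis .
qed

lemma empirical_cdf_deviation:
  fixes x \<delta> :: real
  assumes J: "finite J" "J \<noteq> {}" and ind: "indep_vars (\<lambda>_. borel) Y J"
    and Y: "\<And>k. k \<in> J \<Longrightarrow> distributed M lborel (Y k) std_normal_density" and \<delta>: "0 \<le> \<delta>"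
  defines "B \<equiv> {\<omega> \<in> space M. card J * \<delta> \<le> \<bar>card {k \<in> J. Y k \<omega> \<le> x} - card J * Phi x\<bar>}"
  shows "B \<in> events" "prob B \<le> 2 * exp (- 2 * \<delta>\<^sup>2 * card J)"
proof -
  define Z where "Z k \<omega> = (indicator {..x} (Y k \<omega>) :: real)" for k \<omega>
  have mY: "Y k \<in> borel_measurable M" if "k \<in> J" for k
    using distributed_measurable[OF Y[OF that]] by simp
  have Zm: "(\<lambda>\<omega>. \<Sum>k\<in>J. Z k \<omega>) \<in> borel_measurable M"
    unfolding Z_def using mY by (intro borel_measurable_sum) measurable
  have cnt: "real (card {k \<in> J. Y k \<omega> \<le> x}) = (\<Sum>k\<in>J. Z k \<omega>)" for \<omega>
    using sum.inter_filter[OF J(1), of "\<lambda>_. 1 :: real" "\<lambda>k. Y k \<omega> \<le> x"] by (simp add: Z_def indicator_def of_bool_def)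
  have mean: "(\<Sum>k\<in>J. expectation (Z k)) = card J * Phi x"
    using std_normal_prob_le[OF Y] by (simp add: Z_def[abs_def])
  interpret Z: Hoeffding_ineq M J Z "\<lambda>_. 0" "\<lambda>_. 1" "card J * Phi x"
  proof unfold_locales
    show "finite J" by fact
    show "indep_vars (\<lambda>_. borel) Z J"
      unfolding Z_def by (rule indep_vars_compose2[OF ind]) measurable
    show "AE \<omega> in M. Z k \<omega> \<in> {0..1}" if "k \<in> J" for k by (auto simp: Z_def)
    show "real (card J) * Phi x \<equiv> \<Sum>i\<in>J. expectation (Z i)" using mean by simp
  qed
  have B: "B = {\<omega> \<in> space M. card J * \<delta> \<le> \<bar>(\<Sum>k\<in>J. Z k \<omega>) - card J * Phi x\<bar>}"
    unfolding B_def cnt ..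
  show "B \<in> events" unfolding B using Zm by measurable
  have "card J > 0" using J by (simp add: card_gt_0_iff)
  hence "prob B \<le> 2 * exp (- 2 * (card J * \<delta>)\<^sup>2 / (\<Sum>k\<in>J. (1 - 0 :: real)\<^sup>2))"
    unfolding B using \<delta> by (intro Z.Hoeffding_ineq_abs_ge) auto
  also have "- 2 * (card J * \<delta>)\<^sup>2 / (\<Sum>k\<in>J. (1 - 0 :: real)\<^sup>2) = - 2 * \<delta>\<^sup>2 * card J"
    using \<open>card J > 0\<close> by (simp add: power2_eq_square)
  finally show "prob B \<le> 2 * exp (- 2 * \<delta>\<^sup>2 * card J)" .
qed

text \<open>A quantitative Glivenko--Cantelli theorem. Between neighbouring \<open>j / L\<close>-quantiles \<open>\<Phi>\<close> varies by at most
  \<open>\<delta> / 2\<close>, so by monotonicity it suffices to control the empirical distribution function at these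
  points. The bound involves neither the space nor the variables.\<close>

lemma uniform_empirical_deviation:
  fixes \<delta> :: real and L :: nat
  assumes J: "finite J" "J \<noteq> {}" and ind: "indep_vars (\<lambda>_. borel) Y J"
    and Y: "\<And>k. k \<in> J \<Longrightarrow> distributed M lborel (Y k) std_normal_density"
    and \<delta>: "0 < \<delta>" and L: "2 / \<delta> \<le> L"
  shows "\<exists>B\<in>events. prob B \<le> 2 * real L * exp (- (\<delta>\<^sup>2 / 2) * card J) \<and>
    (\<forall>\<omega>\<in>space M - B. \<forall>x. \<bar>card {k \<in> J. x \<le> Y k \<omega>} / card J - Q x\<bar> \<le> \<delta>
        \<and> \<bar>card {k \<in> J. Y k \<omega> \<le> x} / card J - Phi x\<bar> \<le> \<delta>)"
proof -
  have L0: "0 < real L" using L \<delta> by (smt (verit) divide_pos_pos)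
  have L1: "1 / real L \<le> \<delta> / 2" using L \<delta> L0 by (simp add: field_simps)
  have "\<exists>x. Phi x = real j / real L" if "j \<in> {1..<L}" for j
    using that L0 by (metis Phi_attains divide_less_eq_1_pos divide_pos_pos atLeastLessThan_iff
        of_nat_0_less_iff of_nat_less_iff less_le_trans zero_less_one)
  then obtain q where q: "\<And>j. j \<in> {1..<L} \<Longrightarrow> Phi (q j) = real j / real L" by metis
  define n where "n = real (card J)"
  have n: "0 < n" using J by (simp add: n_def card_gt_0_iff)
  define Bj where "Bj j = {\<omega> \<in> space M. n * (\<delta> / 2) \<le> \<bar>card {k \<in> J. Y k \<omega> \<le> q j} - n * Phi (q j)\<bar>}" for j
  define B where "B = (\<Union>j\<in>{1..<L}. Bj j)"
  have Bj: "Bj j \<in> events" "prob (Bj j) \<le> 2 * exp (- (\<delta>\<^sup>2 / 2) * card J)" for j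
  proof -
    have "0 \<le> \<delta> / 2" using \<delta> by simp
    note dev = empirical_cdf_deviation[OF J ind Y this, of "q j"]
    show "Bj j \<in> events" unfolding Bj_def n_def by (rule dev(1))
    have "- 2 * (\<delta> / 2)\<^sup>2 * card J = - (\<delta>\<^sup>2 / 2) * card J" by (simp add: power2_eq_square)
    with dev(2) show "prob (Bj j) \<le> 2 * exp (- (\<delta>\<^sup>2 / 2) * card J)" unfolding Bj_def n_def by metis
  qed
  have "prob B \<le> (\<Sum>j\<in>{1..<L}. prob (Bj j))"
    unfolding B_def using Bj(1) by (intro finite_measure_subadditive_finite) auto
  also have "\<dots> \<le> (\<Sum>j\<in>{1..<L}. 2 * exp (- (\<delta>\<^sup>2 / 2) * card J))"
    by (intro sum_mono Bj(2))
  also have "\<dots> \<le> 2 * real L * exp (- (\<delta>\<^sup>2 / 2) * card J)"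
    by (auto intro!: mult_right_mono)
  finally have pB: "prob B \<le> 2 * real L * exp (- (\<delta>\<^sup>2 / 2) * card J)" .
  have "\<bar>card {k \<in> J. x \<le> Y k \<omega>} / n - Q x\<bar> \<le> \<delta> \<and> \<bar>card {k \<in> J. Y k \<omega> \<le> x} / n - Phi x\<bar> \<le> \<delta>"
    if \<omega>: "\<omega> \<in> space M - B" for \<omega> x
  proof -
    define F where "F x = real (card {k \<in> J. Y k \<omega> \<le> x}) / n" for x
    define F' where "F' x = real (card {k \<in> J. Y k \<omega> < x}) / n" for x
    \<comment> \<open>\<open>F'\<close> counts strict inequalities; it is the complement of the empirical upper tail\<close>
    have grid: "\<bar>F (q j) - real j / real L\<bar> \<le> \<delta> / 2" if "j \<in> {1..<L}" for j
    proof -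
      have "\<bar>card {k \<in> J. Y k \<omega> \<le> q j} - n * Phi (q j)\<bar> \<le> n * (\<delta> / 2)"
        using \<omega> that by (force simp: B_def Bj_def)
      hence "\<bar>card {k \<in> J. Y k \<omega> \<le> q j} - n * Phi (q j)\<bar> / n \<le> \<delta> / 2"
        using n by (simp add: divide_le_eq mult.commute)
      also have "\<bar>card {k \<in> J. Y k \<omega> \<le> q j} - n * Phi (q j)\<bar> / n
          = \<bar>(card {k \<in> J. Y k \<omega> \<le> q j} - n * Phi (q j)) / n\<bar>" using n by (simp add: abs_divide)
      also have "(card {k \<in> J. Y k \<omega> \<le> q j} - n * Phi (q j)) / n = F (q j) - real j / real L"
        using n q[OF that] by (simp add: F_def diff_divide_distrib)
      finally show ?thesis .
    qed
    have mono: "F y \<le> F' x" if "y < x" for x y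
      unfolding F_def F'_def using J n that by (intro divide_right_mono) (auto intro!: card_mono)
    have F'F: "F' x \<le> F x" for x
      unfolding F_def F'_def using J n by (intro divide_right_mono) (auto intro!: card_mono)
    have F1: "F x \<le> 1" for x
    proof -
      have "card {k \<in> J. Y k \<omega> \<le> x} \<le> card J" using J by (intro card_mono) auto
      thus ?thesis using n by (simp add: F_def n_def divide_le_eq_1)
    qed
    have F'0: "0 \<le> F' x" for x using n by (simp add: F'_def)
    have Phi01: "0 < Phi x" "Phi x < 1" using Q_pos[of x] Q_lt_1[of x] by (simp_all add: Q_def)
    have Phi_less: "y < x" if "Phi y < Phi x" for x y
      using that Q_antimono[of x y] by (cases "y < x") (auto simp: Q_def)
    have up: "F x \<le> Phi x + \<delta>"
    proof -
      \<comment> \<open>the next quantile to the right; if there is none, \<open>\<Phi> x\<close> is within \<open>1 / L\<close> of \<open>1\<close>\<close>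
      define j where "j = nat \<lfloor>L * Phi x\<rfloor> + 1"
      have j: "L * Phi x < j" "real j \<le> L * Phi x + 1"
        using L0 Phi01 unfolding j_def by (simp_all; linarith)+
      have jL: "Phi x < real j / L" "real j / L \<le> Phi x + 1 / L"
        using j L0 by (simp_all add: field_simps)
      show ?thesis
      proof (cases "j < L")
        case True
        hence jI: "j \<in> {1..<L}" by (simp add: j_def)
        have "x < q j" using Phi_less jL q[OF jI] by simp
        hence "F x \<le> F (q j)" using mono F'F order_trans by blast
        thus ?thesis using grid[OF jI] jL L1 by linarith
      next
        case False
        hence "1 \<le> real j / L" using L0 by simp
        thus ?thesis using jL L1 F1[of x] \<delta> by linarith
      qed
    qed
    have low: "Phi x - \<delta> \<le> F' x"
    proof -
      \<comment> \<open>the last quantile strictly to the left, or none if \<open>\<Phi> x \<le> 1 / L\<close>\<close>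
      define j where "j = nat (\<lceil>L * Phi x\<rceil> - 1)"
      have "0 < \<lceil>L * Phi x\<rceil>" using L0 Phi01 by simp
      hence j: "real j < L * Phi x" "L * Phi x \<le> real j + 1"
        unfolding j_def by (simp_all; linarith)+
      have jL: "real j / L < Phi x" "Phi x \<le> real j / L + 1 / L"
        using j L0 by (simp_all add: field_simps)
      show ?thesis
      proof (cases "j = 0")
        case True
        thus ?thesis using jL L1 F'0[of x] \<delta> by simp
      next
        case False
        have "real j / L < 1" using jL Phi01 by linarith
        hence jI: "j \<in> {1..<L}" using False L0 by simp
        have "q j < x" using Phi_less jL q[OF jI] by simp
        thus ?thesis using mono[of "q j" x] grid[OF jI] jL L1 by linarith
      qed
    qed
    have "{k \<in> J. x \<le> Y k \<omega>} = J - {k \<in> J. Y k \<omega> < x}" by auto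
    hence "card {k \<in> J. x \<le> Y k \<omega>} = card J - card {k \<in> J. Y k \<omega> < x}"
      using J by (simp add: card_Diff_subset)
    moreover have "card {k \<in> J. Y k \<omega> < x} \<le> card J" using J by (intro card_mono) auto
    ultimately have "card {k \<in> J. x \<le> Y k \<omega>} / n = 1 - F' x"
      using n by (simp add: F'_def n_def of_nat_diff diff_divide_distrib)
    thus ?thesis using up low F'F[of x] unfolding F_def[symmetric] Q_def by (simp add: abs_le_iff)
  qed
  thus ?thesis using pB Bj(1) unfolding n_def
    by (intro bexI[of _ B]) (auto simp: B_def)
qed

end

section \<open>False discovery proportion in the three-block model\<close>

lemma Phi_eq_Q_uminus: "Phi x = Q (- x)"
  using Q_uminus[of x] by (simp add: Q_def)

text \<open>A two-sided rejection is one of two disjoint one-sided events for the noise, which costs twice the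
  deviation.\<close>

lemma two_sided_block_rate:
  fixes y :: "'k \<Rightarrow> real" and src :: "nat \<Rightarrow> 'k"
  assumes I: "finite I" "I \<noteq> {}" and inj: "inj_on src I" and s: "0 < s" and u: "0 < u"
    and x: "\<And>i. i \<in> I \<Longrightarrow> x i = \<mu> + s * y (src i)"
    and dev: "\<And>t. \<bar>card {k \<in> src ` I. t \<le> y k} / card (src ` I) - Q t\<bar> \<le> \<delta>"
      "\<And>t. \<bar>card {k \<in> src ` I. y k \<le> t} / card (src ` I) - Phi t\<bar> \<le> \<delta>"
  shows "\<bar>card {i \<in> I. u \<le> \<bar>x i\<bar>} / card I - (Q ((u - \<mu>) / s) + Q ((u + \<mu>) / s))\<bar> \<le> 2 * \<delta>"
proof -
  let ?a = "(u - \<mu>) / s" and ?b = "- ((u + \<mu>) / s)"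
  have iff: "u \<le> \<bar>x i\<bar> \<longleftrightarrow> ?a \<le> y (src i) \<or> y (src i) \<le> ?b" if "i \<in> I" for i
    using s x[OF that] by (simp add: divide_le_eq le_minus_iff[of _ "_ / s"] le_divide_eq abs_le_iff abs_if algebra_simps) (use u in auto)
  have ba: "?b < ?a" using s u by (simp add: minus_divide_left divide_strict_right_mono)
  have "src ` {i \<in> I. u \<le> \<bar>x i\<bar>} = {k \<in> src ` I. ?a \<le> y k} \<union> {k \<in> src ` I. y k \<le> ?b}"
    using iff by auto
  moreover have "card (src ` {i \<in> I. u \<le> \<bar>x i\<bar>}) = card {i \<in> I. u \<le> \<bar>x i\<bar>}"
    by (rule card_image) (use inj in \<open>auto intro: inj_on_subset\<close>)
  moreover have "card ({k \<in> src ` I. ?a \<le> y k} \<union> {k \<in> src ` I. y k \<le> ?b})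
      = card {k \<in> src ` I. ?a \<le> y k} + card {k \<in> src ` I. y k \<le> ?b}"
    using I ba by (intro card_Un_disjoint) auto
  ultimately have "real (card {i \<in> I. u \<le> \<bar>x i\<bar>}) / card I
      = card {k \<in> src ` I. ?a \<le> y k} / card (src ` I) + card {k \<in> src ` I. y k \<le> ?b} / card (src ` I)"
    by (simp add: card_image[OF inj] add_divide_distrib)
  moreover have "Phi ?b = Q ((u + \<mu>) / s)" by (simp add: Phi_eq_Q_uminus)
  ultimately show ?thesis using dev(1)[of ?a] dev(2)[of ?b] by linarith
qed

text \<open>All threshold ranges end below \<open>10\<close>, so this is small compared with every tail that occurs.\<close>

definition noise_tolerance :: real where "noise_tolerance = Q 10 / 1000"

lemma noise_tolerance_pos: "0 < noise_tolerance"
  using Q_pos[of 10] by (simp add: noise_tolerance_def)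

definition noise_typical :: "source set \<Rightarrow> (source \<Rightarrow> real) \<Rightarrow> bool" where
  "noise_typical J y \<longleftrightarrow>
    (\<forall>t. \<bar>card {k \<in> J. t \<le> y k} / card J - Q t\<bar> \<le> noise_tolerance
       \<and> \<bar>card {k \<in> J. y k \<le> t} / card J - Phi t\<bar> \<le> noise_tolerance)"

lemma block_model_FDP_lower:
  assumes N: "1 \<le> N"
    and typical: "noise_typical (Eps ` {..<96 * N}) (\<lambda>k. W k \<omega>)" "noise_typical (Eta ` {..<N}) (\<lambda>k. W k \<omega>)"
      "noise_typical (Xi ` {..<3 * N}) (\<lambda>k. W k \<omega>)"
    and ok: "cell_ok c" "u_hi c \<le> 1000" and z: "W Common \<omega> \<in> cell_set c"
  shows "48/10000 * cell_bound c (W Common \<omega>) - 1/100000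
    \<le> bh_FDP (1/100) (100 * N) {..<96 * N} (\<lambda>i. p_value (block_X N W i \<omega>))"
proof -
  define z where "z = W Common \<omega>"
  define x where "x i = block_X N W i \<omega>" for i
  define \<delta> where "\<delta> = noise_tolerance"
  have \<delta>: "0 < \<delta>" "\<delta> = Q 10 / 1000" using noise_tolerance_pos by (simp_all add: \<delta>_def noise_tolerance_def)
  note cb = cell_ok_basic[OF ok(1)]
  have "thr_hi c \<le> 10" using ok(2) by (simp add: thr_hi_def)
  hence Q10: "Q 10 \<le> Q u" if "u \<le> thr_hi c" for u using that by (intro Q_antimono) simp
  define n0 where "n0 u = real (card {i \<in> {..<96 * N}. u \<le> \<bar>x i\<bar>})" for u
  define n1 where "n1 u = real (card {i \<in> {96 * N..<97 * N}. u \<le> \<bar>x i\<bar>})" for u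
  define n2 where "n2 u = real (card {i \<in> {97 * N..<100 * N}. u \<le> \<bar>x i\<bar>})" for u
  have b0: "\<bar>n0 u / (96 * N) - null_rate z u\<bar> \<le> 2 * \<delta>" if "0 < u" for u
  proof -
    have "\<bar>card {i \<in> {..<96 * N}. u \<le> \<bar>x i\<bar>} / card {..<96 * N}
        - (Q ((u - (3/10 * z)) / sd1) + Q ((u + (3/10 * z)) / sd1))\<bar> \<le> 2 * \<delta>"
    proof (rule two_sided_block_rate[where src = "Eps" and y = "\<lambda>k. W k \<omega>"])
      show "x i = 3/10 * z + sd1 * W ((Eps) i) \<omega>" if "i \<in> {..<96 * N}" for i
        using that by (simp add: x_def z_def block_X_def sd1_def)
    qed (use N that typical(1) sd_bounds in \<open>simp_all add: lessThan_empty_iff noise_typical_def \<delta>_def inj_on_def\<close>)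
    thus ?thesis by (simp add: n0_def null_rate_def)
  qed
  have im1: "(\<lambda>i. Eta (i - 96 * N)) ` {96 * N..<97 * N} = Eta ` {..<N}"
  proof (intro equalityI subsetI)
    fix k assume "k \<in> Eta ` {..<N}"
    then obtain j where "k = Eta j" "j < N" by auto
    thus "k \<in> (\<lambda>i. Eta (i - 96 * N)) ` {96 * N..<97 * N}" by (intro image_eqI[of _ _ "j + 96 * N"]) auto
  qed auto
  have im2: "(\<lambda>i. Xi (i - 97 * N)) ` {97 * N..<100 * N} = Xi ` {..<3 * N}"
  proof (intro equalityI subsetI)
    fix k assume "k \<in> Xi ` {..<3 * N}"
    then obtain j where "k = Xi j" "j < 3 * N" by auto
    thus "k \<in> (\<lambda>i. Xi (i - 97 * N)) ` {97 * N..<100 * N}" by (intro image_eqI[of _ _ "j + 97 * N"]) auto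
  qed auto
  have inj: "inj_on (\<lambda>i. Eta (i - 96 * N)) {96 * N..<97 * N}" "inj_on (\<lambda>i. Xi (i - 97 * N)) {97 * N..<100 * N}"
    by (auto simp: inj_on_def)
  have b1: "\<bar>n1 u / N - alt1_rate z u\<bar> \<le> 2 * \<delta>" if "0 < u" for u
  proof -
    have "\<bar>card {i \<in> {96 * N..<97 * N}. u \<le> \<bar>x i\<bar>} / card {96 * N..<97 * N}
        - (Q ((u - (12/5 - 3/10 * z)) / sd1) + Q ((u + (12/5 - 3/10 * z)) / sd1))\<bar> \<le> 2 * \<delta>"
    proof (rule two_sided_block_rate[where src = "\<lambda>i. Eta (i - 96 * N)" and y = "\<lambda>k. W k \<omega>"])
      show "x i = 12/5 - 3/10 * z + sd1 * W ((\<lambda>i. Eta (i - 96 * N)) i) \<omega>" if "i \<in> {96 * N..<97 * N}" for i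
        using that by (simp add: x_def z_def block_X_def sd1_def)
    qed (use N that typical(2) sd_bounds inj in \<open>simp_all add: im1 noise_typical_def \<delta>_def\<close>)
    thus ?thesis by (simp add: n1_def alt1_rate_def)
  qed
  have b2: "\<bar>n2 u / (3 * N) - alt2_rate z u\<bar> \<le> 2 * \<delta>" if "0 < u" for u
  proof -
    have "\<bar>card {i \<in> {97 * N..<100 * N}. u \<le> \<bar>x i\<bar>} / card {97 * N..<100 * N}
        - (Q ((u - (22/5 - 18/25 * z)) / sd2) + Q ((u + (22/5 - 18/25 * z)) / sd2))\<bar> \<le> 2 * \<delta>"
    proof (rule two_sided_block_rate[where src = "\<lambda>i. Xi (i - 97 * N)" and y = "\<lambda>k. W k \<omega>"])
      show "x i = 22/5 - 18/25 * z + sd2 * W ((\<lambda>i. Xi (i - 97 * N)) i) \<omega>" if "i \<in> {97 * N..<100 * N}" for i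
        using that by (simp add: x_def z_def block_X_def sd2_def)
    qed (use N that typical(3) sd_bounds inj in \<open>simp_all add: im2 noise_typical_def \<delta>_def\<close>)
    thus ?thesis by (simp add: n2_def alt2_rate_def)
  qed
  have all: "real (card {i. i < 100 * N \<and> u \<le> \<bar>x i\<bar>}) = n0 u + n1 u + n2 u" for u
  proof -
    have "card {i. i < 100 * N \<and> u \<le> \<bar>x i\<bar>} = card ({i \<in> {..<96 * N}. u \<le> \<bar>x i\<bar>}
      \<union> ({i \<in> {96 * N..<97 * N}. u \<le> \<bar>x i\<bar>} \<union> {i \<in> {97 * N..<100 * N}. u \<le> \<bar>x i\<bar>}))"
      by (rule arg_cong[where f = card]) auto
    also have "\<dots> = card {i \<in> {..<96 * N}. u \<le> \<bar>x i\<bar>} + (card {i \<in> {96 * N..<97 * N}. u \<le> \<bar>x i\<bar>}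
       + card {i \<in> {97 * N..<100 * N}. u \<le> \<bar>x i\<bar>})"
      by (subst card_Un_disjoint; (subst card_Un_disjoint)?) auto
    finally show ?thesis unfolding n0_def n1_def n2_def by (simp only: of_nat_add add.assoc)
  qed
  have "48/10000 * cell_bound c z - 1/100 * (2 * \<delta>) / (2 * Q (thr_hi c))
    \<le> bh_FDP (1/100) (100 * N) {..<96 * N} (\<lambda>i. p_value (x i))"
  proof (rule bh_FDP_lower_bound[where G = "reject_rate z" and ?G0.0 = "\<lambda>u. 96/100 * null_rate z u" and uA = "thr_lo c"])
    fix u :: real assume u: "0 < u"
    have "(n0 u + n1 u + n2 u) / real (100 * N) = 96/100 * (n0 u / (96 * N)) + 1/100 * (n1 u / N) + 3/100 * (n2 u / (3 * N))"
      using N by (simp add: field_simps)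
    thus "\<bar>card {i. i < 100 * N \<and> u \<le> \<bar>x i\<bar>} / real (100 * N) - reject_rate z u\<bar> \<le> 2 * \<delta>"
      using b0[OF u] b1[OF u] b2[OF u] unfolding all reject_rate_def abs_le_iff by linarith
    have "n0 u / real (100 * N) = 96/100 * (n0 u / (96 * N))" using N by (simp add: field_simps)
    thus "\<bar>card {i \<in> {..<96 * N}. u \<le> \<bar>x i\<bar>} / real (100 * N) - 96/100 * null_rate z u\<bar> \<le> 2 * \<delta>"
      using b0[OF u] \<delta> unfolding n0_def[symmetric] abs_le_iff by linarith
  next
    show "2 * Q (thr_hi c) + 1/100 * (2 * \<delta>) \<le> 1/100 * reject_rate z (thr_hi c)"
      using reject_rate_lower[OF ok(1) z] Q10[of "thr_hi c"] \<delta> unfolding z_def by linarith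
  next
    fix u assume u: "0 < u" "u \<le> thr_lo c"
    have "Q 10 \<le> Q u" using Q10[of u] u cb by simp
    thus "1/100 * reject_rate z u + 1/100 * (2 * \<delta>) < 2 * Q u"
      using reject_rate_upper[OF ok(1) z, of u] u Q_pos[of 10] \<delta> unfolding z_def by linarith
  next
    fix u assume u: "thr_lo c \<le> u" "0 < u" "u \<le> thr_hi c"
    show "2 * Q u * (48/10000 * cell_bound c z) \<le> 1/100 * (96/100 * null_rate z u)"
      using null_rate_ge_cell_bound[OF ok(1) z u(1,3)] unfolding z_def by linarith
  qed (use N \<delta> cb in auto)
  moreover have "1/100 * (2 * \<delta>) / (2 * Q (thr_hi c)) \<le> 1/100000"
    using Q10[of "thr_hi c"] \<delta> Q_pos[of "thr_hi c"] by (simp add: divide_le_eq)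
  ultimately show ?thesis unfolding z_def x_def by linarith
qed

text \<open>The false discovery proportion is built from maxima and cardinalities of random sets. It is measurable
  because it depends only on the finitely many truth values of \<open>P\<^sub>i \<le> t\<^sub>r\<close>.\<close>

lemma borel_measurable_if_determined_by_finitely_many_events:
  fixes f :: "'w \<Rightarrow> real"
  assumes A: "finite A" and P: "\<And>a. a \<in> A \<Longrightarrow> {\<omega> \<in> space M. P a \<omega>} \<in> sets M"
    and f: "\<And>\<omega> \<omega>'. \<omega> \<in> space M \<Longrightarrow> \<omega>' \<in> space M \<Longrightarrow> (\<And>a. a \<in> A \<Longrightarrow> P a \<omega> = P a \<omega>') \<Longrightarrow> f \<omega> = f \<omega>'"
  shows "f \<in> borel_measurable M"
proof -
  define h where "h \<omega> = {a \<in> A. P a \<omega>}" for \<omega>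
  define g where "g T = f (SOME \<omega>. \<omega> \<in> space M \<and> h \<omega> = T)" for T
  have h: "h \<in> measurable M (count_space (Pow A))"
  proof (subst measurable_count_space_eq2)
    show "finite (Pow A)" using A by simp
    have "h -` {T} \<inter> space M \<in> sets M" if T: "T \<subseteq> A" for T
    proof -
      have "h -` {T} \<inter> space M
          = {\<omega> \<in> space M. \<forall>a\<in>A. if a \<in> T then P a \<omega> else \<not> P a \<omega>}"
      proof (intro equalityI subsetI)
        fix \<omega> assume "\<omega> \<in> h -` {T} \<inter> space M"
        thus "\<omega> \<in> {\<omega> \<in> space M. \<forall>a\<in>A. if a \<in> T then P a \<omega> else \<not> P a \<omega>}"
          by (auto simp: h_def)
      next
        fix \<omega> assume "\<omega> \<in> {\<omega> \<in> space M. \<forall>a\<in>A. if a \<in> T then P a \<omega> else \<not> P a \<omega>}"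
        hence "\<omega> \<in> space M" "\<And>a. a \<in> A \<Longrightarrow> P a \<omega> \<longleftrightarrow> a \<in> T" by (auto split: if_splits)
        thus "\<omega> \<in> h -` {T} \<inter> space M" using T by (auto simp: h_def)
      qed
      also have "\<dots> \<in> sets M"
      proof (rule sets.sets_Collect_finite_All[OF _ A])
        fix a assume a: "a \<in> A"
        show "{\<omega> \<in> space M. if a \<in> T then P a \<omega> else \<not> P a \<omega>} \<in> sets M"
          using P[OF a] sets.sets_Collect_neg[OF P[OF a]] by (cases "a \<in> T") simp_all
      qed
      finally show ?thesis .
    qed
    thus "h \<in> space M \<rightarrow> Pow A \<and> (\<forall>T\<in>Pow A. h -` {T} \<inter> space M \<in> sets M)"
      by (auto simp: h_def)
  qed
  have "f \<omega> = g (h \<omega>)" if \<omega>: "\<omega> \<in> space M" for \<omega>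
  proof -
    have "\<exists>\<omega>'. \<omega>' \<in> space M \<and> h \<omega>' = h \<omega>" using \<omega> by blast
    from someI_ex[OF this] show ?thesis
      unfolding g_def by (intro f[OF \<omega>]) (auto simp: h_def)
  qed
  moreover have "(\<lambda>\<omega>. g (h \<omega>)) \<in> borel_measurable M"
    by (rule measurable_compose[OF h]) simp
  ultimately show ?thesis by (subst measurable_cong) auto
qed

lemma bh_FDP_cong:
  assumes "\<And>i r. i < m \<Longrightarrow> r \<in> {1..m} \<Longrightarrow> p i \<le> bh_critical \<alpha> m r \<longleftrightarrow> p' i \<le> bh_critical \<alpha> m r"
  shows "bh_FDP \<alpha> m I p = bh_FDP \<alpha> m I p'"
proof -
  have eq: "{i. i < m \<and> p i \<le> bh_critical \<alpha> m r} = {i. i < m \<and> p' i \<le> bh_critical \<alpha> m r}"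
    if "r \<in> {1..m}" for r using assms that by blast
  have "{r \<in> {1..m}. card {i. i < m \<and> p i \<le> bh_critical \<alpha> m r} \<ge> r}
      = {r \<in> {1..m}. card {i. i < m \<and> p' i \<le> bh_critical \<alpha> m r} \<ge> r}"
    using eq by auto
  hence R: "bh_R \<alpha> m p = bh_R \<alpha> m p'" unfolding bh_R_def by simp
  have "bh_rejected \<alpha> m p = bh_rejected \<alpha> m p'"
  proof (cases "bh_R \<alpha> m p' = 0")
    case False
    hence "bh_R \<alpha> m p' \<in> {1..m}" using bh_R_le[of \<alpha> m p'] by simp
    from eq[OF this] show ?thesis unfolding bh_rejected_def R by simp
  qed (simp add: bh_rejected_def R)
  thus ?thesis unfolding bh_FDP_def bh_V_def R by simp
qed

lemma borel_measurable_Q [measurable]: "Q \<in> borel_measurable borel"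
  by (intro borel_measurable_continuous_onI continuous_on_Q continuous_on_id)

lemma borel_measurable_bh_FDP:
  assumes X: "\<And>i. i < m \<Longrightarrow> X i \<in> borel_measurable M"
  shows "(\<lambda>\<omega>. bh_FDP \<alpha> m I (\<lambda>i. p_value (X i \<omega>))) \<in> borel_measurable M"
proof (rule borel_measurable_if_determined_by_finitely_many_events
    [where A = "{..<m} \<times> {1..m}" and P = "\<lambda>(i, r) \<omega>. p_value (X i \<omega>) \<le> bh_critical \<alpha> m r"])
  fix a assume "a \<in> {..<m} \<times> {1..m}"
  then obtain i r where a: "a = (i, r)" "i < m" by auto
  note [measurable] = X[OF a(2)]
  show "{\<omega> \<in> space M. (\<lambda>(i, r) \<omega>. p_value (X i \<omega>) \<le> bh_critical \<alpha> m r) a \<omega>} \<in> sets M"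
    unfolding a prod.case p_value_eq by measurable
next
  fix \<omega> \<omega>'
  assume "\<And>a. a \<in> {..<m} \<times> {1..m} \<Longrightarrow> (\<lambda>(i, r) \<omega>. p_value (X i \<omega>) \<le> bh_critical \<alpha> m r) a \<omega>
      = (\<lambda>(i, r) \<omega>. p_value (X i \<omega>) \<le> bh_critical \<alpha> m r) a \<omega>'"
  from this[of "(_, _)"]
  show "bh_FDP \<alpha> m I (\<lambda>i. p_value (X i \<omega>)) = bh_FDP \<alpha> m I (\<lambda>i. p_value (X i \<omega>'))"
    by (intro bh_FDP_cong) simp
qed simp

section \<open>Integrating over the common factor\<close>

definition disjoint_cells :: "cell \<Rightarrow> cell \<Rightarrow> bool" where
  "disjoint_cells c d \<longleftrightarrow> mirrored c \<noteq> mirrored d \<or> z_hi c \<le> z_lo d \<or> z_hi d \<le> z_lo c"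

definition total_bound :: "cell list \<Rightarrow> real \<Rightarrow> real" where
  "total_bound cs z = (\<Sum>c\<leftarrow>cs. indicator (cell_set c) z * cell_bound c z)"

lemma cell_sets_disjoint:
  assumes "cell_ok c" "cell_ok d" "disjoint_cells c d"
  shows "cell_set c \<inter> cell_set d = {}"
proof (rule ccontr)
  assume "cell_set c \<inter> cell_set d \<noteq> {}"
  then obtain z where z: "z \<in> cell_set c" "z \<in> cell_set d" by auto
  note b = cell_ok_basic[OF assms(1)] cell_ok_basic[OF assms(2)]
  from assms(3) consider "mirrored c \<noteq> mirrored d" | "v_hi c \<le> v_lo d" "mirrored c = mirrored d"
    | "v_hi d \<le> v_lo c" "mirrored c = mirrored d"
    unfolding disjoint_cells_def v_lo_def v_hi_def by fastforce
  thus False using z b by cases (auto simp: cell_set_def side_def split: if_splits)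
qed

lemma total_bound_cases:
  assumes "\<And>c. c \<in> set cs \<Longrightarrow> cell_ok c" "sorted_wrt disjoint_cells cs"
  shows "total_bound cs z = 0 \<or> (\<exists>c\<in>set cs. z \<in> cell_set c \<and> total_bound cs z = cell_bound c z)"
  using assms
proof (induction cs)
  case (Cons c cs)
  show ?case
  proof (cases "z \<in> cell_set c")
    case True
    have "z \<notin> cell_set d" if "d \<in> set cs" for d
      using cell_sets_disjoint[of c d] Cons.prems that True by auto
    hence "total_bound cs z = 0" unfolding total_bound_def by (induction cs) auto
    thus ?thesis using True by (auto simp: total_bound_def)
  next
    case False
    hence "total_bound (c # cs) z = total_bound cs z" by (simp add: total_bound_def)
    thus ?thesis using Cons by auto
  qed
qed (simp add: total_bound_def)

lemma cell_bound_bounds: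
  assumes "cell_ok c" "u_hi c \<le> 1000"
  shows "0 \<le> cell_bound c z" "cell_bound c z \<le> 2 / Q 10"
proof -
  have "thr_ref c \<le> 10" "thr_hi c \<le> 10"
    using assms cell_ok_basic(5)[OF assms(1)] by (auto simp: thr_ref_def thr_hi_def)
  hence Q: "Q 10 \<le> Q (thr_ref c)" "Q 10 \<le> Q (thr_hi c)" by (auto intro: Q_antimono)
  have "Q a / Q b \<le> 1 / Q 10" if "Q 10 \<le> Q b" for a b
    using that Q_lt_1[of a] Q_pos[of a] Q_pos[of 10] by (intro frac_le) auto
  from this[OF Q(1)] this[OF Q(2)] show "cell_bound c z \<le> 2 / Q 10"
    unfolding cell_bound_def by (smt (verit) add_divide_distrib)
  show "0 \<le> cell_bound c z" unfolding cell_bound_def using Q_pos by (simp add: less_imp_le)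
qed

lemma borel_measurable_cell_term [measurable]:
  "(\<lambda>z. indicator (cell_set c) z * cell_bound c z) \<in> borel_measurable borel"
  unfolding cell_bound_def cell_set_def by measurable

text \<open>The weight of a cell is a lower bound for the mean of its bound, because the midpoint estimate refers
  to the integral against the density of the common factor.\<close>

lemma (in prob_space) cell_expectation:
  assumes Z: "distributed M lborel Z std_normal_density" and ok: "cell_ok c" "u_hi c \<le> 1000"
  shows "integrable M (\<lambda>\<omega>. indicator (cell_set c) (Z \<omega>) * cell_bound c (Z \<omega>))"
    "of_int (weight c) / 100000 \<le> expectation (\<lambda>\<omega>. indicator (cell_set c) (Z \<omega>) * cell_bound c (Z \<omega>))"
proof -
  have [measurable]: "Z \<in> borel_measurable M" using distributed_measurable[OF Z] by simp
  show "integrable M (\<lambda>\<omega>. indicator (cell_set c) (Z \<omega>) * cell_bound c (Z \<omega>))"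
  proof (rule integrable_const_bound[where B = "2 / Q 10"])
    show "AE \<omega> in M. norm (indicator (cell_set c) (Z \<omega>) * cell_bound c (Z \<omega>)) \<le> 2 / Q 10"
      using cell_bound_bounds[OF ok] Q_pos[of 10] by (auto simp: indicator_def)
    show "(\<lambda>\<omega>. indicator (cell_set c) (Z \<omega>) * cell_bound c (Z \<omega>)) \<in> borel_measurable M"
      by (rule measurable_compose[OF _ borel_measurable_cell_term]) measurable
  qed
  define l r where "l = (if mirrored c then - v_hi c else v_lo c)"
    and "r = (if mirrored c then - v_lo c else v_hi c)"
  have cs: "cell_set c = {l<..<r}" by (auto simp: cell_set_def side_def l_def r_def)
  have cont: "continuous_on S (\<lambda>z. std_normal_density z * cell_bound c z)" for S
    by (rule continuous_on_cell_bound[OF ok(1)])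
  have "of_int (weight c) / 100000 \<le> integral {l..r} (\<lambda>z. std_normal_density z * cell_bound c z)"
    unfolding l_def r_def by (rule cell_bound_integral[OF ok(1)])
  also have "\<dots> = integral {l<..<r} (\<lambda>z. std_normal_density z * cell_bound c z)"
    using integral_open_interval[of l r "\<lambda>z. std_normal_density z * cell_bound c z"]
    unfolding box_real by (rule sym)
  also have "\<dots> = set_lebesgue_integral lborel {l<..<r} (\<lambda>z. std_normal_density z * cell_bound c z)"
  proof (rule set_borel_integral_eq_integral(2)[symmetric])
    have "set_integrable lborel {l..r} (\<lambda>z. std_normal_density z * cell_bound c z)"
      by (rule borel_integrable_atLeastAtMost') (rule cont)
    thus "set_integrable lborel {l<..<r} (\<lambda>z. std_normal_density z * cell_bound c z)"
      by (rule set_integrable_subset) auto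
  qed
  also have "\<dots> = (\<integral>z. std_normal_density z * (indicator (cell_set c) z * cell_bound c z) \<partial>lborel)"
    unfolding set_lebesgue_integral_def cs by (simp add: mult.left_commute)
  also have "\<dots> = expectation (\<lambda>\<omega>. indicator (cell_set c) (Z \<omega>) * cell_bound c (Z \<omega>))"
    by (rule distributed_integral[OF Z]) auto
  finally show "of_int (weight c) / 100000
    \<le> expectation (\<lambda>\<omega>. indicator (cell_set c) (Z \<omega>) * cell_bound c (Z \<omega>))" .
qed

lemma (in prob_space) total_bound_expectation:
  assumes Z: "distributed M lborel Z std_normal_density"
    and ok: "\<And>c. c \<in> set cs \<Longrightarrow> cell_ok c \<and> u_hi c \<le> 1000"
  shows "integrable M (\<lambda>\<omega>. total_bound cs (Z \<omega>))"
    "of_int (\<Sum>c\<leftarrow>cs. weight c) / 100000 \<le> expectation (\<lambda>\<omega>. total_bound cs (Z \<omega>))"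
proof -
  have "integrable M (\<lambda>\<omega>. total_bound cs (Z \<omega>)) \<and>
    of_int (\<Sum>c\<leftarrow>cs. weight c) / 100000 \<le> expectation (\<lambda>\<omega>. total_bound cs (Z \<omega>))"
    using ok
  proof (induction cs)
    case (Cons c cs)
    hence c: "cell_ok c" "u_hi c \<le> 1000" by auto
    note IH = Cons.IH[OF Cons.prems[OF list.set_intros(2)]]
    have eq: "total_bound (c # cs) (Z \<omega>)
        = indicator (cell_set c) (Z \<omega>) * cell_bound c (Z \<omega>) + total_bound cs (Z \<omega>)" for \<omega>
      by (simp add: total_bound_def)
    have "expectation (\<lambda>\<omega>. total_bound (c # cs) (Z \<omega>))
        = expectation (\<lambda>\<omega>. indicator (cell_set c) (Z \<omega>) * cell_bound c (Z \<omega>))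
          + expectation (\<lambda>\<omega>. total_bound cs (Z \<omega>))"
      unfolding eq using cell_expectation(1)[OF Z c] IH by (intro Bochner_Integration.integral_add) auto
    thus ?case
      unfolding eq using cell_expectation[OF Z c] IH by (auto simp: add_divide_distrib)
  qed (simp add: total_bound_def)
  thus "integrable M (\<lambda>\<omega>. total_bound cs (Z \<omega>))"
    "of_int (\<Sum>c\<leftarrow>cs. weight c) / 100000 \<le> expectation (\<lambda>\<omega>. total_bound cs (Z \<omega>))" by auto
qed

lemma total_bound_bounds:
  assumes "\<And>c. c \<in> set cs \<Longrightarrow> cell_ok c \<and> u_hi c \<le> 1000" "sorted_wrt disjoint_cells cs"
  shows "total_bound cs z \<le> 2 / Q 10"
  using total_bound_cases[of cs z] assms cell_bound_bounds Q_pos[of 10] by fastforce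

definition noise_grid :: nat where "noise_grid = nat \<lceil>2 / noise_tolerance\<rceil>"

text \<open>Outside an exceptional set the pointwise bound for the false discovery proportion holds on every
  cell. On the exceptional set the bound may fail, by at most \<open>2 / Q 10\<close>; this is paid for by its
  exponentially small probability, which is estimated for the three families of noise separately.\<close>

lemma (in prob_space) block_model_FDR_lower:
  fixes W :: "source \<Rightarrow> 'a \<Rightarrow> real"
  assumes N: "1 \<le> N" and W: "iid_std_normal M W"
    and ok: "\<And>c. c \<in> set cs \<Longrightarrow> cell_ok c \<and> u_hi c \<le> 1000" and dj: "sorted_wrt disjoint_cells cs"
  shows "48/10000 * (of_int (\<Sum>c\<leftarrow>cs. weight c) / 100000) - 1/100000
      - 2 / Q 10 * (6 * real noise_grid * exp (- (noise_tolerance\<^sup>2 / 2) * real N))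
    \<le> bh_FDR M (1/100) (100 * N) {..<96 * N} (block_X N W)"
proof -
  have ind: "indep_vars (\<lambda>_. borel) W UNIV" and dist: "distributed M lborel (W k) std_normal_density" for k
    using W by (auto simp: iid_std_normal_def)
  have Wm [measurable]: "W k \<in> borel_measurable M" for k using distributed_measurable[OF dist[of k]] by simp
  define e where "e = 2 * real noise_grid * exp (- (noise_tolerance\<^sup>2 / 2) * real N)"
  have typical: "\<exists>B\<in>events. prob B \<le> e \<and> (\<forall>\<omega>\<in>space M - B. noise_typical J (\<lambda>k. W k \<omega>))"
    if J: "finite J" "N \<le> card J" for J
  proof -
    have J': "J \<noteq> {}" using J N by auto
    have "2 / noise_tolerance \<le> real noise_grid" unfolding noise_grid_def by linarith
    from uniform_empirical_deviation[OF J(1) J' indep_vars_subset[OF ind] dist noise_tolerance_pos this]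
    obtain B where B: "B \<in> events" "prob B \<le> 2 * real noise_grid * exp (- (noise_tolerance\<^sup>2 / 2) * card J)"
      "\<forall>\<omega>\<in>space M - B. noise_typical J (\<lambda>k. W k \<omega>)"
      unfolding noise_typical_def by auto
    have "- (noise_tolerance\<^sup>2 / 2) * card J \<le> - (noise_tolerance\<^sup>2 / 2) * real N"
      using J(2) by (simp add: mult_left_mono)
    hence "2 * real noise_grid * exp (- (noise_tolerance\<^sup>2 / 2) * card J) \<le> e"
      unfolding e_def by (intro mult_left_mono) auto
    with B show ?thesis by (intro bexI[of _ B]) auto
  qed
  have card: "card (Eps ` {..<96 * N}) = 96 * N" "card (Eta ` {..<N}) = N" "card (Xi ` {..<3 * N}) = 3 * N"
    by (simp_all add: card_image inj_on_def)
  obtain B0 B1 B2 where B: "B0 \<in> events" "B1 \<in> events" "B2 \<in> events" "prob B0 \<le> e" "prob B1 \<le> e" "prob B2 \<le> e"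
    "\<forall>\<omega>\<in>space M - B0. noise_typical (Eps ` {..<96 * N}) (\<lambda>k. W k \<omega>)"
    "\<forall>\<omega>\<in>space M - B1. noise_typical (Eta ` {..<N}) (\<lambda>k. W k \<omega>)"
    "\<forall>\<omega>\<in>space M - B2. noise_typical (Xi ` {..<3 * N}) (\<lambda>k. W k \<omega>)"
    using typical[of "Eps ` {..<96 * N}"] typical[of "Eta ` {..<N}"] typical[of "Xi ` {..<3 * N}"] card by auto
  define B where "B = B0 \<union> B1 \<union> B2"
  have Be [measurable]: "B \<in> events" using B by (auto simp: B_def)
  have "prob B \<le> prob B0 + prob B1 + prob B2"
    unfolding B_def using measure_Un_le[of "B0 \<union> B1" M B2] measure_Un_le[of B0 M B1] B by simp
  hence pB: "prob B \<le> 3 * e" using B by linarith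
  define F where "F \<omega> = bh_FDP (1/100) (100 * N) {..<96 * N} (\<lambda>i. p_value (block_X N W i \<omega>))" for \<omega>
  have Fm: "F \<in> borel_measurable M"
    unfolding F_def by (rule borel_measurable_bh_FDP) (simp add: block_X_def[abs_def])
  have F01: "0 \<le> F \<omega>" "F \<omega> \<le> 1" for \<omega> unfolding F_def by (simp_all add: bh_FDP_nonneg bh_FDP_le_1)
  have Fi: "integrable M F"
    by (rule integrable_const_bound[where B = 1]) (use F01 Fm in auto)
  have point: "48/10000 * total_bound cs (W Common \<omega>) - 1/100000 - 2 / Q 10 * indicator B \<omega> \<le> F \<omega>"
    if \<omega>: "\<omega> \<in> space M" for \<omega>
  proof (cases "\<omega> \<in> B")
    case True
    have "total_bound cs (W Common \<omega>) \<le> 2 / Q 10" using total_bound_bounds[OF ok dj] .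
    moreover have "0 \<le> 2 / Q 10" using Q_pos[of 10] by simp
    moreover have "indicator B \<omega> = (1 :: real)" using True by simp
    ultimately show ?thesis using F01(1)[of \<omega>] by (simp only: mult_1_right)
  next
    case False
    have t: "noise_typical (Eps ` {..<96 * N}) (\<lambda>k. W k \<omega>)" "noise_typical (Eta ` {..<N}) (\<lambda>k. W k \<omega>)"
      "noise_typical (Xi ` {..<3 * N}) (\<lambda>k. W k \<omega>)" using B False \<omega> by (auto simp: B_def)
    consider "total_bound cs (W Common \<omega>) = 0" | c where "c \<in> set cs" "W Common \<omega> \<in> cell_set c"
      "total_bound cs (W Common \<omega>) = cell_bound c (W Common \<omega>)"
      using total_bound_cases[of cs "W Common \<omega>"] ok dj by auto
    thus ?thesis
    proof cases
      case 1
      thus ?thesis using False F01(1)[of \<omega>] by simp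
    next
      case 2
      thus ?thesis using block_model_FDP_lower[where N = N and W = W and \<omega> = \<omega> and c = c, OF N t] ok False
        by (simp add: F_def)
    qed
  qed
  have T: "integrable M (\<lambda>\<omega>. total_bound cs (W Common \<omega>))"
    "of_int (\<Sum>c\<leftarrow>cs. weight c) / 100000 \<le> expectation (\<lambda>\<omega>. total_bound cs (W Common \<omega>))"
    using total_bound_expectation[OF dist[of Common], of cs] ok by blast+
  have iT: "integrable M (\<lambda>\<omega>. 48/10000 * total_bound cs (W Common \<omega>) - 1/100000)"
    using T(1) by simp
  have iB: "integrable M (\<lambda>\<omega>. 2 / Q 10 * indicator B \<omega>)"
    by (intro integrable_mult_right integrable_real_indicator Be) (simp add: emeasure_eq_measure)
  have "48/10000 * (of_int (\<Sum>c\<leftarrow>cs. weight c) / 100000) - 1/100000 - 2 / Q 10 * (3 * e)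
      \<le> 48/10000 * expectation (\<lambda>\<omega>. total_bound cs (W Common \<omega>)) - 1/100000 - 2 / Q 10 * prob B"
    using T(2) pB Q_pos[of 10] by (intro diff_mono mult_left_mono) auto
  also have "\<dots> = expectation (\<lambda>\<omega>. 48/10000 * total_bound cs (W Common \<omega>) - 1/100000 - 2 / Q 10 * indicator B \<omega>)"
    unfolding Bochner_Integration.integral_diff[OF iT iB] using T(1) by (simp add: prob_space)
  also have "\<dots> \<le> expectation F"
    by (intro integral_mono Fi point Bochner_Integration.integrable_diff iT iB) auto
  finally show ?thesis
    unfolding bh_FDR_def F_def e_def by (simp add: mult.assoc)
qed

lemma block_model_FDR_eventually:
  assumes ok: "\<And>c. c \<in> set cs \<Longrightarrow> cell_ok c \<and> u_hi c \<le> 1000" and dj: "sorted_wrt disjoint_cells cs"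
    and r: "r < 48/10000 * (of_int (\<Sum>c\<leftarrow>cs. weight c) / 100000) - 1/100000"
  shows "\<forall>\<^sub>F N in sequentially. \<forall>(M :: 'w measure) W. prob_space M \<longrightarrow> iid_std_normal M W \<longrightarrow>
    r < bh_FDR M (1/100) (100 * N) {..<96 * N} (block_X N W)"
proof -
  let ?a = "48/10000 * (of_int (\<Sum>c\<leftarrow>cs. weight c) / 100000) - 1/100000 :: real"
  have "((\<lambda>N. ?a - 2 / Q 10 * (6 * real noise_grid * exp (- (noise_tolerance\<^sup>2 / 2) * real N))) \<longlongrightarrow>
      ?a - 2 / Q 10 * (6 * real noise_grid * 0)) sequentially"
  proof (intro tendsto_intros)
    have "0 < noise_tolerance\<^sup>2 / 2" using noise_tolerance_pos by simp
    thus "((\<lambda>N. exp (- (noise_tolerance\<^sup>2 / 2) * real N)) \<longlongrightarrow> 0) sequentially" by real_asymp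
  qed
  hence "\<forall>\<^sub>F N in sequentially. r < ?a - 2 / Q 10 * (6 * real noise_grid * exp (- (noise_tolerance\<^sup>2 / 2) * real N))"
    using r by (intro order_tendstoD(1)) auto
  thus ?thesis using eventually_ge_at_top[of 1]
  proof eventually_elim
    case (elim N)
    show ?case
      using prob_space.block_model_FDR_lower[OF _ elim(2) _ ok dj] elim(1) by (meson less_le_trans)
  qed
qed

section \<open>The certificate\<close>

text \<open>The threshold ranges and weights were found numerically. The cells stop at \<open>\<bar>z\<bar> = 3.1\<close> and \<open>3.4\<close>, and
  leave out \<open>2 < z < 2.2\<close>, where the threshold jumps from about \<open>5\<close> to about \<open>7\<close> because the extreme tail
  of the first block of nonnulls takes over.\<close>

definition cells_left :: "cell list" where
  "cells_left =
    [Cell True 250 310 True 355 358 5446,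
     Cell True 200 250 True 357 361 10591,
     Cell True 140 200 True 358 372 21051,
     Cell True 110 140 True 291 361 12352,
     Cell True 70 110 False 359 397 16717,
     Cell True 40 70 False 355 363 12645,
     Cell True 0 40 False 360 365 15860]"

definition cells_middle :: "cell list" where
  "cells_middle =
    [Cell False 0 40 False 363 370 15586,
     Cell False 40 70 False 368 375 12256,
     Cell False 70 100 False 367 384 12733,
     Cell False 100 115 False 369 408 6383,
     Cell False 115 130 True 299 397 6232,
     Cell False 130 150 True 365 411 8225,
     Cell False 150 170 True 409 433 7973,
     Cell False 170 190 True 429 471 7478,
     Cell False 190 200 True 466 510 3656]"

definition cells_right :: "cell list" where
  "cells_right =
    [Cell False 220 240 True 657 763 7975,
     Cell False 240 260 True 725 802 7977,
     Cell False 260 280 True 766 844 7756,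
     Cell False 280 300 True 793 887 7335,
     Cell False 300 320 True 791 918 6423,
     Cell False 320 340 True 744 886 4666]"

lemma cells_left_ok: "list_all cell_ok cells_left" by code_simp
lemma cells_middle_ok: "list_all cell_ok cells_middle" by code_simp
lemma cells_right_ok: "list_all cell_ok cells_right" by code_simp

section \<open>The three-block vector is multivariate normal\<close>

fun source_index :: "source \<Rightarrow> nat" where
  "source_index Common = 0"
| "source_index (Eps i) = 3 * i + 1"
| "source_index (Eta i) = 3 * i + 2"
| "source_index (Xi i) = 3 * i + 3"

lemma inj_source_index: "inj source_index"
proof (rule injI)
  fix x y assume "source_index x = source_index y"
  thus "x = y" by (cases x; cases y) (auto; presburger)+
qed

text \<open>An infinite product of standard normal laws, with its coordinates renumbered by the sources.\<close>

lemma iid_std_normal_exists: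
  "\<exists>(M :: (nat \<Rightarrow> real) measure) (W :: source \<Rightarrow> (nat \<Rightarrow> real) \<Rightarrow> real).
     prob_space M \<and> iid_std_normal M W"
proof -
  let ?S = "std_normal_distribution"
  have S: "prob_space ?S" by (rule prob_space_normal_density) simp
  define M where "M = (\<Pi>\<^sub>M i\<in>(UNIV :: nat set). ?S)"
  define W where "W k \<omega> = \<omega> (source_index k)" for k and \<omega> :: "nat \<Rightarrow> real"
  interpret M: prob_space M unfolding M_def by (intro prob_space_PiM S)
  have Wm: "W k \<in> borel_measurable M" for k
  proof -
    have "(\<lambda>\<omega>. \<omega> (source_index k)) \<in> measurable M ?S" unfolding M_def by measurable
    thus ?thesis by (simp add: W_def[abs_def])
  qed
  have law: "distr M borel (W k) = ?S" for k
  proof -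
    have "distr M borel (W k) = distr M ?S (\<lambda>\<omega>. \<omega> (source_index k))"
      by (rule distr_cong) (auto simp: W_def)
    also have "\<dots> = ?S" unfolding M_def by (rule distr_PiM_component) (auto intro: S)
    finally show ?thesis .
  qed
  have "distr M (\<Pi>\<^sub>M k\<in>UNIV. borel) (\<lambda>\<omega>. \<lambda>k\<in>UNIV. W k \<omega>)
      = distr M (\<Pi>\<^sub>M k\<in>UNIV. ?S) (\<lambda>\<omega>. \<lambda>k\<in>UNIV. \<omega> (source_index k))"
    by (rule distr_cong) (auto simp: W_def intro!: sets_PiM_cong)
  also have "\<dots> = (\<Pi>\<^sub>M k\<in>UNIV. ?S)"
    unfolding M_def by (rule distr_PiM_reindex) (auto intro: S inj_source_index)
  also have "\<dots> = (\<Pi>\<^sub>M k\<in>UNIV. distr M borel (W k))" unfolding law ..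
  finally have "M.indep_vars (\<lambda>_. borel) W UNIV"
    using Wm by (subst M.indep_vars_iff_distr_eq_PiM) auto
  moreover have "distributed M lborel (W k) std_normal_density" for k
  proof -
    have "distr M lborel (W k) = distr M borel (W k)" by (rule distr_cong) auto
    thus ?thesis unfolding distributed_def law using Wm by auto
  qed
  ultimately show ?thesis using M.prob_space_axioms by (auto simp: iid_std_normal_def)
qed

text \<open>Vanishing coefficients have to be removed first because sums of independent normal variables are
  treated for positive variances; if none are left, the variable is constant.\<close>

lemma (in prob_space) normal_variable_linear_combination:
  assumes W: "iid_std_normal M W" and K: "finite K"
  shows "normal_variable M (\<lambda>\<omega>. c + (\<Sum>k\<in>K. d k * W k \<omega>)) c (\<Sum>k\<in>K. (d k)\<^sup>2)"
proof -
  have ind: "indep_vars (\<lambda>_. borel) W UNIV" and dist: "distributed M lborel (W k) std_normal_density" for k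
    using W by (auto simp: iid_std_normal_def)
  have Wm [measurable]: "W k \<in> borel_measurable M" for k using distributed_measurable[OF dist[of k]] by simp
  define K' where "K' = {k \<in> K. d k \<noteq> 0}"
  have K': "finite K'" "K' \<subseteq> K" using K by (auto simp: K'_def)
  have sum: "(\<Sum>k\<in>K. d k * W k \<omega>) = (\<Sum>k\<in>K'. d k * W k \<omega>)" for \<omega>
    using K K' by (intro sum.mono_neutral_right) (auto simp: K'_def)
  have var: "(\<Sum>k\<in>K. (d k)\<^sup>2) = (\<Sum>k\<in>K'. \<bar>d k\<bar>\<^sup>2)"
    using K K' by (subst sum.mono_neutral_right[of K K']) (auto simp: K'_def)
  have meas: "(\<lambda>\<omega>. c + (\<Sum>k\<in>K. d k * W k \<omega>)) \<in> borel_measurable M" by measurable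
  show ?thesis
  proof (cases "K' = {}")
    case True
    thus ?thesis unfolding normal_variable_def using meas var by (simp add: sum)
  next
    case False
    have "0 < (\<Sum>k\<in>K'. \<bar>d k\<bar>\<^sup>2)" using False K'(1) by (intro sum_pos) (auto simp: K'_def)
    hence v: "0 < (\<Sum>k\<in>K. (d k)\<^sup>2)" by (simp add: var)
    have "distributed M lborel (\<lambda>\<omega>. \<Sum>k\<in>K'. d k * W k \<omega>)
        (normal_density (\<Sum>k\<in>K'. 0) (sqrt (\<Sum>k\<in>K'. \<bar>d k\<bar>\<^sup>2)))"
    proof (rule sum_indep_normal[OF K'(1) False])
      show "indep_vars (\<lambda>_. borel) (\<lambda>k \<omega>. d k * W k \<omega>) K'"
        by (rule indep_vars_compose2[OF indep_vars_subset[OF ind]]) auto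
    next
      fix k assume k: "k \<in> K'"
      thus "0 < \<bar>d k\<bar>" by (simp add: K'_def)
      have "distributed M lborel (\<lambda>\<omega>. 0 + d k * W k \<omega>) (normal_density (0 + d k * 0) (\<bar>d k\<bar> * 1))"
        using k by (intro normal_density_affine dist) (auto simp: K'_def)
      thus "distributed M lborel (\<lambda>\<omega>. d k * W k \<omega>) (normal_density 0 \<bar>d k\<bar>)" by simp
    qed
    hence "distributed M lborel (\<lambda>\<omega>. \<Sum>k\<in>K. d k * W k \<omega>) (normal_density 0 (sqrt (\<Sum>k\<in>K. (d k)\<^sup>2)))"
      unfolding sum var by simp
    from normal_density_affine[OF this, of 1 c] v
    have "distributed M lborel (\<lambda>\<omega>. c + (\<Sum>k\<in>K. d k * W k \<omega>)) (normal_density c (sqrt (\<Sum>k\<in>K. (d k)\<^sup>2)))"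
      by simp
    thus ?thesis unfolding normal_variable_def using v meas by simp
  qed
qed

text \<open>The covariance of \<open>X\<^sub>i = b\<^sub>i * Z + s\<^sub>i * noise\<^sub>i\<close> with independent noises.\<close>

definition factor_covariance :: "(nat \<Rightarrow> real) \<Rightarrow> (nat \<Rightarrow> real) \<Rightarrow> nat \<Rightarrow> nat \<Rightarrow> real" where
  "factor_covariance b s i j = b i * b j + (if i = j then (s i)\<^sup>2 else 0)"

lemma factor_covariance_form:
  "(\<Sum>i<m. \<Sum>j<m. a i * factor_covariance b s i j * a j) = (\<Sum>i<m. a i * b i)\<^sup>2 + (\<Sum>i<m. (a i * s i)\<^sup>2)"
proof -
  have "(\<Sum>j<m. a i * factor_covariance b s i j * a j) = a i * b i * (\<Sum>j<m. a j * b j) + (a i * s i)\<^sup>2"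
    if "i < m" for i
  proof -
    have "(\<Sum>j<m. a i * factor_covariance b s i j * a j)
        = (\<Sum>j<m. a i * b i * (a j * b j) + (if j = i then (a i * s i)\<^sup>2 else 0))"
      by (intro sum.cong) (auto simp: factor_covariance_def algebra_simps power2_eq_square)
    thus ?thesis using that by (simp add: sum.distrib sum_distrib_left)
  qed
  thus ?thesis by (simp add: sum.distrib power2_eq_square sum_distrib_right)
qed

lemma correlation_matrix_factor_covariance:
  assumes "\<And>i. i < m \<Longrightarrow> (b i)\<^sup>2 + (s i)\<^sup>2 = 1"
  shows "correlation_matrix m (factor_covariance b s)"
  unfolding correlation_matrix_def factor_covariance_form
  using assms by (auto simp: factor_covariance_def power2_eq_square sum_nonneg)

lemma (in prob_space) multivariate_normal_factor_model:
  assumes W: "iid_std_normal M W" and src: "inj_on src {..<m}" "k0 \<notin> src ` {..<m}"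
    and X: "\<And>i \<omega>. i < m \<Longrightarrow> X i \<omega> = \<mu> i + b i * W k0 \<omega> + s i * W (src i) \<omega>"
  shows "multivariate_normal M m X \<mu> (factor_covariance b s)"
  unfolding multivariate_normal_def
proof (intro conjI allI impI)
  have Wm [measurable]: "W k \<in> borel_measurable M" for k
    using W distributed_measurable[of M lborel "W k"] by (auto simp: iid_std_normal_def)
  show "X i \<in> borel_measurable M" if "i < m" for i
  proof -
    have "X i = (\<lambda>\<omega>. \<mu> i + b i * W k0 \<omega> + s i * W (src i) \<omega>)" using X[OF that] by auto
    thus ?thesis by simp
  qed
  fix a :: "nat \<Rightarrow> real"
  \<comment> \<open>the coefficients of the linear combination with respect to the independent variables\<close>
  define d where "d k = (if k = k0 then \<Sum>i<m. a i * b i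
      else a (inv_into {..<m} src k) * s (inv_into {..<m} src k))" for k
  have d: "d (src i) = a i * s i" if "i < m" for i
  proof -
    have "src i \<noteq> k0" using src(2) that by auto
    thus ?thesis using inv_into_f_f[OF src(1), of i] that by (simp add: d_def)
  qed
  have split: "(\<Sum>k\<in>insert k0 (src ` {..<m}). f k) = f k0 + (\<Sum>i<m. f (src i))" for f :: "_ \<Rightarrow> real"
    using src by (simp add: sum.reindex)
  have "(\<Sum>i<m. a i * X i \<omega>) = (\<Sum>i<m. a i * \<mu> i) + (\<Sum>k\<in>insert k0 (src ` {..<m}). d k * W k \<omega>)" for \<omega>
  proof -
    have "(\<Sum>i<m. a i * X i \<omega>) = (\<Sum>i<m. a i * \<mu> i + a i * b i * W k0 \<omega> + a i * s i * W (src i) \<omega>)"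
      by (intro sum.cong) (auto simp: X algebra_simps)
    also have "\<dots> = (\<Sum>i<m. a i * \<mu> i) + (d k0 * W k0 \<omega> + (\<Sum>i<m. d (src i) * W (src i) \<omega>))"
      by (simp add: sum.distrib d sum_distrib_right) (simp add: d_def sum_distrib_right)
    finally show ?thesis unfolding split .
  qed
  moreover have "(\<Sum>i<m. \<Sum>j<m. a i * factor_covariance b s i j * a j)
      = (\<Sum>k\<in>insert k0 (src ` {..<m}). (d k)\<^sup>2)"
    unfolding split factor_covariance_form by (simp add: d) (simp add: d_def)
  ultimately show "normal_variable M (\<lambda>\<omega>. \<Sum>i<m. a i * X i \<omega>) (\<Sum>i<m. a i * \<mu> i)
      (\<Sum>i<m. \<Sum>j<m. a i * factor_covariance b s i j * a j)"
    using normal_variable_linear_combination[OF W, of "insert k0 (src ` {..<m})" "\<Sum>i<m. a i * \<mu> i" d] by simp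
qed

definition block_mean :: "nat \<Rightarrow> nat \<Rightarrow> real" where
  "block_mean N i = (if i < 96 * N then 0 else if i < 97 * N then 12/5 else 22/5)"

lemma true_nulls_block_mean: "true_nulls (100 * N) (block_mean N) = {..<96 * N}"
  by (auto simp: true_nulls_def block_mean_def split: if_splits)

lemma (in prob_space) block_X_multivariate_normal:
  assumes W: "iid_std_normal M W"
  obtains \<Sigma> where "correlation_matrix (100 * N) \<Sigma>"
    "multivariate_normal M (100 * N) (block_X N W) (block_mean N) \<Sigma>"
proof -
  \<comment> \<open>the loadings on the common factor and on the noise, and the noise variable of each coordinate\<close>
  define b where "b i = (if i < 96 * N then 3/10 else if i < 97 * N then - 3/10 else - 18/25 :: real)" for i
  define s where "s i = (if i < 97 * N then sd1 else sd2)" for i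
  define src where "src i = (if i < 96 * N then Eps i else if i < 97 * N then Eta (i - 96 * N)
    else Xi (i - 97 * N))" for i
  have "correlation_matrix (100 * N) (factor_covariance b s)"
    by (rule correlation_matrix_factor_covariance) (auto simp: b_def s_def sd_squares power_divide)
  moreover have "multivariate_normal M (100 * N) (block_X N W) (block_mean N) (factor_covariance b s)"
  proof (rule multivariate_normal_factor_model[OF W])
    show "inj_on src {..<100 * N}" by (auto simp: inj_on_def src_def split: if_splits)
    show "Common \<notin> src ` {..<100 * N}" by (auto simp: src_def split: if_splits)
    show "block_X N W i \<omega> = block_mean N i + b i * W Common \<omega> + s i * W (src i) \<omega>" for i \<omega>
      by (simp add: block_X_def block_mean_def b_def s_def src_def sd1_def sd2_def)
  qed
  ultimately show ?thesis by (rule that)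
qed

section \<open>The false discovery rate exceeds the level\<close>

definition cells :: "cell list" where
  "cells = cells_left @ cells_middle @ cells_right"

lemma cells_ok:
  assumes "c \<in> set cells"
  shows "cell_ok c \<and> u_hi c \<le> 1000"
proof
  show "cell_ok c"
    using assms cells_left_ok cells_middle_ok cells_right_ok by (auto simp: cells_def list_all_iff)
  show "u_hi c \<le> 1000"
    using assms by (auto simp: cells_def cells_left_def cells_middle_def cells_right_def)
qed

lemma cells_disjoint: "sorted_wrt disjoint_cells cells"
  by (simp add: cells_def cells_left_def cells_middle_def cells_right_def disjoint_cells_def)

lemma cells_weight: "(\<Sum>c\<leftarrow>cells. weight c) = 217316"
  by (simp add: cells_def cells_left_def cells_middle_def cells_right_def)

text \<open>The weights add up to a limit of at least \<open>0.0048 * 2.17316 - 0.00001\<close>, which is larger than \<open>0.01042\<close>.\<close>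

lemma block_model_FDR_exceeds:
  "\<forall>\<^sub>F N in sequentially. \<forall>(M :: 'w measure) W. prob_space M \<longrightarrow> iid_std_normal M W \<longrightarrow>
    104/10000 < bh_FDR M (1/100) (100 * N) {..<96 * N} (block_X N W)"
  by (rule block_model_FDR_eventually[OF cells_ok cells_disjoint]) (simp_all add: cells_weight)

theorem theorem1:
  shows
    "(\<forall>\<^sub>F N in sequentially.
        \<forall>(M :: 'w measure) (W :: source \<Rightarrow> 'w \<Rightarrow> real).
          prob_space M \<longrightarrow> iid_std_normal M W \<longrightarrow>
            bh_FDR M 0.01 (100 * N) {..<96 * N} (block_X N W) > 0.0104 \<and> (0.0104 :: real) > 0.01)
     \<and>
     \<not> (\<forall>(m :: nat) (\<mu> :: nat \<Rightarrow> real) (\<Sigma> :: nat \<Rightarrow> nat \<Rightarrow> real) (\<alpha> :: real)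
           (M :: (nat \<Rightarrow> real) measure) (X :: nat \<Rightarrow> (nat \<Rightarrow> real) \<Rightarrow> real).
          m \<ge> 1 \<longrightarrow> correlation_matrix m \<Sigma> \<longrightarrow> 0 < \<alpha> \<longrightarrow> \<alpha> < 1 \<longrightarrow>
          prob_space M \<longrightarrow> multivariate_normal M m X \<mu> \<Sigma> \<longrightarrow>
            bh_FDR M \<alpha> m (true_nulls m \<mu>) X \<le> \<alpha>)"
proof -
  have dec: "(0.01 :: real) = 1/100" "(0.0104 :: real) = 104/10000" by simp_all
  have 1: "\<forall>\<^sub>F N in sequentially. \<forall>(M :: 'w measure) (W :: source \<Rightarrow> 'w \<Rightarrow> real).
      prob_space M \<longrightarrow> iid_std_normal M W \<longrightarrow>
        bh_FDR M 0.01 (100 * N) {..<96 * N} (block_X N W) > 0.0104 \<and> (0.0104 :: real) > 0.01"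
    unfolding dec using block_model_FDR_exceeds by eventually_elim simp
  obtain N where N: "1 \<le> N" and exceeds: "\<And>(M :: (nat \<Rightarrow> real) measure) W. prob_space M \<Longrightarrow> iid_std_normal M W \<Longrightarrow>
      104/10000 < bh_FDR M (1/100) (100 * N) {..<96 * N} (block_X N W)"
    using eventually_happens[OF eventually_conj[OF eventually_ge_at_top[of "1 :: nat"]
      block_model_FDR_exceeds[where 'w = "nat \<Rightarrow> real"]]] by auto
  obtain M :: "(nat \<Rightarrow> real) measure" and W :: "source \<Rightarrow> (nat \<Rightarrow> real) \<Rightarrow> real"
    where M: "prob_space M" "iid_std_normal M W"
    using iid_std_normal_exists by blast
  obtain \<Sigma> where \<Sigma>: "correlation_matrix (100 * N) \<Sigma>"
      "multivariate_normal M (100 * N) (block_X N W) (block_mean N) \<Sigma>"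
    using prob_space.block_X_multivariate_normal[OF M] .
  have "\<not> bh_FDR M (1/100) (100 * N) (true_nulls (100 * N) (block_mean N)) (block_X N W) \<le> 1/100"
    using exceeds[OF M] unfolding true_nulls_block_mean by simp
  moreover have "1 \<le> 100 * N" "(0 :: real) < 1/100" "(1/100 :: real) < 1" using N by simp_all
  ultimately have 2: "\<not> (\<forall>(m :: nat) (\<mu> :: nat \<Rightarrow> real) (\<Sigma> :: nat \<Rightarrow> nat \<Rightarrow> real) (\<alpha> :: real)
           (M :: (nat \<Rightarrow> real) measure) (X :: nat \<Rightarrow> (nat \<Rightarrow> real) \<Rightarrow> real).
          m \<ge> 1 \<longrightarrow> correlation_matrix m \<Sigma> \<longrightarrow> 0 < \<alpha> \<longrightarrow> \<alpha> < 1 \<longrightarrow>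
          prob_space M \<longrightarrow> multivariate_normal M m X \<mu> \<Sigma> \<longrightarrow>
            bh_FDR M \<alpha> m (true_nulls m \<mu>) X \<le> \<alpha>)"
    using M(1) \<Sigma> by blast
  from 1 2 show ?thesis by (rule conjI)
qed

end
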